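(* Let $d\ge 4$. For all forms $f$ in an open dense subset of $\Sigma_{2d}$, the following is true: (a) If $d=4$: For each of the $\binom{8}{2}=28$ pairs $\theta\ne\theta'$ in $\mathrm{Ex}_2(f)$, the interval $[\theta,\theta']$ is contained in the boundary of $\mathrm{Gram}(f)$. For precisely $16$ of these pairs, $[\theta,\theta']$ is a face of $\mathrm{Gram}(f)$. These $16$ edges form a graph (with vertex set $\mathrm{Ex}_2(f)$) isomorphic to $K_{4,4}$, the complete bipartite graph on two sets of four points each. (b) If $d\ge 5$: For any two $\theta\ne\theta'$ in $\mathrm{Ex}_2(f)$, the line segment $[\theta,\theta']$ is a face of $\mathrm{Gram}(f)$.
   Context: Let $V=\mathbb{R}[x_1,x_2]_d$ be the space of real binary forms of degree $d$, and let $\Sigma_{2d}\subset\mathbb{R}[x_1,x_2]_{2d}$ be the cone of sums of squares of forms in $V$ (with the topology induced from $\mathbb{R}[x_1,x_2]_{2d}$). Let $\mathsf{S}_2V\subset V\otimes V$ be the space of symmetric tensors, let $\mathsf{S}_2^+V=\{\sum_{i=1}^r p_i\otimes p_i: r\ge 0,\ p_i\in V\}$ be the cone of positive semidefinite symmetric tensors, and let $\mu:\mathsf{S}_2V\to\mathbb{R}[x_1,x_2]_{2d}$ be the linear map induced by multiplication $p\otimes q\mapsto pq$. For $f\in\Sigma_{2d}$, the Gram spectrahedron is $\mathrm{Gram}(f)=\mathsf{S}_2^+V\cap\mu^{-1}(f)$, a closed convex set; its boundary is taken relative to its affine hull. The rank of $\theta\in\mathsf{S}_2V$ is the rank of the associated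 linear map $V^\vee\to V$; for $\theta=\sum_{i=1}^r p_i\otimes p_i$ with $p_1,\dots,p_r$ linearly independent it equals $r$. $\mathrm{Ex}_2(f)$ denotes the set of extreme points of $\mathrm{Gram}(f)$ of rank $2$. A convex subset $F$ of a closed convex set $K$ is a face of $K$ if $x,y\in K$, $0<t<1$ and $(1-t)x+ty\in F$ imply $x,y\in F$; an edge is a one-dimensional face. $[\theta,\theta']$ is the line segment with endpoints $\theta,\theta'$. *)

theory Defs
  imports
    "HOL-Analysis.Analysis"
    "HOL-Analysis.Finite_Function_Topology"
    "Graph_Theory.Kuratowski"
begin

text \<open>
  The polynomial ring \<open>\<real>[x\<^sub>1,x\<^sub>2]\<close> is the monoid algebra of \<open>\<nat> \<times> \<nat>\<close>: the monomial
  \<open>x\<^sub>1\<^sup>i x\<^sub>2\<^sup>j\<close> is \<open>Poly_Mapping.single (i, j) 1\<close>, and ring structure, vector space structure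
  and norm (the \<open>\<ell>\<^sup>1\<close>-norm of the coefficients) are those of the type \<open>poly_mapping\<close>.
  On the finite-dimensional spaces of forms the norm induces the usual topology.
\<close>
type_synonym bpoly = "(nat \<times> nat) \<Rightarrow>\<^sub>0 real"

text \<open>
  \<open>\<real>[x\<^sub>1,x\<^sub>2] \<otimes> \<real>[x\<^sub>1,x\<^sub>2]\<close> is the vector space with basis the pairs of monomials.
\<close>
type_synonym btensor = "((nat \<times> nat) \<times> (nat \<times> nat)) \<Rightarrow>\<^sub>0 real"

definition forms :: "nat \<Rightarrow> bpoly set" where
  "forms d = {p. \<forall>m \<in> Poly_Mapping.keys p. fst m + snd m = d}"

definition sos_cone :: "nat \<Rightarrow> bpoly set" where
  "sos_cone d = {f. \<exists>r p. (\<forall>i<r. p i \<in> forms d) \<and> f = (\<Sum>i<(r::nat). (p i)^2)}"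

definition tensor :: "bpoly \<Rightarrow> bpoly \<Rightarrow> btensor" where
  "tensor p q = (\<Sum>a \<in> Poly_Mapping.keys p. \<Sum>b \<in> Poly_Mapping.keys q.
     Poly_Mapping.single (a, b) (Poly_Mapping.lookup p a * Poly_Mapping.lookup q b))"

definition psd_tensors :: "nat \<Rightarrow> btensor set" where
  "psd_tensors d = {\<theta>. \<exists>r p. (\<forall>i<r. p i \<in> forms d) \<and> \<theta> = (\<Sum>i<(r::nat). tensor (p i) (p i))}"

text \<open>
  The multiplication map; it is defined on all tensors, see \<open>linear_mult_map\<close> and
  \<open>mult_map_tensor\<close>.
\<close>
definition mult_map :: "btensor \<Rightarrow> bpoly" where
  "mult_map \<theta> = (\<Sum>m \<in> Poly_Mapping.keys \<theta>.
     Poly_Mapping.single (fst m + snd m) (Poly_Mapping.lookup \<theta> m))"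

definition Gram :: "nat \<Rightarrow> bpoly \<Rightarrow> btensor set" where
  "Gram d f = {\<theta> \<in> psd_tensors d. mult_map \<theta> = f}"

text \<open>
  The linear map \<open>V\<^sup>\<or> \<rightarrow> V\<close> associated with \<open>\<theta>\<close>, characterised by
  \<open>p \<otimes> q \<mapsto> (l \<mapsto> l(p) q)\<close>, see \<open>tensor_map_tensor\<close>. For \<open>\<theta> \<in> V \<otimes> V\<close> its value at \<open>l\<close> depends only
  on the restriction of \<open>l\<close> to \<open>V\<close>, and each functional on \<open>V\<close> extends to \<open>\<real>[x\<^sub>1,x\<^sub>2]\<close>, so that the
  image of the dual of \<open>\<real>[x\<^sub>1,x\<^sub>2]\<close> is that of \<open>V\<^sup>\<or>\<close>.
\<close>
definition tensor_map :: "btensor \<Rightarrow> (bpoly \<Rightarrow> real) \<Rightarrow> bpoly" where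
  "tensor_map \<theta> l = (\<Sum>m \<in> Poly_Mapping.keys \<theta>.
     (Poly_Mapping.lookup \<theta> m * l (Poly_Mapping.single (fst m) 1)) *\<^sub>R
       Poly_Mapping.single (snd m) 1)"

definition tensor_rank :: "btensor \<Rightarrow> nat" where
  "tensor_rank \<theta> = dim {tensor_map \<theta> l |l. linear l}"

definition Ex2 :: "nat \<Rightarrow> bpoly \<Rightarrow> btensor set" where
  "Ex2 d f = {\<theta>. \<theta> extreme_point_of (Gram d f) \<and> tensor_rank \<theta> = 2}"

text \<open>
  The graph of those edges of the Gram spectrahedron that join two points of \<open>Ex2\<close>, as a symmetric
  digraph: each edge gives two arcs.
\<close>
definition edge_graph :: "nat \<Rightarrow> bpoly \<Rightarrow> btensor pair_pre_digraph" where
  "edge_graph d f =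
     \<lparr> pverts = Ex2 d f,
       parcs = {(\<theta>, \<theta>'). \<theta> \<in> Ex2 d f \<and> \<theta>' \<in> Ex2 d f \<and> \<theta> \<noteq> \<theta>' \<and>
                  closed_segment \<theta> \<theta>' face_of Gram d f} \<rparr>"

lemma lookup_scaleR_pm [simp]:
  "Poly_Mapping.lookup (c *\<^sub>R p) m = c *\<^sub>R Poly_Mapping.lookup p m"
  for p :: "'a \<Rightarrow>\<^sub>0 real"
proof -
  have "finite {i. c *\<^sub>R Poly_Mapping.lookup p i \<noteq> 0}"
    by (rule finite_subset[OF _ finite_keys[of p]]) (auto simp: in_keys_iff)
  then show ?thesis
    by (simp add: scaleR_poly_mapping_def Abs_poly_mapping_inverse)
qed

lemma linear_pm_sum:
  fixes h :: "'a \<Rightarrow> 'v::real_vector"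
  shows "linear (\<lambda>\<theta> :: 'a \<Rightarrow>\<^sub>0 real. \<Sum>m \<in> Poly_Mapping.keys \<theta>. Poly_Mapping.lookup \<theta> m *\<^sub>R h m)"
    (is "linear ?F")
proof (rule linearI)
  have ext: "?F \<theta> = (\<Sum>m \<in> S. Poly_Mapping.lookup \<theta> m *\<^sub>R h m)"
    if "finite S" "Poly_Mapping.keys \<theta> \<subseteq> S" for S \<theta>
    by (rule sum.mono_neutral_left) (use that in \<open>auto simp: in_keys_iff\<close>)
  show "?F (x + y) = ?F x + ?F y" for x y
  proof -
    let ?S = "Poly_Mapping.keys x \<union> Poly_Mapping.keys y"
    have "?F (x + y) = (\<Sum>m\<in>?S. Poly_Mapping.lookup (x + y) m *\<^sub>R h m)"
      by (rule ext) (simp_all add: Poly_Mapping.keys_add)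
    also have "\<dots> = (\<Sum>m\<in>?S. Poly_Mapping.lookup x m *\<^sub>R h m) + (\<Sum>m\<in>?S. Poly_Mapping.lookup y m *\<^sub>R h m)"
      by (simp add: lookup_add scaleR_add_left sum.distrib)
    also have "\<dots> = ?F x + ?F y"
      by (simp add: ext[of ?S x] ext[of ?S y])
    finally show ?thesis .
  qed
  show "?F (c *\<^sub>R x) = c *\<^sub>R ?F x" for c x
  proof -
    have "Poly_Mapping.keys (c *\<^sub>R x) \<subseteq> Poly_Mapping.keys x"
      by (auto simp: in_keys_iff)
    then have "?F (c *\<^sub>R x) = (\<Sum>m \<in> Poly_Mapping.keys x. Poly_Mapping.lookup (c *\<^sub>R x) m *\<^sub>R h m)"
      by (intro ext finite_keys)
    then show ?thesis
      by (simp add: scaleR_sum_right)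
  qed
qed

lemma single_conv_scaleR:
  "Poly_Mapping.single m c = c *\<^sub>R Poly_Mapping.single m (1::real)"
  by (rule poly_mapping_eqI) (simp add: lookup_single when_def)

lemma pm_expand:
  "(\<Sum>m \<in> Poly_Mapping.keys p. Poly_Mapping.lookup p m *\<^sub>R Poly_Mapping.single m (1::real)) = p"
  by (rule poly_mapping_eqI)
     (auto simp: lookup_sum lookup_single when_def in_keys_iff if_distrib cong: if_cong)

lemma linear_mult_map: "linear mult_map"
  using linear_pm_sum[of "\<lambda>m :: (nat \<times> nat) \<times> (nat \<times> nat). Poly_Mapping.single (fst m + snd m) (1::real)"]
  by (simp add: mult_map_def[abs_def] single_conv_scaleR[symmetric])

lemma linear_tensor_map: "linear (\<lambda>\<theta>. tensor_map \<theta> l)"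
  using linear_pm_sum[of "\<lambda>m. l (Poly_Mapping.single (fst m) 1) *\<^sub>R Poly_Mapping.single (snd m) (1::real)"]
  by (simp add: tensor_map_def)

lemma mult_map_single: "mult_map (Poly_Mapping.single (a, b) c) = Poly_Mapping.single (a + b) c"
  by (simp add: mult_map_def)

lemma mult_map_tensor: "mult_map (tensor p q) = p * q"
proof -
  have "mult_map (tensor p q) =
      (\<Sum>a \<in> Poly_Mapping.keys p. Poly_Mapping.single a (Poly_Mapping.lookup p a)) *
      (\<Sum>b \<in> Poly_Mapping.keys q. Poly_Mapping.single b (Poly_Mapping.lookup q b))"
    by (simp add: tensor_def linear_sum[OF linear_mult_map] mult_map_single sum_product mult_single)
  also have "\<dots> = p * q"
    by (simp add: single_conv_scaleR[of _ "Poly_Mapping.lookup _ _"] pm_expand)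
  finally show ?thesis .
qed

lemma tensor_map_tensor:
  assumes "linear l"
  shows "tensor_map (tensor p q) l = l p *\<^sub>R q"
proof -
  have single: "tensor_map (Poly_Mapping.single (a, b) c) l
      = (c * l (Poly_Mapping.single a 1)) *\<^sub>R Poly_Mapping.single b 1" for a b c
    by (cases "c = 0") (simp_all add: tensor_map_def)
  have "tensor_map (tensor p q) l =
      (\<Sum>a \<in> Poly_Mapping.keys p. Poly_Mapping.lookup p a * l (Poly_Mapping.single a 1)) *\<^sub>R
      (\<Sum>b \<in> Poly_Mapping.keys q. Poly_Mapping.lookup q b *\<^sub>R Poly_Mapping.single b 1)"
    unfolding tensor_def linear_sum[OF linear_tensor_map] single scaleR_sum_left
    by (intro sum.cong refl) (simp add: scaleR_sum_right mult_ac)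
  also have "(\<Sum>a \<in> Poly_Mapping.keys p. Poly_Mapping.lookup p a * l (Poly_Mapping.single a 1)) =
      l (\<Sum>a \<in> Poly_Mapping.keys p. Poly_Mapping.lookup p a *\<^sub>R Poly_Mapping.single a 1)"
    by (simp add: linear_sum[OF assms] linear_scale[OF assms])
  finally show ?thesis
    by (simp add: pm_expand)
qed

lemma tensor_rank_sum_tensor:
  assumes "finite I" and inj: "inj_on p I" and indep: "independent (p ` I)"
  shows "tensor_rank (\<Sum>i\<in>I. tensor (p i) (p i)) = card I"
proof -
  let ?\<theta> = "\<Sum>i\<in>I. tensor (p i) (p i)"
  have map: "tensor_map ?\<theta> l = (\<Sum>i\<in>I. l (p i) *\<^sub>R p i)" if "linear l" for l
    by (simp add: linear_sum[OF linear_tensor_map] tensor_map_tensor[OF that])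
  have "{tensor_map ?\<theta> l |l. linear l} = span (p ` I)"
  proof (intro equalityI subsetI)
    fix x assume "x \<in> {tensor_map ?\<theta> l |l. linear l}"
    then show "x \<in> span (p ` I)"
      by (force simp: map intro: span_sum span_scale span_base)
  next
    fix x assume "x \<in> span (p ` I)"
    then obtain c where "x = (\<Sum>v\<in>p ` I. c v *\<^sub>R v)"
      using span_finite[of "p ` I"] \<open>finite I\<close> by auto
    then have x: "x = (\<Sum>i\<in>I. c (p i) *\<^sub>R p i)"
      by (simp add: sum.reindex[OF inj])
    obtain l where l: "linear l" "\<forall>v\<in>p ` I. l v = c v"
      using linear_independent_extend[OF indep, of c] by auto
    then have "x = tensor_map ?\<theta> l"
      by (simp add: map x)
    then show "x \<in> {tensor_map ?\<theta> l |l. linear l}"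
      using l by blast
  qed
  then show ?thesis
    by (simp add: tensor_rank_def dim_eq_card_independent[OF indep] card_image[OF inj])
qed

end

theory Submission
  imports Defs "HOL-Computational_Algebra.Fundamental_Theorem_Algebra"
begin

text \<open>
  Setting the second variable to one turns a form of degree \<open>d\<close> into a polynomial of degree at
  most \<open>d\<close>, and a representation \<open>f = p\<^sup>2 + q\<^sup>2\<close> into a factorisation \<open>f = g * cnj g\<close> with
  \<open>g = p + \<i> q\<close>. So the Gram tensors of rank two are given by the choices of one root from each of
  the \<open>d\<close> conjugate pairs of roots of \<open>f\<close>, up to conjugating all of them
  (\<open>rank_two_two_squares\<close>, \<open>conjugate_factor_choice\<close>). Two such points come from factors \<open>a b\<close> and
  \<open>a (cnj b)\<close>, where \<open>a\<close> collects the roots on which the choices agree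
  (\<open>Ex2_pair_splitting\<close>).

  Let \<open>a1, a2\<close> and \<open>b1, b2\<close> be the real and imaginary parts of \<open>a\<close> and \<open>b\<close>. The smallest face
  that contains both points lives on the span of the four products \<open>ai bj\<close>, and its dimension is the
  number of independent quadratic relations between them. One relation is always there,
  \<open>(a1 b1) (a2 b2) = (a1 b2) (a2 b1)\<close>; it is the direction of the segment. There is no
  other one if the nine products of \<open>a1\<^sup>2, a1 a2, a2\<^sup>2\<close> with \<open>b1\<^sup>2, b1 b2, b2\<^sup>2\<close> are independent, and
  then the segment is a face (\<open>biquadratic_indep_segment_face\<close>). If one of \<open>a, b\<close> has degree at
  least three, the nine products are independent for some choice of roots
  (\<open>generic_minor_example\<close>), hence for generic roots. As the degrees of \<open>a\<close> and \<open>b\<close> add up to \<open>d\<close>,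
  this covers all pairs if \<open>d \<ge> 5\<close>; if \<open>d = 4\<close>, it leaves the case of degrees two and two.
  In this case the planes spanned by \<open>a1, a2\<close> and by \<open>b1, b2\<close> meet in the
  three-dimensional space of quadratic forms, which yields a second relation
  (\<open>two_two_not_face\<close>). So for \<open>d = 4\<close> two choices of roots are joined by an edge if and only if
  they differ in an odd number of places; the parity of a choice gives the two sides of
  the complete bipartite graph. The segments lie in the boundary because their points have rank
  at most four, while some Gram tensor has rank five (\<open>generic_full_support\<close>).

  A positive form depends continuously on its leading coefficient and its roots. The independence
  conditions are the non-vanishing of polynomials in the roots and their conjugates, so that
  genericity is dense; and it is open, since the roots of a form stay bounded near a form with
  nonzero leading coefficient (\<open>generic_forms_dense\<close>, \<open>openin_generic_forms\<close>).
\<close>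

abbreviation "lookup \<equiv> Poly_Mapping.lookup"
abbreviation "keys \<equiv> Poly_Mapping.keys"
abbreviation "single \<equiv> Poly_Mapping.single"

section \<open>Symmetric tensors and their supports\<close>

lemma lookup_tensor: "lookup (tensor p q) (a, b) = lookup p a * lookup q b"
proof -
  have "lookup (tensor p q) (a, b) =
     (\<Sum>a'\<in>keys p. \<Sum>b'\<in>keys q.
        if a' = a then if b' = b then lookup p a * lookup q b else 0 else 0)"
    by (auto simp: tensor_def lookup_sum lookup_single when_def intro!: sum.cong)
  also have "\<dots> = (\<Sum>a'\<in>keys p. if a' = a then (\<Sum>b'\<in>keys q.
        if b' = b then lookup p a * lookup q b else 0) else 0)"
    by (intro sum.cong refl) simp
  also have "\<dots> = lookup p a * lookup q b"
    by (auto simp: in_keys_iff)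
  finally show ?thesis .
qed

lemma tensor_eqI:
  assumes "\<And>a b. lookup x (a, b) = lookup y (a, b)"
  shows "x = (y :: btensor)"
  using assms by (intro poly_mapping_eqI) auto

lemma tensor_add_left: "tensor (p + p') q = tensor p q + tensor p' q"
  and tensor_add_right: "tensor p (q + q') = tensor p q + tensor p q'"
  and tensor_diff_left: "tensor (p - p') q = tensor p q - tensor p' q"
  and tensor_diff_right: "tensor p (q - q') = tensor p q - tensor p q'"
  and tensor_minus_left: "tensor (- p) q = - tensor p q"
  and tensor_minus_right: "tensor p (- q) = - tensor p q"
  and tensor_scale_left: "tensor (c *\<^sub>R p) q = c *\<^sub>R tensor p q"
  and tensor_scale_right: "tensor p (c *\<^sub>R q) = c *\<^sub>R tensor p q"
  by (rule tensor_eqI, simp add: lookup_tensor lookup_add lookup_minus algebra_simps)+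

lemmas tensor_bilinear = tensor_add_left tensor_add_right tensor_diff_left tensor_diff_right
  tensor_minus_left tensor_minus_right tensor_scale_left tensor_scale_right

lemma tensor_sum_left: "tensor (\<Sum>i\<in>I. p i) q = (\<Sum>i\<in>I. tensor (p i) q)"
  and tensor_sum_right: "tensor q (\<Sum>i\<in>I. p i) = (\<Sum>i\<in>I. tensor q (p i))"
  by (rule tensor_eqI, simp add: lookup_tensor lookup_sum sum_distrib_left sum_distrib_right)+

lemma tensor_0 [simp]: "tensor 0 q = 0" "tensor p 0 = 0"
  by (rule tensor_eqI, simp add: lookup_tensor)+

lemma tensor_square_plane:
  "tensor (\<alpha> *\<^sub>R p + \<beta> *\<^sub>R q) (\<alpha> *\<^sub>R p + \<beta> *\<^sub>R q) =
    \<alpha>\<^sup>2 *\<^sub>R tensor p p + (\<alpha> * \<beta>) *\<^sub>R (tensor p q + tensor q p) + \<beta>\<^sup>2 *\<^sub>R tensor q q"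
  by (rule tensor_eqI) (simp add: lookup_tensor lookup_add algebra_simps power2_eq_square)

text \<open>
  Sums over an index set stand for linear combinations, so that no distinctness of the vectors has
  to be carried along.
\<close>
definition lin_indep :: "nat \<Rightarrow> (nat \<Rightarrow> bpoly) \<Rightarrow> bool" where
  "lin_indep n u \<longleftrightarrow> (\<forall>c. (\<Sum>s<n. c s *\<^sub>R u s) = 0 \<longrightarrow> (\<forall>s<n. c s = 0))"

lemma lin_indepD: "lin_indep n u \<Longrightarrow> (\<Sum>s<n. c s *\<^sub>R u s) = 0 \<Longrightarrow> s < n \<Longrightarrow> c s = 0"
  by (auto simp: lin_indep_def)

definition quad_tensor :: "nat \<Rightarrow> (nat \<Rightarrow> bpoly) \<Rightarrow> (nat \<Rightarrow> nat \<Rightarrow> real) \<Rightarrow> btensor" where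
  "quad_tensor n u C = (\<Sum>s<n. \<Sum>t<n. C s t *\<^sub>R tensor (u s) (u t))"

lemma quad_tensor_eq_0:
  assumes u: "lin_indep n u" and 0: "quad_tensor n u C = 0" and "s < n" "t < n"
  shows "C s t = 0"
proof -
  have *: "(\<Sum>s<n. \<Sum>t<n. C s t * (lookup (u s) a * lookup (u t) b)) = 0" for a b
    using arg_cong[OF 0, of "\<lambda>x. lookup x (a, b)"]
    by (simp add: quad_tensor_def lookup_sum lookup_tensor)
  have "(\<Sum>s<n. (\<Sum>t<n. C s t * lookup (u t) b) *\<^sub>R u s) = 0" for b
    by (rule poly_mapping_eqI)
      (use * in \<open>simp add: lookup_sum sum_distrib_left sum_distrib_right mult_ac\<close>)
  then have "(\<Sum>t<n. C s t * lookup (u t) b) = 0" for b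
    by (rule lin_indepD[OF u _ \<open>s < n\<close>])
  then have "(\<Sum>t<n. C s t *\<^sub>R u t) = 0"
    by (intro poly_mapping_eqI) (simp add: lookup_sum)
  then show ?thesis
    by (rule lin_indepD[OF u _ \<open>t < n\<close>])
qed

lemma quad_tensor_diff: "quad_tensor n u C - quad_tensor n u D = quad_tensor n u (\<lambda>s t. C s t - D s t)"
  by (simp add: quad_tensor_def scaleR_diff_left sum_subtractf)

lemma mult_map_quad_tensor:
  "mult_map (quad_tensor n u C) = (\<Sum>s<n. \<Sum>t<n. C s t *\<^sub>R (u s * u t))"
  by (simp add: quad_tensor_def linear_sum[OF linear_mult_map] linear_scale[OF linear_mult_map]
    mult_map_tensor)

lemma in_span_image_lessThan:
  fixes n :: nat
  assumes "x \<in> span (u ` {..<n})"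
  shows "\<exists>c. x = (\<Sum>s<n. c s *\<^sub>R (u s :: bpoly))"
  using assms
proof (induction rule: span_induct_alt)
  case base
  show ?case by (intro exI[of _ "\<lambda>_. 0"]) simp
next
  case (step c x y)
  then obtain s e where s: "s < n" "x = u s" and y: "y = (\<Sum>s<n. e s *\<^sub>R u s)"
    by auto
  have "(\<Sum>t<n. (if t = s then c else 0) *\<^sub>R u t) = c *\<^sub>R x"
    using s by (simp add: if_distrib[of "\<lambda>c. c *\<^sub>R _"] sum.delta cong: if_cong)
  then have "c *\<^sub>R x + y = (\<Sum>t<n. ((if t = s then c else 0) + e t) *\<^sub>R u t)"
    by (simp add: scaleR_add_left sum.distrib y)
  then show ?case
    by (intro exI[of _ "\<lambda>t. (if t = s then c else 0) + e t"]) simp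
qed

lemma sum_square_tensors_in_span:
  assumes "\<And>i. i \<in> I \<Longrightarrow> p i \<in> span (u ` {..<n})"
  shows "\<exists>C. (\<forall>s t. C s t = C t s) \<and> (\<Sum>i\<in>I. tensor (p i) (p i)) = quad_tensor n u C"
proof -
  have "\<forall>i\<in>I. \<exists>c. p i = (\<Sum>s<n. c s *\<^sub>R u s)"
    using assms in_span_image_lessThan by blast
  then obtain c where c: "\<And>i. i \<in> I \<Longrightarrow> p i = (\<Sum>s<n. c i s *\<^sub>R u s)"
    by metis
  have "(\<Sum>i\<in>I. tensor (p i) (p i)) =
      (\<Sum>i\<in>I. \<Sum>s<n. \<Sum>t<n. (c i s * c i t) *\<^sub>R tensor (u s) (u t))"
  proof (intro sum.cong refl)
    fix i assume "i \<in> I"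
    then show "tensor (p i) (p i) = (\<Sum>s<n. \<Sum>t<n. (c i s * c i t) *\<^sub>R tensor (u s) (u t))"
      unfolding c[OF \<open>i \<in> I\<close>] tensor_sum_left
      by (simp add: tensor_sum_right tensor_bilinear scaleR_sum_right mult.commute)
  qed
  also have "\<dots> = quad_tensor n u (\<lambda>s t. \<Sum>i\<in>I. c i s * c i t)"
    unfolding quad_tensor_def scaleR_sum_left
    by (subst sum.swap, intro sum.cong refl, subst sum.swap) simp
  finally show ?thesis
    by (intro exI[of _ "\<lambda>s t. \<Sum>i\<in>I. c i s * c i t"]) (simp add: mult.commute)
qed

text \<open>
  The quadratic form on functionals attached to a tensor detects supports: on a sum of squares it is
  a sum of squares of real numbers.
\<close>
definition quad_form :: "btensor \<Rightarrow> (bpoly \<Rightarrow> real) \<Rightarrow> real" where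
  "quad_form \<theta> l = l (tensor_map \<theta> l)"

lemma linear_quad_form: "linear l \<Longrightarrow> linear (\<lambda>\<theta>. quad_form \<theta> l)"
  unfolding quad_form_def using linear_compose[OF linear_tensor_map, of l l] by (simp add: o_def)

lemma quad_form_tensor: "linear l \<Longrightarrow> quad_form (tensor p q) l = l p * l q"
  by (simp add: quad_form_def tensor_map_tensor linear_scale)

lemma quad_form_sum_squares:
  "linear l \<Longrightarrow> quad_form (\<Sum>i\<in>I. tensor (p i) (p i)) l = (\<Sum>i\<in>I. (l (p i))\<^sup>2)"
  by (simp add: linear_sum[OF linear_quad_form] quad_form_tensor power2_eq_square)

lemma separating_functional:
  assumes "subspace W" "(v :: bpoly) \<notin> W"
  obtains l :: "bpoly \<Rightarrow> real" where "linear l" "\<And>w. w \<in> W \<Longrightarrow> l w = 0" "l v = 1"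
proof -
  obtain B where B: "B \<subseteq> W" "independent B" "W \<subseteq> span B"
    using maximal_independent_subset[of W] by blast
  have span: "span B = W"
    using B assms(1) by (metis span_minimal subset_antisym)
  have "independent (insert v B)"
    using B assms span by (simp add: independent_insert)
  then obtain l :: "bpoly \<Rightarrow> real"
    where l: "linear l" "\<forall>x\<in>insert v B. l x = (if x = v then 1 else 0)"
    using linear_independent_extend[of "insert v B" "\<lambda>x. if x = v then 1 else 0"] by blast
  have "l w = 0" if "w \<in> W" for w
  proof -
    have "w \<in> span B" using that span by simp
    moreover have "l x = 0" if "x \<in> B" for x
      using that l B assms by auto
    ultimately show ?thesis
      using linear_eq_0_on_span[OF l(1)] by blast
  qed
  then show ?thesis using that l by auto
qed

lemma sum_squares_support:
  assumes W: "subspace W" and I: "finite I"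
    and 0: "\<And>l. linear l \<Longrightarrow> (\<And>w. w \<in> W \<Longrightarrow> l w = 0) \<Longrightarrow> quad_form (\<Sum>i\<in>I. tensor (p i) (p i)) l = 0"
    and "i \<in> I"
  shows "p i \<in> W"
proof (rule ccontr)
  assume "p i \<notin> W"
  then obtain l :: "bpoly \<Rightarrow> real"
    where l: "linear l" "\<And>w. w \<in> W \<Longrightarrow> l w = 0" "l (p i) = 1"
    using separating_functional[OF W] by blast
  have "(\<Sum>i\<in>I. (l (p i))\<^sup>2) = 0"
    using 0[OF l(1,2)] quad_form_sum_squares[OF l(1), of p I] by simp
  then show False
    using I \<open>i \<in> I\<close> l(3) by (auto simp: sum_nonneg_eq_0_iff)
qed

lemma quad_form_psd_nonneg: "\<theta> \<in> psd_tensors d \<Longrightarrow> linear l \<Longrightarrow> 0 \<le> quad_form \<theta> l"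
  by (auto simp: psd_tensors_def quad_form_sum_squares intro!: sum_nonneg)

text \<open>
  If a point lies strictly between two positive semidefinite tensors, its support contains theirs;
  this is how the face of a Gram spectrahedron around a point is cut out by linear equations.
\<close>
lemma psd_open_segment_support:
  assumes x: "x \<in> psd_tensors d" and y: "y \<in> psd_tensors d" and z: "z \<in> open_segment x y"
    and 0: "\<And>l. linear l \<Longrightarrow> (\<And>s. s < n \<Longrightarrow> l (u s) = 0) \<Longrightarrow> quad_form z l = 0"
  shows "\<exists>C. (\<forall>s t. C s t = C t s) \<and> x = quad_tensor n u C"
proof -
  obtain t where t: "0 < t" "t < 1" "z = (1 - t) *\<^sub>R x + t *\<^sub>R y"
    using z by (auto simp: in_segment)
  obtain r p where p: "x = (\<Sum>i<(r::nat). tensor (p i) (p i))"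
    using x by (auto simp: psd_tensors_def)
  have "p i \<in> span (u ` {..<n})" if "i \<in> {..<r}" for i
  proof (rule sum_squares_support[where I = "{..<r}" and p = p])
    fix l :: "bpoly \<Rightarrow> real"
    assume l: "linear l" and "\<And>w. w \<in> span (u ` {..<n}) \<Longrightarrow> l w = 0"
    then have "l (u s) = 0" if "s < n" for s
      using that by (simp add: span_base)
    then have "0 = quad_form z l"
      using 0[OF l] by simp
    also have "\<dots> = (1 - t) * quad_form x l + t * quad_form y l"
      by (simp add: t(3) linear_add[OF linear_quad_form[OF l]] linear_scale[OF linear_quad_form[OF l]])
    finally have "(1 - t) * quad_form x l + t * quad_form y l = 0" by simp
    moreover have "0 \<le> (1 - t) * quad_form x l" "0 \<le> t * quad_form y l"
      using t quad_form_psd_nonneg[OF x l] quad_form_psd_nonneg[OF y l] by simp_all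
    ultimately have "quad_form x l = 0"
      using t by (auto simp: add_nonneg_eq_0_iff)
    then show "quad_form (\<Sum>i<r. tensor (p i) (p i)) l = 0"
      using p by simp
  qed (use that in auto)
  then show ?thesis
    using sum_square_tensors_in_span[of "{..<r}" p u n] p by simp
qed

lemma forms_subspace: "subspace (forms d)"
proof (rule subspaceI)
  fix x y :: bpoly and c :: real
  show "0 \<in> forms d" by (simp add: forms_def)
  show "x + y \<in> forms d" if "x \<in> forms d" "y \<in> forms d"
    using that Poly_Mapping.keys_add[of x y] by (auto simp: forms_def)
  show "c *\<^sub>R x \<in> forms d" if "x \<in> forms d"
  proof -
    have "keys (c *\<^sub>R x) \<subseteq> keys x"
      by (auto simp: in_keys_iff)
    then show ?thesis using that by (auto simp: forms_def)
  qed
qed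

lemma forms_mult: "p \<in> forms k \<Longrightarrow> q \<in> forms m \<Longrightarrow> p * q \<in> forms (k + m)"
  using keys_mult[of p q] by (fastforce simp: forms_def)

lemma psd_tensors_add:
  assumes "x \<in> psd_tensors d" "y \<in> psd_tensors d"
  shows "x + y \<in> psd_tensors d"
proof -
  obtain r p where p: "\<forall>i<r. p i \<in> forms d" "x = (\<Sum>i<(r::nat). tensor (p i) (p i))"
    using assms by (auto simp: psd_tensors_def)
  obtain r' p' where p': "\<forall>i<r'. p' i \<in> forms d" "y = (\<Sum>i<(r'::nat). tensor (p' i) (p' i))"
    using assms by (auto simp: psd_tensors_def)
  let ?p = "\<lambda>i. if i < r then p i else p' (i - r)"
  have "(\<Sum>i<r + m. tensor (?p i) (?p i)) = x + (\<Sum>i<m. tensor (p' i) (p' i))" for m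
    by (induction m) (simp_all add: p(2) add.assoc)
  then have "(\<Sum>i<r + r'. tensor (?p i) (?p i)) = x + y"
    by (simp add: p'(2))
  then show ?thesis
    using p p' by (auto simp: psd_tensors_def intro!: exI[of _ "r + r'"] exI[of _ ?p])
qed

lemma psd_tensors_scale:
  assumes "x \<in> psd_tensors d" "0 \<le> c"
  shows "c *\<^sub>R x \<in> psd_tensors d"
proof -
  obtain r p where p: "\<forall>i<r. p i \<in> forms d" "x = (\<Sum>i<(r::nat). tensor (p i) (p i))"
    using assms by (auto simp: psd_tensors_def)
  have "c *\<^sub>R x = (\<Sum>i<r. tensor (sqrt c *\<^sub>R p i) (sqrt c *\<^sub>R p i))"
    using assms(2) by (simp add: p tensor_bilinear scaleR_sum_right)
  moreover have "\<forall>i<r. sqrt c *\<^sub>R p i \<in> forms d"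
    using p subspace_scale[OF forms_subspace] by blast
  ultimately show ?thesis
    unfolding psd_tensors_def
    by (intro CollectI exI[of _ r] exI[of _ "\<lambda>i. sqrt c *\<^sub>R p i"]) simp
qed

lemma psd_square: "p \<in> forms d \<Longrightarrow> tensor p p \<in> psd_tensors d"
  by (auto simp: psd_tensors_def intro!: exI[of _ 1] exI[of _ "\<lambda>_. p"])

lemma psd_sum: "(\<And>i. i \<in> I \<Longrightarrow> x i \<in> psd_tensors d) \<Longrightarrow> (\<Sum>i\<in>I. x i) \<in> psd_tensors d"
proof (induction I rule: infinite_finite_induct)
  case (insert i I)
  then show ?case by (simp add: psd_tensors_add)
qed (auto simp: psd_tensors_def intro!: exI[of _ 0])

section \<open>Gram tensors of rank two\<close>

text \<open>
  Completing the square: a positive semidefinite tensor supported on a plane is a sum of two squares.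
\<close>
lemma plane_tensor_two_squares:
  assumes C: "C 0 1 = C 1 (0::nat)" "C 0 0 = (\<Sum>i\<in>I. (a i)\<^sup>2)" "C 0 1 = (\<Sum>i\<in>I. a i * b i)" "C 1 1 = (\<Sum>i\<in>I. (b i)\<^sup>2)"
  and I: "finite I"
  shows "\<exists>\<alpha> \<beta> \<gamma>. quad_tensor 2 u C =
    tensor (\<alpha> *\<^sub>R u 0 + \<beta> *\<^sub>R u 1) (\<alpha> *\<^sub>R u 0 + \<beta> *\<^sub>R u 1) + tensor (\<gamma> *\<^sub>R u 1) (\<gamma> *\<^sub>R u 1)"
proof -
  have "(C 0 1)\<^sup>2 \<le> C 0 0 * C 1 1"
    unfolding C(2-4) by (rule Cauchy_Schwarz_ineq_sum)
  have "0 \<le> C 0 0" "0 \<le> C 1 1" unfolding C by (auto intro: sum_nonneg)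
  have exp: "quad_tensor 2 u C = C 0 0 *\<^sub>R tensor (u 0) (u 0) + C 0 1 *\<^sub>R (tensor (u 0) (u 1) + tensor (u 1) (u 0))
     + C 1 1 *\<^sub>R tensor (u 1) (u 1)"
    using C(1) by (simp add: quad_tensor_def eval_nat_numeral algebra_simps)
  show ?thesis
  proof (cases "C 0 0 = 0")
    case True
    then have "C 0 1 = 0" using \<open>(C 0 1)\<^sup>2 \<le> C 0 0 * C 1 1\<close> by simp
    then show ?thesis
      using True \<open>0 \<le> C 1 1\<close>
      by (rule_tac x = 0 in exI, rule_tac x = 0 in exI, rule_tac x = "sqrt (C 1 1)" in exI) (simp add: exp tensor_bilinear)
  next
    case False
    then have pos: "0 < C 0 0" using \<open>0 \<le> C 0 0\<close> by simp
    define e where "e = C 1 1 - (C 0 1)\<^sup>2 / C 0 0"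
    have e: "0 \<le> e"
      using \<open>(C 0 1)\<^sup>2 \<le> C 0 0 * C 1 1\<close> pos by (simp add: e_def field_simps)
    have s: "(sqrt (C 0 0))\<^sup>2 = C 0 0" "(sqrt e)\<^sup>2 = e" "(C 0 1 / sqrt (C 0 0))\<^sup>2 = C 1 1 - e"
      "sqrt (C 0 0) * (C 0 1 / sqrt (C 0 0)) = C 0 1"
      using pos e by (simp_all add: e_def power_divide)
    have "tensor (sqrt e *\<^sub>R u 1) (sqrt e *\<^sub>R u 1) = e *\<^sub>R tensor (u 1) (u 1)"
      using s(2) by (simp add: tensor_bilinear power2_eq_square)
    then have "quad_tensor 2 u C =
        tensor (sqrt (C 0 0) *\<^sub>R u 0 + (C 0 1 / sqrt (C 0 0)) *\<^sub>R u 1)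
          (sqrt (C 0 0) *\<^sub>R u 0 + (C 0 1 / sqrt (C 0 0)) *\<^sub>R u 1) +
        tensor (sqrt e *\<^sub>R u 1) (sqrt e *\<^sub>R u 1)"
      unfolding exp tensor_square_plane s by (simp add: scaleR_diff_left)
    then show ?thesis by blast
  qed
qed

text \<open>
  A functional that vanishes on the image of the associated map vanishes on every \<open>p i\<close> in a
  representation as a sum of squares, so that all \<open>p i\<close> lie in this image, a plane.
\<close>
lemma rank_two_two_squares:
  assumes \<theta>: "\<theta> \<in> psd_tensors d" and rank: "tensor_rank \<theta> = 2"
  shows "\<exists>p q. p \<in> forms d \<and> q \<in> forms d \<and> \<theta> = tensor p p + tensor q q"
proof -
  obtain r p where p: "\<forall>i<r. p i \<in> forms d" "\<theta> = (\<Sum>i<(r::nat). tensor (p i) (p i))"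
    using \<theta> by (auto simp: psd_tensors_def)
  define W where "W = {tensor_map \<theta> l |l. linear l}"
  have W_map: "tensor_map \<theta> l = (\<Sum>i<r. l (p i) *\<^sub>R p i)" if "linear l" for l
    by (simp add: p linear_sum[OF linear_tensor_map] tensor_map_tensor[OF that])
  have W_forms: "W \<subseteq> forms d"
  proof
    fix w assume "w \<in> W"
    then obtain l where l: "linear l" "w = tensor_map \<theta> l" by (auto simp: W_def)
    show "w \<in> forms d"
      unfolding l W_map[OF l(1)]
      by (intro subspace_sum[OF forms_subspace] subspace_scale[OF forms_subspace]) (use p in auto)
  qed
  have "dim W = 2" using rank by (simp add: tensor_rank_def W_def)
  then obtain B where B: "B \<subseteq> W" "independent B" "W \<subseteq> span B" "card B = 2"
    using basis_exists[of W] by metis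
  then obtain v w where vw: "B = {v, w}" "v \<noteq> w" by (auto simp: card_2_iff)
  define u where "u = (\<lambda>i::nat. if i = 0 then v else w)"
  have u: "u ` {..<2} = B" using vw by (auto simp: u_def eval_nat_numeral lessThan_Suc)
  have "p i \<in> span (u ` {..<2})" if "i \<in> {..<r}" for i
  proof (rule sum_squares_support[where I = "{..<r}" and p = p])
    fix l :: "bpoly \<Rightarrow> real"
    assume l: "linear l" "\<And>w. w \<in> span (u ` {..<2}) \<Longrightarrow> l w = 0"
    have "tensor_map \<theta> l \<in> span B" using B l by (auto simp: W_def)
    then show "quad_form (\<Sum>i<r. tensor (p i) (p i)) l = 0"
      using l(2) u by (simp add: quad_form_def p(2)[symmetric])
  qed (use that in auto)
  then have "\<forall>i\<in>{..<r}. \<exists>c. p i = (\<Sum>s<2. c s *\<^sub>R u s)"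
    using in_span_image_lessThan by blast
  then obtain c where c': "\<forall>i\<in>{..<r}. p i = (\<Sum>s<2. c i s *\<^sub>R u s)"
    by metis
  have c: "p i = c i 0 *\<^sub>R u 0 + c i 1 *\<^sub>R u 1" if "i < r" for i
    using c' that by (simp add: eval_nat_numeral)
  define C where "C = (\<lambda>s t. \<Sum>i<r. c i s * c i t)"
  have "\<theta> = quad_tensor 2 u C"
    by (rule tensor_eqI) (simp add: p(2) c lookup_sum lookup_add lookup_tensor quad_tensor_def
        eval_nat_numeral C_def sum_distrib_left sum.distrib algebra_simps)
  moreover obtain \<alpha> \<beta> \<gamma> where "quad_tensor 2 u C =
    tensor (\<alpha> *\<^sub>R u 0 + \<beta> *\<^sub>R u 1) (\<alpha> *\<^sub>R u 0 + \<beta> *\<^sub>R u 1) + tensor (\<gamma> *\<^sub>R u 1) (\<gamma> *\<^sub>R u 1)"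
    using plane_tensor_two_squares[of C "\<lambda>i. c i 0" "{..<r}" "\<lambda>i. c i 1" u]
    by (auto simp: C_def power2_eq_square mult.commute)
  moreover have "u 0 \<in> forms d" "u 1 \<in> forms d"
    using B W_forms vw by (auto simp: u_def)
  ultimately show ?thesis
    by (metis forms_subspace subspace_add subspace_scale)
qed

section \<open>Faces of Gram spectrahedra spanned by two tensors of rank two\<close>

lemma scaleR_bpoly: "c *\<^sub>R p = single 0 c * (p :: bpoly)"
proof -
  have "c *\<^sub>R p = (\<Sum>m\<in>keys p. c *\<^sub>R lookup p m *\<^sub>R single m 1)"
    by (subst pm_expand[of p, symmetric]) (simp add: scaleR_sum_right)
  also have "\<dots> = (\<Sum>m\<in>keys p. single 0 c * single m (lookup p m))"
    by (intro sum.cong refl poly_mapping_eqI) (simp add: mult_single lookup_single when_def)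
  also have "\<dots> = single 0 c * p"
    by (simp add: sum_distrib_left[symmetric] single_conv_scaleR[of _ "lookup _ _"] pm_expand)
  finally show ?thesis .
qed

lemma mult_scaleR_bpoly: "(c *\<^sub>R p) * q = c *\<^sub>R (p * q)" "p * (c *\<^sub>R q) = c *\<^sub>R (p * q)"
  for p q :: bpoly
  by (simp_all add: scaleR_bpoly mult_ac)

lemma scaleR_double: "(2 * c) *\<^sub>R p = 2 * (c *\<^sub>R (p :: bpoly))"
  unfolding mult_2 scaleR_add_left ..

lemma convex_Gram: "convex (Gram d f)"
proof (rule convexI)
  fix x y and u v :: real
  assume "x \<in> Gram d f" "y \<in> Gram d f" and uv: "0 \<le> u" "0 \<le> v" "u + v = 1"
  then show "u *\<^sub>R x + v *\<^sub>R y \<in> Gram d f"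
    by (auto simp: Gram_def linear_add[OF linear_mult_map] linear_scale[OF linear_mult_map]
        scaleR_add_left[symmetric] intro!: psd_tensors_add psd_tensors_scale)
qed

lemma two_squares_in_Gram:
  assumes "p \<in> forms d" "q \<in> forms d"
  shows "tensor p p + tensor q q \<in> Gram d (p * p + q * q)"
  using assms by (simp add: Gram_def psd_tensors_add psd_square linear_add[OF linear_mult_map] mult_map_tensor)

lemma two_squares_quad_tensor:
  "tensor p p + tensor q q =
    quad_tensor 2 (\<lambda>s. if s = 0 then p else q) (\<lambda>s t. if s = t then 1 else 0)"
  by (simp add: quad_tensor_def eval_nat_numeral)

lemma quad_form_quad_tensor_eq_0:
  assumes "linear l" "\<And>s. s < n \<Longrightarrow> l (u s) = 0"
  shows "quad_form (quad_tensor n u C) l = 0"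
  using assms(2)
  by (simp add: quad_tensor_def linear_sum[OF linear_quad_form[OF assms(1)]]
      linear_scale[OF linear_quad_form[OF assms(1)]] quad_form_tensor[OF assms(1)])

text \<open>
  A Gram tensor at the end of a segment through \<open>p \<otimes> p + q \<otimes> q\<close> is supported on the plane of \<open>p\<close> and
  \<open>q\<close>. Independence of \<open>p\<^sup>2\<close>, \<open>p q\<close>, \<open>q\<^sup>2\<close> means that the multiplication map is injective there.
\<close>
lemma two_squares_Ex2:
  assumes p: "p \<in> forms d" and q: "q \<in> forms d"
    and indep: "\<And>x y z. x *\<^sub>R (p * p) + y *\<^sub>R (p * q) + z *\<^sub>R (q * q) = 0 \<Longrightarrow> x = 0 \<and> y = 0 \<and> z = 0"
  shows "tensor p p + tensor q q \<in> Ex2 d (p * p + q * q)"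
proof -
  let ?u = "\<lambda>s::nat. if s = 0 then p else q"
  let ?\<theta> = "tensor p p + tensor q q"
  have in_Gram: "?\<theta> \<in> Gram d (p * p + q * q)"
    by (rule two_squares_in_Gram[OF p q])
  have "p \<noteq> q" using indep[of 1 "-1" 0] by auto
  have lin: "x = 0 \<and> y = 0" if "x *\<^sub>R p + y *\<^sub>R q = 0" for x y
  proof -
    have "x *\<^sub>R (p * p) + y *\<^sub>R (p * q) = p * (x *\<^sub>R p + y *\<^sub>R q)"
      by (simp add: distrib_left mult_scaleR_bpoly)
    also have "\<dots> = 0" using that by simp
    finally show ?thesis
      using indep[of x y 0] by simp
  qed
  have "independent (?u ` {..<2})"
  proof
    assume "dependent (?u ` {..<2})"
    then have "dependent {p, q}"
      by (simp add: eval_nat_numeral lessThan_Suc insert_commute)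
    then obtain c where "\<exists>v\<in>{p, q}. c v \<noteq> 0" "(\<Sum>v\<in>{p, q}. c v *\<^sub>R v) = 0"
      using dependent_finite[of "{p, q}"] by auto
    then show False
      using \<open>p \<noteq> q\<close> lin[of "c p" "c q"] by auto
  qed
  moreover have "inj_on ?u {..<2}"
    using \<open>p \<noteq> q\<close> by (auto simp: inj_on_def)
  ultimately have "tensor_rank (\<Sum>i<2. tensor (?u i) (?u i)) = 2"
    by (subst tensor_rank_sum_tensor) auto
  then have rank: "tensor_rank ?\<theta> = 2"
    by (simp add: eval_nat_numeral)
  have unique: "x = ?\<theta>"
    if x: "x \<in> Gram d (p * p + q * q)" and y: "y \<in> Gram d (p * p + q * q)" and \<theta>: "?\<theta> \<in> open_segment x y" for x y
  proof -
    have "quad_form ?\<theta> l = 0" if "linear l" "\<And>s. s < 2 \<Longrightarrow> l (?u s) = 0" for l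
      unfolding two_squares_quad_tensor using that by (rule quad_form_quad_tensor_eq_0)
    then obtain C where C: "\<And>s t. C s t = C t s" "x = quad_tensor 2 ?u C"
      using psd_open_segment_support[of x d y ?\<theta> 2 ?u] x y \<theta> by (auto simp: Gram_def)
    have "mult_map x = p * p + q * q" using x by (simp add: Gram_def)
    then have "(C 0 0 - 1) *\<^sub>R (p * p) + (2 * C 0 1) *\<^sub>R (p * q) + (C 1 1 - 1) *\<^sub>R (q * q) = 0"
      using C(1)[of 1 0] unfolding C(2) mult_map_quad_tensor
      by (simp add: eval_nat_numeral algebra_simps scaleR_double)
    then have "C 0 0 = 1" "C 0 1 = 0" "C 1 1 = 1"
      using indep by fastforce+
    then show ?thesis
      using C(1)[of 1 0] unfolding C(2) by (simp add: quad_tensor_def eval_nat_numeral)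
  qed
  have "?\<theta> \<notin> open_segment x y"
    if xy: "x \<in> Gram d (p * p + q * q)" "y \<in> Gram d (p * p + q * q)" for x y
  proof
    assume *: "?\<theta> \<in> open_segment x y"
    then have "x = ?\<theta>" using unique xy by blast
    moreover have "y = ?\<theta>" using unique[of y x] xy * by (simp add: open_segment_commute)
    ultimately show False using * by simp
  qed
  then show ?thesis
    using in_Gram rank by (auto simp: Ex2_def extreme_point_of_def)
qed

text \<open>
  A complex form \<open>ab\<close> has real part \<open>a1 b1 - a2 b2\<close> and imaginary part
  \<open>a1 b2 + a2 b1\<close>.
\<close>
definition gram_tensor :: "bpoly \<Rightarrow> bpoly \<Rightarrow> bpoly \<Rightarrow> bpoly \<Rightarrow> btensor" where
  "gram_tensor a1 a2 b1 b2 =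
     tensor (a1 * b1 - a2 * b2) (a1 * b1 - a2 * b2) + tensor (a1 * b2 + a2 * b1) (a1 * b2 + a2 * b1)"

definition prods :: "bpoly \<Rightarrow> bpoly \<Rightarrow> bpoly \<Rightarrow> bpoly \<Rightarrow> nat \<Rightarrow> bpoly" where
  "prods a1 a2 b1 b2 s = (if s < 2 then a1 else a2) * (if even s then b1 else b2)"

lemma prods_simps:
  "prods a1 a2 b1 b2 0 = a1 * b1" "prods a1 a2 b1 b2 1 = a1 * b2"
  "prods a1 a2 b1 b2 (Suc 0) = a1 * b2"
  "prods a1 a2 b1 b2 2 = a2 * b1" "prods a1 a2 b1 b2 3 = a2 * b2"
  "prods a1 a2 b1 b2 (Suc (Suc 0)) = a2 * b1" "prods a1 a2 b1 b2 (Suc (Suc (Suc 0))) = a2 * b2"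
  by (simp_all add: prods_def)

text \<open>
  The coefficients of a Gram tensor with respect to the four products: \<open>e = 1\<close> belongs to the factor
  \<open>a b\<close> and \<open>e = - 1\<close> to \<open>a (cnj b)\<close>.
\<close>
definition gram_matrix :: "real \<Rightarrow> nat \<Rightarrow> nat \<Rightarrow> real" where
  "gram_matrix e s t = (if s = t then 1 else if s + t = 3 then (if s \<in> {1, 2} then e else - e) else 0)"

lemma sum_lessThan_4: "(\<Sum>s<4. F s) = F 0 + F 1 + F 2 + F (3::nat)"
  by (simp add: eval_nat_numeral)

lemma gram_tensor_quad_tensor:
  "gram_tensor a1 a2 b1 b2 = quad_tensor 4 (prods a1 a2 b1 b2) (gram_matrix 1)"
  "gram_tensor a1 a2 b1 (- b2) = quad_tensor 4 (prods a1 a2 b1 b2) (gram_matrix (- 1))"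
  by (rule tensor_eqI, simp add: gram_tensor_def quad_tensor_def sum_lessThan_4 prods_simps gram_matrix_def
      lookup_tensor lookup_add lookup_minus algebra_simps)+

definition biquadratic_indep :: "bpoly \<Rightarrow> bpoly \<Rightarrow> bpoly \<Rightarrow> bpoly \<Rightarrow> bool" where
  "biquadratic_indep a1 a2 b1 b2 \<longleftrightarrow> (\<forall>c :: nat \<Rightarrow> nat \<Rightarrow> real.
     (\<Sum>i<3. \<Sum>j<3. c i j *\<^sub>R ((a1 ^ (2 - i) * a2 ^ i) * (b1 ^ (2 - j) * b2 ^ j))) = 0 \<longrightarrow>
     (\<forall>i<3. \<forall>j<3. c i j = 0))"

lemma biquadratic_indepD:
  assumes "biquadratic_indep a1 a2 b1 b2"
    and "c00 *\<^sub>R (a1 * a1 * (b1 * b1)) + c01 *\<^sub>R (a1 * a1 * (b1 * b2)) + c02 *\<^sub>R (a1 * a1 * (b2 * b2)) +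
      c10 *\<^sub>R (a1 * a2 * (b1 * b1)) + c11 *\<^sub>R (a1 * a2 * (b1 * b2)) + c12 *\<^sub>R (a1 * a2 * (b2 * b2)) +
      c20 *\<^sub>R (a2 * a2 * (b1 * b1)) + c21 *\<^sub>R (a2 * a2 * (b1 * b2)) + c22 *\<^sub>R (a2 * a2 * (b2 * b2)) = 0"
  shows "c00 = 0 \<and> c01 = 0 \<and> c02 = 0 \<and> c10 = 0 \<and> c11 = 0 \<and> c12 = 0 \<and> c20 = 0 \<and> c21 = 0 \<and> c22 = 0"
proof -
  let ?c = "\<lambda>i j. [[c00, c01, c02], [c10, c11, c12], [c20, c21, c22]] ! i ! j"
  have "(\<Sum>i<3. \<Sum>j<3. ?c i j *\<^sub>R ((a1 ^ (2 - i) * a2 ^ i) * (b1 ^ (2 - j) * b2 ^ j))) = 0"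
    using assms(2) by (simp add: eval_nat_numeral add_ac)
  then have *: "?c i j = 0" if "i < 3" "j < 3" for i j
    using assms(1)[unfolded biquadratic_indep_def, rule_format, of ?c] that by blast
  show ?thesis
    using *[of 0 0] *[of 0 1] *[of 0 2] *[of 1 0] *[of 1 1] *[of 1 2] *[of 2 0] *[of 2 1] *[of 2 2]
    by simp
qed

lemma biquadratic_indep_prods:
  assumes "biquadratic_indep a1 a2 b1 b2"
  shows "lin_indep 4 (prods a1 a2 b1 b2)"
  unfolding lin_indep_def
proof (intro allI impI)
  fix c :: "nat \<Rightarrow> real" and s :: nat
  assume "(\<Sum>s<4. c s *\<^sub>R prods a1 a2 b1 b2 s) = 0" and s: "s < 4"
  then have 0: "c 0 *\<^sub>R (a1 * b1) + c 1 *\<^sub>R (a1 * b2) + c 2 *\<^sub>R (a2 * b1) + c 3 *\<^sub>R (a2 * b2) = 0"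
    by (simp add: sum_lessThan_4 prods_simps)
  have "c 0 = 0 \<and> c 1 = 0 \<and> 0 = (0::real) \<and> c 2 = 0 \<and> c 3 = 0 \<and> 0 = (0::real) \<and> 0 = (0::real) \<and> 0 = (0::real) \<and> 0 = (0::real)"
    by (rule biquadratic_indepD[OF assms])
      (use arg_cong[OF 0, of "\<lambda>x. x * (a1 * b1)"] in \<open>simp add: algebra_simps mult_scaleR_bpoly\<close>)
  then show "c s = 0"
    using s by (auto simp: less_Suc_eq numeral_eq_Suc)
qed

text \<open>
  Comparing coefficients of the nine products leaves only the relation of the Segre quadric.
\<close>
lemma quad_tensor_prods_kernel:
  assumes indep: "biquadratic_indep a1 a2 b1 b2"
    and sym: "\<And>s t. C s t = C t s"
    and 0: "mult_map (quad_tensor 4 (prods a1 a2 b1 b2) C) = 0"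
  shows "quad_tensor 4 (prods a1 a2 b1 b2) C =
    C 1 2 *\<^sub>R (tensor (a1 * b2) (a2 * b1) + tensor (a2 * b1) (a1 * b2)
      - tensor (a1 * b1) (a2 * b2) - tensor (a2 * b2) (a1 * b1))"
proof -
  have *: "C 1 0 = C 0 1" "C 2 0 = C 0 2" "C 3 0 = C 0 3" "C 2 1 = C 1 2" "C 3 1 = C 1 3" "C 3 2 = C 2 3"
    using sym by blast+
  note * = *[unfolded One_nat_def]
  have "C 0 0 = 0 \<and> C 0 1 + C 1 0 = 0 \<and> C 1 1 = 0 \<and> C 0 2 + C 2 0 = 0 \<and>
    C 0 3 + C 3 0 + C 1 2 + C 2 1 = 0 \<and> C 1 3 + C 3 1 = 0 \<and> C 2 2 = 0 \<and> C 2 3 + C 3 2 = 0 \<and> C 3 3 = 0"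
    by (rule biquadratic_indepD[OF indep], subst 0[symmetric], rule poly_mapping_eqI)
      (simp add: mult_map_quad_tensor sum_lessThan_4 prods_simps lookup_add algebra_simps)
  then have "C 0 0 = 0" "C 0 1 = 0" "C 1 1 = 0" "C 0 2 = 0" "C 0 3 = - C 1 2" "C 1 3 = 0" "C 2 2 = 0"
    "C 2 3 = 0" "C 3 3 = 0"
    using * by auto
  then show ?thesis
    by (simp add: quad_tensor_def sum_lessThan_4 prods_simps * algebra_simps)
qed

text \<open>
  If a point of the line were beyond an end of the segment, this end would lie strictly between
  two points of the set.
\<close>
lemma extreme_points_on_line:
  fixes x :: "'a::real_vector"
  assumes \<theta>: "\<theta> extreme_point_of S" and \<theta>': "\<theta>' extreme_point_of S" and x: "x \<in> S"
    and eq: "x = (1 - s) *\<^sub>R \<theta> + s *\<^sub>R \<theta>'"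
  shows "x \<in> closed_segment \<theta> \<theta>'"
proof -
  have *: False
    if \<theta>: "\<theta> extreme_point_of S" and \<theta>': "\<theta>' \<in> S" and ne: "\<theta> \<noteq> \<theta>'" and s: "s < 0"
      and eq: "x = (1 - s) *\<^sub>R \<theta> + s *\<^sub>R \<theta>'" for \<theta> \<theta>' s
  proof -
    define r where "r = - s / (1 - s)"
    have r: "0 < r" "r < 1" "(1 - r) * (1 - s) = 1" "(1 - r) * s + r = 0"
      using s by (auto simp: r_def field_simps)
    have "(1 - r) *\<^sub>R x + r *\<^sub>R \<theta>' = ((1 - r) * (1 - s)) *\<^sub>R \<theta> + ((1 - r) * s + r) *\<^sub>R \<theta>'"
      by (simp add: eq scaleR_add_right scaleR_add_left)
    then have "\<theta> = (1 - r) *\<^sub>R x + r *\<^sub>R \<theta>'"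
      unfolding r by simp
    moreover have "x \<noteq> \<theta>'"
    proof
      assume "x = \<theta>'"
      then have "(1 - s) *\<^sub>R (\<theta> - \<theta>') = 0" using eq by (simp add: algebra_simps)
      then show False using s ne by simp
    qed
    ultimately have "\<theta> \<in> open_segment x \<theta>'"
      using r by (auto simp: in_segment)
    then show False
      using \<theta> \<theta>' x by (auto simp: extreme_point_of_def)
  qed
  show ?thesis
  proof (cases "\<theta> = \<theta>'")
    case True
    then show ?thesis using eq by (simp add: scaleR_add_left[symmetric])
  next
    case False
    have "\<not> s < 0"
      using *[OF \<theta> _ False _ eq] \<theta>' by (auto simp: extreme_point_of_def)
    moreover have "\<not> 1 - s < 0"
      using *[OF \<theta>' _ _ _, of \<theta> "1 - s"] False \<theta> eq by (auto simp: extreme_point_of_def add.commute)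
    ultimately show ?thesis
      unfolding in_segment(1) using eq by (metis not_less diff_ge_0_iff_ge)
  qed
qed

text \<open>
  If an open segment in \<open>Gram d f\<close> meets the given one, its ends are supported on the four products.
  They differ from an end by an element of the kernel of the multiplication map, which is the line of
  the segment.
\<close>
theorem biquadratic_indep_segment_face:
  assumes indep: "biquadratic_indep a1 a2 b1 b2"
    and ext: "gram_tensor a1 a2 b1 b2 extreme_point_of Gram d f"
      "gram_tensor a1 a2 b1 (- b2) extreme_point_of Gram d f"
  shows "closed_segment (gram_tensor a1 a2 b1 b2) (gram_tensor a1 a2 b1 (- b2)) face_of Gram d f"
proof -
  let ?u = "prods a1 a2 b1 b2"
  define \<theta> \<theta>' where \<theta>: "\<theta> = gram_tensor a1 a2 b1 b2" and \<theta>': "\<theta>' = gram_tensor a1 a2 b1 (- b2)"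
  define \<Delta> where "\<Delta> = tensor (a1 * b2) (a2 * b1) + tensor (a2 * b1) (a1 * b2)
      - tensor (a1 * b1) (a2 * b2) - tensor (a2 * b2) (a1 * b1)"
  have diff: "\<theta> - \<theta>' = 2 *\<^sub>R \<Delta>"
    unfolding \<theta> \<theta>' \<Delta>_def gram_tensor_def
    by (rule tensor_eqI) (simp add: lookup_tensor lookup_add lookup_minus algebra_simps)
  have G: "\<theta> \<in> Gram d f" "\<theta>' \<in> Gram d f"
    using ext by (auto simp: \<theta> \<theta>' extreme_point_of_def)
  have mem: "x \<in> closed_segment \<theta> \<theta>'"
    if x: "x \<in> Gram d f" and y: "y \<in> Gram d f" and z: "z \<in> closed_segment \<theta> \<theta>'" "z \<in> open_segment x y"
    for x y z
  proof -
    obtain t where t: "z = (1 - t) *\<^sub>R \<theta> + t *\<^sub>R \<theta>'"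
      using z(1) by (auto simp: in_segment)
    have "quad_form z l = 0" if l: "linear l" "\<And>s. s < 4 \<Longrightarrow> l (?u s) = 0" for l
      unfolding t \<theta>' gram_tensor_quad_tensor(2)
      unfolding \<theta> gram_tensor_quad_tensor(1)
      using quad_form_quad_tensor_eq_0[OF l]
      by (simp add: linear_add[OF linear_quad_form[OF l(1)]] linear_scale[OF linear_quad_form[OF l(1)]])
    then obtain C where C: "\<forall>s t. C s t = C t s" "x = quad_tensor 4 ?u C"
      using psd_open_segment_support[OF _ _ z(2), of d 4 ?u] x y by (auto simp: Gram_def)
    define D where "D = (\<lambda>s t. C s t - gram_matrix 1 s t)"
    have D: "x - \<theta> = quad_tensor 4 ?u D"
      by (simp add: C(2) \<theta> gram_tensor_quad_tensor quad_tensor_diff D_def)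
    have "mult_map (quad_tensor 4 ?u D) = 0"
      unfolding D[symmetric] using x G by (simp add: linear_diff[OF linear_mult_map] Gram_def)
    moreover have "D s t = D t s" for s t
      using C(1) by (auto simp: D_def gram_matrix_def)
    ultimately have "x - \<theta> = D 1 2 *\<^sub>R \<Delta>"
      unfolding D \<Delta>_def by (intro quad_tensor_prods_kernel[OF indep])
    also have "\<Delta> = (1 / 2) *\<^sub>R (\<theta> - \<theta>')"
      by (simp add: diff)
    finally have "x = (1 - (- D 1 2 / 2)) *\<^sub>R \<theta> + (- D 1 2 / 2) *\<^sub>R \<theta>'"
      by (simp add: algebra_simps)
    then show ?thesis
      by (rule extreme_points_on_line[OF _ _ x, rotated 2]) (use ext in \<open>simp_all add: \<theta> \<theta>'\<close>)
  qed
  have "closed_segment \<theta> \<theta>' face_of Gram d f"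
    unfolding face_of_def
  proof (intro conjI ballI impI)
    show "closed_segment \<theta> \<theta>' \<subseteq> Gram d f"
      using G convex_Gram by (simp add: closed_segment_subset)
    fix x y z
    assume *: "x \<in> Gram d f" "y \<in> Gram d f" "z \<in> closed_segment \<theta> \<theta>'" "z \<in> open_segment x y"
    then show "x \<in> closed_segment \<theta> \<theta>'" by (rule mem)
    show "y \<in> closed_segment \<theta> \<theta>'"
      using * mem[of y x z] by (simp add: open_segment_commute)
  qed simp
  then show ?thesis by (simp add: \<theta> \<theta>')
qed

section \<open>Boundary points and segments that are not faces\<close>

lemma quad_form_segment_gram_tensor:
  assumes l: "linear l" "\<And>s. s < 4 \<Longrightarrow> l (prods a1 a2 b1 b2 s) = 0"
    and z: "z \<in> closed_segment (gram_tensor a1 a2 b1 b2) (gram_tensor a1 a2 b1 (- b2))"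
  shows "quad_form z l = 0"
proof -
  obtain t where t: "z = (1 - t) *\<^sub>R gram_tensor a1 a2 b1 b2 + t *\<^sub>R gram_tensor a1 a2 b1 (- b2)"
    using z by (auto simp: in_segment)
  show ?thesis
    unfolding t gram_tensor_quad_tensor(2)
    unfolding gram_tensor_quad_tensor(1)
    using quad_form_quad_tensor_eq_0[OF l]
    by (simp add: linear_add[OF linear_quad_form[OF l(1)]] linear_scale[OF linear_quad_form[OF l(1)]])
qed

text \<open>
  A relative interior point has the largest support: it can be pushed away from any other point
  of the spectrahedron without leaving it.
\<close>
lemma small_support_rel_frontier:
  assumes z: "z \<in> Gram d f" and w: "(\<Sum>i\<in>I. tensor (p i) (p i)) \<in> Gram d f" and I: "finite I"
    and i: "i \<in> I" "p i \<notin> W" and W: "subspace W"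
    and 0: "\<And>l. linear l \<Longrightarrow> (\<And>w. w \<in> W \<Longrightarrow> l w = 0) \<Longrightarrow> quad_form z l = 0"
  shows "z \<in> rel_frontier (Gram d f)"
proof -
  let ?w = "\<Sum>i\<in>I. tensor (p i) (p i)"
  have "z \<notin> rel_interior (Gram d f)"
  proof
    assume "z \<in> rel_interior (Gram d f)"
    then obtain T where T: "open T" "z \<in> T" "T \<inter> affine hull (Gram d f) \<subseteq> Gram d f"
      by (auto simp: rel_interior_def openin_open)
    have "((\<lambda>e. z + e *\<^sub>R (z - ?w)) \<longlongrightarrow> z + 0 *\<^sub>R (z - ?w)) (at_right 0)"
      by (intro tendsto_intros)
    then have "\<forall>\<^sub>F e in at_right 0. z + e *\<^sub>R (z - ?w) \<in> T"
      using T by (intro topological_tendstoD) auto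
    then have "\<forall>\<^sub>F e in at_right (0::real). z + e *\<^sub>R (z - ?w) \<in> T \<and> 0 < e"
      by (intro eventually_conj eventually_at_right_less)
    then obtain e where e: "z + e *\<^sub>R (z - ?w) \<in> T" "0 < (e::real)"
      using eventually_happens'[OF trivial_limit_at_right_real] by blast
    define y where "y = z + e *\<^sub>R (z - ?w)"
    have "y = (1 + e) *\<^sub>R z + (- e) *\<^sub>R ?w"
      by (simp add: y_def algebra_simps)
    then have "y \<in> affine hull (Gram d f)"
      using mem_affine[OF affine_affine_hull, of z "Gram d f" ?w "1 + e" "- e"] z w
      by (simp add: hull_inc)
    then have y: "y \<in> Gram d f"
      using T e by (auto simp: y_def)
    have "p i \<in> W"
    proof (rule sum_squares_support[OF W I _ i(1), of p])
      fix l :: "bpoly \<Rightarrow> real"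
      assume l: "linear l" "\<And>w. w \<in> W \<Longrightarrow> l w = 0"
      note lq = linear_quad_form[OF l(1)]
      have "quad_form y l = - e * quad_form ?w l"
        using 0[OF l] by (simp add: y_def linear_add[OF lq] linear_scale[OF lq] linear_diff[OF lq])
      moreover have "0 \<le> quad_form y l" "0 \<le> quad_form ?w l"
        using y w l quad_form_psd_nonneg by (auto simp: Gram_def)
      ultimately show "quad_form ?w l = 0"
        using \<open>0 < e\<close> by (auto simp: mult_le_0_iff)
    qed
    then show False using i by simp
  qed
  then show ?thesis
    using z closure_subset by (auto simp: rel_frontier_def)
qed


lemma in_open_segment_perturbed:
  fixes x y :: "'a::real_vector"
  assumes "y \<noteq> 0" "0 < e"
  shows "x \<in> open_segment (x + e *\<^sub>R y) (x - e *\<^sub>R y)"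
proof -
  have "x = (1 - 1 / 2) *\<^sub>R (x + e *\<^sub>R y) + (1 / 2) *\<^sub>R (x - e *\<^sub>R y)"
    by (simp add: scaleR_add_right scaleR_diff_right scaleR_add_left[symmetric])
  moreover have "x + e *\<^sub>R y \<noteq> x - e *\<^sub>R y"
  proof
    assume "x + e *\<^sub>R y = x - e *\<^sub>R y"
    then have "(e + e) *\<^sub>R y = 0"
      unfolding scaleR_add_left by (simp only: add_left_cancel diff_conv_add_uminus eq_neg_iff_add_eq_0)
    then show False using assms by simp
  qed
  ultimately show ?thesis
    unfolding in_segment by (intro conjI exI[of _ "1 / 2"]) simp_all
qed

text \<open>
  Diagonal dominance: the identity tensor on a finite family may be perturbed in all symmetric
  directions.
\<close>
lemma quad_tensor_diagonally_dominant:
  assumes u: "\<And>s. s < n \<Longrightarrow> u s \<in> forms d" and sym: "\<And>s t. E s t = E t s"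
    and B: "\<And>s t. s < n \<Longrightarrow> t < n \<Longrightarrow> \<bar>E s t\<bar> \<le> B"
  shows "(real n * B) *\<^sub>R quad_tensor n u (\<lambda>s t. if s = t then 1 else 0) + quad_tensor n u E \<in> psd_tensors d"
proof -
  \<comment> \<open>The weights \<open>(B \<plusminus> E s t) / 4\<close> are nonnegative, and the mixed terms of the squares add up to \<open>E\<close>.\<close>
  define X where "X s t = ((B + E s t) / 4) *\<^sub>R tensor (u s + u t) (u s + u t) +
      ((B - E s t) / 4) *\<^sub>R tensor (u s - u t) (u s - u t)" for s t
  have X: "X s t = (B / 2) *\<^sub>R tensor (u s) (u s) + (B / 2) *\<^sub>R tensor (u t) (u t) +
      (E s t / 2) *\<^sub>R tensor (u s) (u t) + (E s t / 2) *\<^sub>R tensor (u t) (u s)" for s t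
    unfolding X_def
    by (rule tensor_eqI) (simp add: lookup_tensor lookup_add lookup_minus algebra_simps add_divide_distrib diff_divide_distrib)
  have "X s t \<in> psd_tensors d" if "s < n" "t < n" for s t
    unfolding X_def using u[OF that(1)] u[OF that(2)] B[OF that]
    by (intro psd_tensors_add psd_tensors_scale psd_square subspace_add[OF forms_subspace] subspace_diff[OF forms_subspace]) auto
  then have "(\<Sum>s<n. \<Sum>t<n. X s t) \<in> psd_tensors d"
    by (intro psd_sum) auto
  also have "(\<Sum>s<n. \<Sum>t<n. X s t) =
      (real n * B) *\<^sub>R (\<Sum>s<n. tensor (u s) (u s)) + quad_tensor n u E"
  proof -
    have 1: "(\<Sum>s<n. \<Sum>t<n. (B / 2) *\<^sub>R tensor (u s) (u s)) = (real n * B / 2) *\<^sub>R (\<Sum>s<n. tensor (u s) (u s))"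
      by (simp add: scaleR_sum_right sum_constant_scaleR del: sum_constant)
    have 2: "(\<Sum>s<n. \<Sum>t<n. (B / 2) *\<^sub>R tensor (u t) (u t)) = (real n * B / 2) *\<^sub>R (\<Sum>s<n. tensor (u s) (u s))"
      by (subst sum.swap) (rule 1)
    have 3: "(\<Sum>s<n. \<Sum>t<n. (E s t / 2) *\<^sub>R tensor (u s) (u t)) = (1 / 2) *\<^sub>R quad_tensor n u E"
      by (simp add: quad_tensor_def scaleR_sum_right)
    have 4: "(\<Sum>s<n. \<Sum>t<n. (E s t / 2) *\<^sub>R tensor (u t) (u s)) = (1 / 2) *\<^sub>R quad_tensor n u E"
      by (subst sum.swap, subst sym) (rule 3)
    show ?thesis
      unfolding X sum.distrib 1 2 3 4 scaleR_add_left[symmetric] add.assoc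
      by (simp add: add.assoc[symmetric] scaleR_add_left[symmetric])
  qed
  also have "(\<Sum>s<n. tensor (u s) (u s)) = quad_tensor n u (\<lambda>s t. if s = t then 1 else 0)"
    by (simp add: quad_tensor_def if_distrib[of "\<lambda>c. c *\<^sub>R _"] sum.delta cong: if_cong)
  finally show ?thesis .
qed

text \<open>
  The midpoint of the segment is the identity tensor on the four products. By diagonal dominance,
  each quadratic relation between them is a direction in which the smallest face containing
  the midpoint extends. The direction of the segment has a nonzero entry in position \<open>(0, 3)\<close>, so
  that a relation without this entry leads out of the segment.
\<close>
theorem extra_relation_not_face:
  assumes a: "a1 \<in> forms k" "a2 \<in> forms k" and b: "b1 \<in> forms m" "b2 \<in> forms m"
    and indep: "lin_indep 4 (prods a1 a2 b1 b2)"
    and f: "f = (a1 * a1 + a2 * a2) * (b1 * b1 + b2 * b2)"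
    and sym: "\<And>s t. E s t = E t s"
    and E0: "mult_map (quad_tensor 4 (prods a1 a2 b1 b2) E) = 0"
    and E03: "E 0 3 = 0" and E_ne: "s0 < 4" "t0 < 4" "E s0 t0 \<noteq> 0"
  shows "\<not> closed_segment (gram_tensor a1 a2 b1 b2) (gram_tensor a1 a2 b1 (- b2)) face_of Gram (k + m) f"
proof
  let ?u = "prods a1 a2 b1 b2"
  let ?I = "quad_tensor 4 ?u (\<lambda>s t. if s = t then 1 else 0)"
  let ?\<kappa> = "quad_tensor 4 ?u E"
  define \<theta> \<theta>' where \<theta>: "\<theta> = gram_tensor a1 a2 b1 b2" and \<theta>': "\<theta>' = gram_tensor a1 a2 b1 (- b2)"
  assume "closed_segment (gram_tensor a1 a2 b1 b2) (gram_tensor a1 a2 b1 (- b2)) face_of Gram (k + m) f"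
  then have face: "closed_segment \<theta> \<theta>' face_of Gram (k + m) f" by (simp add: \<theta> \<theta>')
  have u: "?u s \<in> forms (k + m)" for s
    unfolding prods_def using a b by (auto intro: forms_mult)
  define B where "B = (\<Sum>s<4. \<Sum>t<4. \<bar>E s t\<bar>)"
  have B: "\<bar>E s t\<bar> \<le> B" if "s < 4" "t < 4" for s t
  proof -
    have "\<bar>E s t\<bar> \<le> (\<Sum>t<4. \<bar>E s t\<bar>)"
      using that by (intro member_le_sum) auto
    also have "\<dots> \<le> B"
      unfolding B_def using that by (intro member_le_sum[of s "{..<4}" "\<lambda>s. \<Sum>t<4. \<bar>E s t\<bar>"]) (auto intro: sum_nonneg)
    finally show ?thesis .
  qed
  have "0 < B" using B[OF E_ne(1,2)] E_ne(3) by linarith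
  define \<epsilon> where "\<epsilon> = 1 / (4 * B)"
  have \<epsilon>: "0 < \<epsilon>" "\<epsilon> * (4 * B) = 1" using \<open>0 < B\<close> by (simp_all add: \<epsilon>_def)
  have psd: "?I + (\<epsilon> * e) *\<^sub>R ?\<kappa> \<in> psd_tensors (k + m)" if e: "e \<in> {1, -1}" for e
  proof -
    have "(real 4 * B) *\<^sub>R ?I + quad_tensor 4 ?u (\<lambda>s t. e * E s t) \<in> psd_tensors (k + m)"
      using u sym B e by (intro quad_tensor_diagonally_dominant) auto
    then have "\<epsilon> *\<^sub>R ((real 4 * B) *\<^sub>R ?I + quad_tensor 4 ?u (\<lambda>s t. e * E s t)) \<in> psd_tensors (k + m)"
      using \<epsilon> by (intro psd_tensors_scale) auto
    also have "quad_tensor 4 ?u (\<lambda>s t. e * E s t) = e *\<^sub>R ?\<kappa>"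
      by (simp add: quad_tensor_def scaleR_sum_right)
    finally show ?thesis
      using \<epsilon> by (simp add: scaleR_add_right)
  qed
  have I: "?I = (1 - 1 / 2) *\<^sub>R \<theta> + (1 / 2) *\<^sub>R \<theta>'"
  proof -
    have "(\<lambda>s t. if s = t then 1 else 0) =
        (\<lambda>s t. (1 - 1 / 2) * gram_matrix 1 s t + (1 / 2) * gram_matrix (- 1) s t)"
      by (intro ext) (simp add: gram_matrix_def)
    then show ?thesis
      unfolding \<theta> \<theta>' gram_tensor_quad_tensor(2) unfolding gram_tensor_quad_tensor(1)
      by (simp only: quad_tensor_def scaleR_add_left sum.distrib scaleR_sum_right scaleR_scaleR)
  qed
  have mult_I: "mult_map ?I = f"
    by (rule poly_mapping_eqI)
      (simp add: f mult_map_quad_tensor sum_lessThan_4 prods_simps lookup_add algebra_simps)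
  have G: "?I + (\<epsilon> * e) *\<^sub>R ?\<kappa> \<in> Gram (k + m) f" if "e \<in> {1, -1}" for e
    using psd[OF that] mult_I E0 by (simp add: Gram_def linear_add[OF linear_mult_map] linear_scale[OF linear_mult_map])
  have \<kappa>: "?\<kappa> \<noteq> 0"
    using quad_tensor_eq_0[OF indep] E_ne by blast
  have "?I \<in> open_segment (?I + (\<epsilon> * 1) *\<^sub>R ?\<kappa>) (?I + (\<epsilon> * -1) *\<^sub>R ?\<kappa>)"
    using in_open_segment_perturbed[OF \<kappa> \<epsilon>(1), of ?I] by simp
  moreover have "?I \<in> closed_segment \<theta> \<theta>'"
    unfolding in_segment using I by (intro exI[of _ "1 / 2"]) simp
  ultimately have "?I + (\<epsilon> * 1) *\<^sub>R ?\<kappa> \<in> closed_segment \<theta> \<theta>'"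
    using face G[of 1] G[of "-1"] unfolding face_of_def by blast
  then obtain s where s: "?I + (\<epsilon> * 1) *\<^sub>R ?\<kappa> = (1 - s) *\<^sub>R \<theta> + s *\<^sub>R \<theta>'"
    by (auto simp: in_segment)
  let ?D = "\<lambda>i j. (if i = j then 1 else 0) + \<epsilon> * E i j - ((1 - s) * gram_matrix 1 i j + s * gram_matrix (-1) i j)"
  have "quad_tensor 4 ?u ?D = ?I + (\<epsilon> * 1) *\<^sub>R ?\<kappa> - ((1 - s) *\<^sub>R \<theta> + s *\<^sub>R \<theta>')"
    unfolding \<theta> \<theta>' gram_tensor_quad_tensor(2) unfolding gram_tensor_quad_tensor(1)
    by (simp add: quad_tensor_def scaleR_add_left scaleR_diff_left sum.distrib sum_subtractf scaleR_sum_right)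
  then have D: "?D i j = 0" if "i < 4" "j < 4" for i j
    using quad_tensor_eq_0[OF indep _ that, of ?D] s by simp
  have "s = 1 / 2"
    using D[of 0 3] E03 by (simp add: gram_matrix_def)
  then have "(1 - s) * gram_matrix 1 s0 t0 + s * gram_matrix (- 1) s0 t0 = (if s0 = t0 then 1 else 0)"
    by (simp add: gram_matrix_def)
  then have "\<epsilon> * E s0 t0 = 0"
    using D[OF E_ne(1,2)] by simp
  then show False using \<epsilon> E_ne by simp
qed

lemma span_linear_relation:
  assumes q: "\<And>i. i < n \<Longrightarrow> q i \<in> span M" and M: "finite M" "card M < n"
  shows "\<exists>c. (\<Sum>i<n. c i *\<^sub>R (q i :: bpoly)) = 0 \<and> (\<exists>i<n. c i \<noteq> 0)"
proof (cases "inj_on q {..<n}")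
  case False
  then obtain i j where ij: "i < n" "j < n" "i \<noteq> j" "q i = q j"
    by (auto simp: inj_on_def)
  let ?c = "\<lambda>l. (if l = i then 1 else 0) - (if l = j then 1 else 0 :: real)"
  have "(\<Sum>l<n. ?c l *\<^sub>R q l) = 0"
    using ij by (simp add: scaleR_diff_left sum_subtractf if_distrib[of "\<lambda>c. c *\<^sub>R _"] cong: if_cong)
  then show ?thesis using ij by (intro exI[of _ ?c]) auto
next
  case True
  have "q ` {..<n} \<subseteq> span M" using q by auto
  then have "dependent (q ` {..<n})"
    using independent_span_bound[of M "q ` {..<n}"] M card_image[OF True] by auto
  then obtain c where c: "\<exists>v\<in>q ` {..<n}. c v \<noteq> 0" "(\<Sum>v\<in>q ` {..<n}. c v *\<^sub>R v) = 0"
    using dependent_finite[of "q ` {..<n}"] by auto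
  then show ?thesis
    by (intro exI[of _ "c \<circ> q"]) (auto simp: sum.reindex[OF True])
qed

lemma forms_linear_relation:
  assumes q: "\<And>i. i < n \<Longrightarrow> q i \<in> forms k" and n: "k + 1 < n"
  shows "\<exists>c. (\<Sum>i<n. c i *\<^sub>R q i) = 0 \<and> (\<exists>i<n. c i \<noteq> 0)"
proof (rule span_linear_relation)
  let ?M = "(\<lambda>i. single (i, k - i) (1::real)) ` {..k}"
  show "finite ?M" by simp
  show "card ?M < n"
    using card_image_le[of "{..k}" "\<lambda>i. single (i, k - i) (1::real)"] n by simp
  fix i assume "i < n"
  then have qi: "q i \<in> forms k" by (rule q)
  have "(\<Sum>m \<in> keys (q i). lookup (q i) m *\<^sub>R single m (1::real)) \<in> span ?M"
  proof (intro span_sum span_scale span_base)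
    fix m assume "m \<in> keys (q i)"
    then have "m = (fst m, k - fst m)" "fst m \<le> k"
      using qi by (auto simp: forms_def prod_eq_iff)
    then show "single m 1 \<in> ?M" by (metis (no_types, lifting) atMost_iff imageI)
  qed
  then show "q i \<in> span ?M" by (simp add: pm_expand)
qed

lemma tensor_rotate:
  assumes "c * c + s * s = 1"
  shows "tensor (c *\<^sub>R p - s *\<^sub>R q) (c *\<^sub>R p - s *\<^sub>R q) + tensor (s *\<^sub>R p + c *\<^sub>R q) (s *\<^sub>R p + c *\<^sub>R q) =
    tensor p p + tensor q q"
proof (rule tensor_eqI)
  fix a b
  let ?p = "lookup p" and ?q = "lookup q"
  have "(c * ?p a - s * ?q a) * (c * ?p b - s * ?q b) + (s * ?p a + c * ?q a) * (s * ?p b + c * ?q b) =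
      (c * c + s * s) * (?p a * ?p b + ?q a * ?q b)"
    by (simp add: algebra_simps)
  then show "lookup (tensor (c *\<^sub>R p - s *\<^sub>R q) (c *\<^sub>R p - s *\<^sub>R q) +
      tensor (s *\<^sub>R p + c *\<^sub>R q) (s *\<^sub>R p + c *\<^sub>R q)) (a, b) =
      lookup (tensor p p + tensor q q) (a, b)"
    using assms by (simp add: lookup_tensor lookup_add lookup_minus)
qed

lemma gram_tensor_rotate:
  assumes "c * c + s * s = 1"
  shows "gram_tensor (c *\<^sub>R a1 - s *\<^sub>R a2) (s *\<^sub>R a1 + c *\<^sub>R a2) b1 b2 = gram_tensor a1 a2 b1 b2"
proof -
  have "(c *\<^sub>R a1 - s *\<^sub>R a2) * b1 - (s *\<^sub>R a1 + c *\<^sub>R a2) * b2 =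
      c *\<^sub>R (a1 * b1 - a2 * b2) - s *\<^sub>R (a1 * b2 + a2 * b1)"
    "(c *\<^sub>R a1 - s *\<^sub>R a2) * b2 + (s *\<^sub>R a1 + c *\<^sub>R a2) * b1 =
      s *\<^sub>R (a1 * b1 - a2 * b2) + c *\<^sub>R (a1 * b2 + a2 * b1)"
    by (simp_all add: algebra_simps mult_scaleR_bpoly)
  then show ?thesis
    by (simp add: gram_tensor_def tensor_rotate[OF assms])
qed

lemma gram_tensor_commute: "gram_tensor b1 b2 a1 a2 = gram_tensor a1 a2 b1 b2"
  by (simp add: gram_tensor_def mult.commute add.commute)

lemma lin_indep_4_iff:
  "lin_indep 4 (prods a1 a2 b1 b2) \<longleftrightarrow> (\<forall>x y z w. x *\<^sub>R (a1 * b1) + y *\<^sub>R (a1 * b2) +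
     z *\<^sub>R (a2 * b1) + w *\<^sub>R (a2 * b2) = 0 \<longrightarrow> x = 0 \<and> y = 0 \<and> z = 0 \<and> w = 0)" (is "?L \<longleftrightarrow> ?R")
proof
  assume L: ?L
  show ?R
  proof (intro allI impI)
    fix x y z w :: real
    assume "x *\<^sub>R (a1 * b1) + y *\<^sub>R (a1 * b2) + z *\<^sub>R (a2 * b1) + w *\<^sub>R (a2 * b2) = 0"
    then have "(\<Sum>s<4. [x, y, z, w] ! s *\<^sub>R prods a1 a2 b1 b2 s) = 0"
      by (simp add: sum_lessThan_4 prods_simps)
    then have "[x, y, z, w] ! s = 0" if "s < 4" for s
      using lin_indepD[OF L _ that] by blast
    from this[of 0] this[of 1] this[of 2] this[of 3]
    show "x = 0 \<and> y = 0 \<and> z = 0 \<and> w = 0" by simp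
  qed
next
  assume R: ?R
  show ?L
    unfolding lin_indep_def
  proof (intro allI impI)
    fix c :: "nat \<Rightarrow> real" and s :: nat
    assume "(\<Sum>s<4. c s *\<^sub>R prods a1 a2 b1 b2 s) = 0" "s < 4"
    moreover from this(1) have "c 0 = 0 \<and> c 1 = 0 \<and> c 2 = 0 \<and> c 3 = 0"
      by (intro R[rule_format]) (simp add: sum_lessThan_4 prods_simps)
    ultimately show "c s = 0"
      by (auto simp: less_Suc_eq numeral_eq_Suc)
  qed
qed

lemma lin_indep_4_commute:
  assumes "lin_indep 4 (prods a1 a2 b1 b2)"
  shows "lin_indep 4 (prods b1 b2 a1 a2)"
  unfolding lin_indep_4_iff
proof (intro allI impI)
  fix x y z w :: real
  assume "x *\<^sub>R (b1 * a1) + y *\<^sub>R (b1 * a2) + z *\<^sub>R (b2 * a1) + w *\<^sub>R (b2 * a2) = 0"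
  then have "x *\<^sub>R (a1 * b1) + z *\<^sub>R (a1 * b2) + y *\<^sub>R (a2 * b1) + w *\<^sub>R (a2 * b2) = 0"
    by (simp add: mult.commute add_ac)
  then show "x = 0 \<and> y = 0 \<and> z = 0 \<and> w = 0"
    using assms unfolding lin_indep_4_iff by blast
qed

lemma lin_indep_4_rotate:
  assumes cs: "c * c + s * s = 1" and indep: "lin_indep 4 (prods a1 a2 b1 b2)"
  shows "lin_indep 4 (prods (c *\<^sub>R a1 - s *\<^sub>R a2) (s *\<^sub>R a1 + c *\<^sub>R a2) b1 b2)"
  unfolding lin_indep_4_iff
proof (intro allI impI)
  fix x y z w :: real
  assume "x *\<^sub>R ((c *\<^sub>R a1 - s *\<^sub>R a2) * b1) + y *\<^sub>R ((c *\<^sub>R a1 - s *\<^sub>R a2) * b2) +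
    z *\<^sub>R ((s *\<^sub>R a1 + c *\<^sub>R a2) * b1) + w *\<^sub>R ((s *\<^sub>R a1 + c *\<^sub>R a2) * b2) = 0"
  then have "(c * x + s * z) *\<^sub>R (a1 * b1) + (c * y + s * w) *\<^sub>R (a1 * b2) +
      (c * z - s * x) *\<^sub>R (a2 * b1) + (c * w - s * y) *\<^sub>R (a2 * b2) = 0"
    by (simp add: algebra_simps mult_scaleR_bpoly)
  then have *: "c * x + s * z = 0" "c * y + s * w = 0" "c * z - s * x = 0" "c * w - s * y = 0"
    using indep unfolding lin_indep_4_iff by blast+
  have "x = (c * c + s * s) * x" "y = (c * c + s * s) * y" "z = (c * c + s * s) * z" "w = (c * c + s * s) * w"
    by (simp_all add: cs)
  then have "x = c * (c * x + s * z) - s * (c * z - s * x)" "y = c * (c * y + s * w) - s * (c * w - s * y)"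
    "z = s * (c * x + s * z) + c * (c * z - s * x)" "w = s * (c * y + s * w) + c * (c * w - s * y)"
    by (simp_all add: algebra_simps)
  then show "x = 0 \<and> y = 0 \<and> z = 0 \<and> w = 0"
    unfolding * by simp
qed

text \<open>
  The six products of two of the quadratic forms \<open>b1, a2, b2\<close> lie in the five-dimensional space of
  quartic forms. A linear relation between them, multiplied by \<open>b1\<^sup>2\<close>, is a quadratic relation
  between the four products that does not involve \<open>a2 b2\<close>.
\<close>
lemma proportional_two_two_not_face:
  assumes a: "a2 \<in> forms 2" and b: "b1 \<in> forms 2" "b2 \<in> forms 2" and r: "r \<noteq> 0" "a1 = r *\<^sub>R b1"
    and indep: "lin_indep 4 (prods a1 a2 b1 b2)"
    and f: "f = (a1 * a1 + a2 * a2) * (b1 * b1 + b2 * b2)"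
  shows "\<not> closed_segment (gram_tensor a1 a2 b1 b2) (gram_tensor a1 a2 b1 (- b2)) face_of Gram 4 f"
proof -
  let ?q = "\<lambda>i. [b1 * b1, b1 * a2, b1 * b2, a2 * a2, a2 * b2, b2 * b2] ! i"
  have "?q i \<in> forms 4" if "i < 6" for i
    using that a b forms_mult[of _ 2 _ 2] by (auto simp: less_Suc_eq numeral_eq_Suc)
  then obtain c where c: "(\<Sum>i<6. c i *\<^sub>R ?q i) = 0" "\<exists>i<6. c i \<noteq> 0"
    using forms_linear_relation[of 6 ?q 4] by auto
  have c0: "c 0 *\<^sub>R (b1 * b1) + c 1 *\<^sub>R (b1 * a2) + c 2 *\<^sub>R (b1 * b2) + c 3 *\<^sub>R (a2 * a2) +
      c 4 *\<^sub>R (a2 * b2) + c 5 *\<^sub>R (b2 * b2) = 0"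
    using c(1) by (simp add: eval_nat_numeral add_ac)
  define E where "E = (\<lambda>s t. if s < 3 \<and> t < 3 then
    [[c 0 / (r * r), c 2 / (2 * r * r), c 1 / (2 * r)],
     [c 2 / (2 * r * r), c 5 / (r * r), c 4 / (2 * r)],
     [c 1 / (2 * r), c 4 / (2 * r), c 3]] ! s ! t else 0)"
  have E: "E 0 0 = c 0 / (r * r)" "E 0 1 = c 2 / (2 * r * r)" "E 0 2 = c 1 / (2 * r)" "E 1 1 = c 5 / (r * r)"
    "E 1 2 = c 4 / (2 * r)" "E 2 2 = c 3" "E s 3 = 0" "E 3 s = 0" for s
    by (simp_all add: E_def)
  have sym: "E s t = E t s" for s t
    by (auto simp: E_def less_Suc_eq numeral_eq_Suc)
  have "mult_map (quad_tensor 4 (prods a1 a2 b1 b2) E) = (b1 * b1) *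
      (c 0 *\<^sub>R (b1 * b1) + c 1 *\<^sub>R (b1 * a2) + c 2 *\<^sub>R (b1 * b2) + c 3 *\<^sub>R (a2 * a2) +
      c 4 *\<^sub>R (a2 * b2) + c 5 *\<^sub>R (b2 * b2))"
  proof -
    have s: "E 1 0 = E 0 1" "E 2 0 = E 0 2" "E 2 1 = E 1 2" by (rule sym)+
    note s = s[unfolded One_nat_def]
    have "mult_map (quad_tensor 4 (prods a1 a2 b1 b2) E) =
      (E 0 0 * (r * r)) *\<^sub>R (b1 * b1 * (b1 * b1)) + (r * (E 0 2 + E 2 0)) *\<^sub>R (b1 * b1 * (b1 * a2)) +
      (r * r * (E 0 1 + E 1 0)) *\<^sub>R (b1 * b1 * (b1 * b2)) + E 2 2 *\<^sub>R (b1 * b1 * (a2 * a2)) +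
      (r * (E 1 2 + E 2 1)) *\<^sub>R (b1 * b1 * (a2 * b2)) + (r * r * E 1 1) *\<^sub>R (b1 * b1 * (b2 * b2))"
      by (rule poly_mapping_eqI)
        (simp add: mult_map_quad_tensor sum_lessThan_4 prods_simps E(7,8) r(2)
          mult_scaleR_bpoly lookup_add algebra_simps)
    also have "\<dots> = (b1 * b1) *
      (c 0 *\<^sub>R (b1 * b1) + c 1 *\<^sub>R (b1 * a2) + c 2 *\<^sub>R (b1 * b2) + c 3 *\<^sub>R (a2 * a2) +
      c 4 *\<^sub>R (a2 * b2) + c 5 *\<^sub>R (b2 * b2))"
      using r(1) by (simp add: s E E(2,4,5)[unfolded One_nat_def] mult_scaleR_bpoly distrib_left)
    finally show ?thesis .
  qed
  then have "mult_map (quad_tensor 4 (prods a1 a2 b1 b2) E) = 0"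
    unfolding c0 by simp
  moreover obtain s t where "s < 4" "t < 4" "E s t \<noteq> 0"
  proof -
    obtain i where i: "i < 6" "c i \<noteq> 0" using c(2) by blast
    then consider "i = 0" | "i = 1" | "i = 2" | "i = 3" | "i = 4" | "i = 5" by linarith
    then show thesis
    proof cases
      case 1 then show ?thesis using that[of 0 0] i r E by simp
    next
      case 2 then show ?thesis using that[of 0 2] i r E by simp
    next
      case 3 then show ?thesis using that[of 0 1] i r by (simp add: E_def)
    next
      case 4 then show ?thesis using that[of 2 2] i r E by simp
    next
      case 5 then show ?thesis using that[of 1 2] i r by (simp add: E_def)
    next
      case 6 then show ?thesis using that[of 1 1] i r by (simp add: E_def)
    qed
  qed
  moreover have "a1 \<in> forms 2"
    using r b subspace_scale[OF forms_subspace] by simp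
  ultimately show ?thesis
    using extra_relation_not_face[of a1 2 a2 b1 2 b2 f E] a b indep f sym E(7)[of 0] by auto
qed

text \<open>
  Multiplying a complex form by a unit changes neither its Gram tensor nor the plane spanned by its
  real and imaginary parts. Two such planes in the three-dimensional space of quadratic forms
  meet, so that the first basis vectors can be rotated onto a common line.
\<close>
theorem two_two_not_face:
  assumes a: "a1 \<in> forms 2" "a2 \<in> forms 2" and b: "b1 \<in> forms 2" "b2 \<in> forms 2"
    and indep: "lin_indep 4 (prods a1 a2 b1 b2)"
    and f: "f = (a1 * a1 + a2 * a2) * (b1 * b1 + b2 * b2)"
  shows "\<not> closed_segment (gram_tensor a1 a2 b1 b2) (gram_tensor a1 a2 b1 (- b2)) face_of Gram 4 f"
proof -
  let ?q = "\<lambda>i. [a1, a2, b1, b2] ! i"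
  have "?q i \<in> forms 2" if "i < 4" for i
    using that a b by (auto simp: less_Suc_eq numeral_eq_Suc)
  then obtain e where e: "(\<Sum>i<4. e i *\<^sub>R ?q i) = 0" "\<exists>i<4. e i \<noteq> 0"
    using forms_linear_relation[of 4 ?q 2] by auto
  define A B where "A = e 0 *\<^sub>R a1 + e 1 *\<^sub>R a2" and "B = e 2 *\<^sub>R b1 + e 3 *\<^sub>R b2"
  have AB: "A + B = 0"
    using e(1) by (simp add: sum_lessThan_4 A_def B_def add.assoc)
  have A0: "A \<noteq> 0" and B0: "B \<noteq> 0"
  proof -
    have "e 0 = 0 \<and> e 1 = 0" if "A = 0"
    proof -
      have "e 0 *\<^sub>R (a1 * b1) + 0 *\<^sub>R (a1 * b2) + e 1 *\<^sub>R (a2 * b1) + 0 *\<^sub>R (a2 * b2) = A * b1"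
        by (simp add: A_def algebra_simps mult_scaleR_bpoly)
      then show ?thesis using that indep unfolding lin_indep_4_iff by (metis mult_zero_left)
    qed
    moreover have "e 2 = 0 \<and> e 3 = 0" if "B = 0"
    proof -
      have "e 2 *\<^sub>R (a1 * b1) + e 3 *\<^sub>R (a1 * b2) + 0 *\<^sub>R (a2 * b1) + 0 *\<^sub>R (a2 * b2) = a1 * B"
        by (simp add: B_def algebra_simps mult_scaleR_bpoly)
      then show ?thesis using that indep unfolding lin_indep_4_iff by (metis mult_zero_right)
    qed
    moreover have "\<not> (e 0 = 0 \<and> e 1 = 0 \<and> e 2 = 0 \<and> e 3 = 0)"
      using e(2) by (auto simp: less_Suc_eq numeral_eq_Suc)
    ultimately show "A \<noteq> 0" "B \<noteq> 0"
      using AB by auto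
  qed
  define \<rho> \<sigma> where "\<rho> = sqrt ((e 0)\<^sup>2 + (e 1)\<^sup>2)" and "\<sigma> = sqrt ((e 2)\<^sup>2 + (e 3)\<^sup>2)"
  have \<rho>: "\<rho> > 0" and \<sigma>: "\<sigma> > 0"
    using A0 B0 by (auto simp: \<rho>_def \<sigma>_def A_def B_def sum_power2_gt_zero_iff)
  define c s c' s' where "c = e 0 / \<rho>" and "s = - e 1 / \<rho>" and "c' = e 2 / \<sigma>" and "s' = - e 3 / \<sigma>"
  have unit: "c * c + s * s = 1" "c' * c' + s' * s' = 1" "c' * c' + (- s') * (- s') = 1"
    using \<rho> \<sigma> by (simp_all add: c_def s_def c'_def s'_def add_divide_distrib[symmetric])
      (simp_all add: \<rho>_def \<sigma>_def power2_eq_square)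
  define A1 A2 B1 B2 where "A1 = c *\<^sub>R a1 - s *\<^sub>R a2" and "A2 = s *\<^sub>R a1 + c *\<^sub>R a2"
    and "B1 = c' *\<^sub>R b1 - s' *\<^sub>R b2" and "B2 = s' *\<^sub>R b1 + c' *\<^sub>R b2"
  have "A1 = (1 / \<rho>) *\<^sub>R A" "B1 = (1 / \<sigma>) *\<^sub>R B"
    by (simp_all add: A1_def B1_def A_def B_def c_def s_def c'_def s'_def scaleR_add_right)
  moreover have "A = - B" using AB by (simp add: eq_neg_iff_add_eq_0)
  ultimately have parallel: "A1 = (- \<sigma> / \<rho>) *\<^sub>R B1"
    using \<sigma> by simp
  have in_forms: "A2 \<in> forms 2" "B1 \<in> forms 2" "B2 \<in> forms 2"
    unfolding A2_def B1_def B2_def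
    by (intro subspace_add[OF forms_subspace] subspace_diff[OF forms_subspace] subspace_scale[OF forms_subspace] a b)+
  have "lin_indep 4 (prods A1 A2 B1 B2)"
    unfolding A1_def A2_def B1_def B2_def
    by (intro lin_indep_4_rotate[OF unit(1)] lin_indep_4_commute[OF lin_indep_4_rotate[OF unit(2)]]
        lin_indep_4_commute[OF indep])
  moreover have "gram_tensor A1 A2 B1 B2 = gram_tensor a1 a2 b1 b2"
    unfolding A1_def A2_def B1_def B2_def gram_tensor_rotate[OF unit(1)]
    by (subst (1 2) gram_tensor_commute) (rule gram_tensor_rotate[OF unit(2)])
  moreover have "gram_tensor A1 A2 B1 (- B2) = gram_tensor a1 a2 b1 (- b2)"
  proof -
    have "B1 = c' *\<^sub>R b1 - (- s') *\<^sub>R (- b2)" "- B2 = (- s') *\<^sub>R b1 + c' *\<^sub>R (- b2)"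
      by (simp_all add: B1_def B2_def)
    then show ?thesis
      unfolding A1_def A2_def gram_tensor_rotate[OF unit(1)]
      by (simp only: gram_tensor_rotate[OF unit(3)] gram_tensor_commute[of _ _ a1 a2, symmetric])
  qed
  moreover have "f = (A1 * A1 + A2 * A2) * (B1 * B1 + B2 * B2)"
  proof -
    have "A1 * A1 + A2 * A2 = a1 * a1 + a2 * a2" "B1 * B1 + B2 * B2 = b1 * b1 + b2 * b2"
      using arg_cong[OF tensor_rotate[OF unit(1), of a1 a2], of mult_map]
        arg_cong[OF tensor_rotate[OF unit(2), of b1 b2], of mult_map]
      by (simp_all add: linear_add[OF linear_mult_map] mult_map_tensor A1_def A2_def B1_def B2_def)
    then show ?thesis by (simp add: f)
  qed
  ultimately show ?thesis
    using proportional_two_two_not_face[OF in_forms _ parallel] \<rho> \<sigma> by simp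
qed

section \<open>Binary forms and complex polynomials\<close>

text \<open>
  Dehomogenisation, with coefficients in the complex numbers so that forms can be factored.
\<close>
definition dehom :: "bpoly \<Rightarrow> complex poly" where
  "dehom p = (\<Sum>m\<in>keys p. monom (of_real (lookup p m)) (fst m))"

lemma dehom_superset:
  "finite S \<Longrightarrow> keys p \<subseteq> S \<Longrightarrow>
    dehom p = (\<Sum>m\<in>S. monom (of_real (lookup p m)) (fst m))"
  unfolding dehom_def by (rule sum.mono_neutral_left) (auto simp: in_keys_iff)

lemma dehom_add: "dehom (p + q) = dehom p + dehom q"
proof -
  let ?S = "keys p \<union> keys q"
  have "dehom (p + q) = (\<Sum>m\<in>?S. monom (of_real (lookup (p + q) m)) (fst m))"
    by (rule dehom_superset) (simp_all add: Poly_Mapping.keys_add)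
  then show ?thesis
    by (simp add: dehom_superset[of ?S p] dehom_superset[of ?S q] lookup_add add_monom[symmetric] sum.distrib)
qed

lemma dehom_0 [simp]: "dehom 0 = 0"
  by (simp add: dehom_def)

lemma dehom_sum: "dehom (\<Sum>i\<in>I. p i) = (\<Sum>i\<in>I. dehom (p i))"
  by (induction I rule: infinite_finite_induct) (simp_all add: dehom_add)

lemma dehom_single: "dehom (single m c) = monom (of_real c) (fst m)"
  by (cases "c = 0") (simp_all add: dehom_def)

lemma dehom_mult: "dehom (p * q) = dehom p * dehom q"
proof -
  have p: "p = (\<Sum>a\<in>keys p. single a (lookup p a))" for p :: bpoly
    by (simp add: single_conv_scaleR[of _ "lookup _ _"] pm_expand)
  have "p * q = (\<Sum>a\<in>keys p. \<Sum>b\<in>keys q.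
      single (a + b) (lookup p a * lookup q b))"
    by (subst p[of p], subst p[of q]) (simp add: sum_product mult_single)
  then have "dehom (p * q) = (\<Sum>a\<in>keys p. \<Sum>b\<in>keys q.
      monom (of_real (lookup p a)) (fst a) * monom (of_real (lookup q b)) (fst b))"
    by (simp add: dehom_sum dehom_single mult_monom)
  then show ?thesis
    by (simp add: dehom_def sum_product)
qed

lemma dehom_scale: "dehom (c *\<^sub>R p) = smult (of_real c) (dehom p)"
  by (simp add: scaleR_bpoly dehom_mult dehom_single monom_0)

lemma dehom_minus: "dehom (- p) = - dehom p"
  using dehom_scale[of "- 1" p] by simp

lemma dehom_diff: "dehom (p - q) = dehom p - dehom q"
  using dehom_add[of p "- q"] by (simp add: dehom_minus)

lemma dehom_power: "dehom (p ^ n) = dehom p ^ n"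
proof (induction n)
  case 0
  show ?case using dehom_single[of 0 1] by (simp add: single_one monom_0 one_pCons)
qed (simp add: dehom_mult)

lemma lookup_forms_eq_0: "p \<in> forms d \<Longrightarrow> i + j \<noteq> d \<Longrightarrow> lookup p (i, j) = 0"
  by (force simp: forms_def in_keys_iff)

lemma forms_eqI:
  assumes "p \<in> forms d" "q \<in> forms d"
    and "\<And>i. i \<le> d \<Longrightarrow> lookup p (i, d - i) = lookup q (i, d - i)"
  shows "p = q"
proof (rule poly_mapping_eqI)
  fix m :: "nat \<times> nat"
  obtain i j where m: "m = (i, j)" by (cases m)
  show "lookup p m = lookup q m"
    using assms(3)[of i] lookup_forms_eq_0[OF assms(1), of i j] lookup_forms_eq_0[OF assms(2), of i j]
    unfolding m by (cases "i + j = d") auto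
qed

lemma coeff_dehom:
  assumes "p \<in> forms d"
  shows "coeff (dehom p) i = (if i \<le> d then of_real (lookup p (i, d - i)) else 0)"
proof -
  have "coeff (dehom p) i = (\<Sum>m\<in>keys p. if m = (i, d - i) \<and> i \<le> d then of_real (lookup p m) else 0)"
    unfolding dehom_def coeff_sum
    by (intro sum.cong refl) (use assms in \<open>auto simp: forms_def prod_eq_iff\<close>)
  also have "\<dots> = (if i \<le> d then of_real (lookup p (i, d - i)) else 0)"
    by (auto simp: in_keys_iff)
  finally show ?thesis .
qed

lemma dehom_inject:
  assumes "p \<in> forms d" "q \<in> forms d" "dehom p = dehom q"
  shows "p = q"
proof (rule forms_eqI[OF assms(1,2)])
  fix i assume "i \<le> d"
  have "coeff (dehom p) i = coeff (dehom q) i" using assms by simp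
  then show "lookup p (i, d - i) = lookup q (i, d - i)"
    using \<open>i \<le> d\<close> by (simp add: coeff_dehom[OF assms(1)] coeff_dehom[OF assms(2)])
qed

lemma degree_dehom: "p \<in> forms d \<Longrightarrow> degree (dehom p) \<le> d"
  by (intro degree_le) (simp add: coeff_dehom)

abbreviation cnjp :: "complex poly \<Rightarrow> complex poly" where
  "cnjp \<equiv> map_poly cnj"

lemma cnjp_simps [simp]:
  "coeff (cnjp p) i = cnj (coeff p i)"
  "cnjp (cnjp p) = p" "degree (cnjp p) = degree p"
  "cnjp (p + q) = cnjp p + cnjp q" "cnjp (p - q) = cnjp p - cnjp q" "cnjp (- p) = - cnjp p"
  "cnjp (p * q) = cnjp p * cnjp q" "cnjp (smult c p) = smult (cnj c) (cnjp p)"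
  "cnjp [:a, b:] = [:cnj a, cnj b:]"
proof -
  show [simp]: "coeff (cnjp p) i = cnj (coeff p i)" for p i by (simp add: coeff_map_poly)
  show "cnjp (cnjp p) = p" "cnjp (p + q) = cnjp p + cnjp q" "cnjp (p - q) = cnjp p - cnjp q" "cnjp (- p) = - cnjp p"
    "cnjp (p * q) = cnjp p * cnjp q" "cnjp (smult c p) = smult (cnj c) (cnjp p)"
    by (rule poly_eqI, simp add: coeff_mult)+
  show "degree (cnjp p) = degree p" by (rule degree_map_poly) simp
  show "cnjp [:a, b:] = [:cnj a, cnj b:]"
    by (rule poly_eqI) (simp add: coeff_pCons split: nat.split)
qed

lemma cnjp_prod: "cnjp (\<Prod>i\<in>I. p i) = (\<Prod>i\<in>I. cnjp (p i))"
  by (induction I rule: infinite_finite_induct) (simp_all add: one_pCons map_poly_pCons)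

lemma poly_cnjp: "poly (cnjp p) z = cnj (poly p (cnj z))"
  by (induction p) (simp_all add: map_poly_pCons)

definition re_form :: "nat \<Rightarrow> complex poly \<Rightarrow> bpoly" where
  "re_form d g = (\<Sum>i\<le>d. single (i, d - i) (Re (coeff g i)))"

definition im_form :: "nat \<Rightarrow> complex poly \<Rightarrow> bpoly" where
  "im_form d g = (\<Sum>i\<le>d. single (i, d - i) (Im (coeff g i)))"

lemma lookup_re_form: "lookup (re_form d g) (i, j) = (if i + j = d then Re (coeff g i) else 0)"
  and lookup_im_form: "lookup (im_form d g) (i, j) = (if i + j = d then Im (coeff g i) else 0)"
proof -
  have *: "(\<Sum>l\<le>d. (F l when (l, d - l) = (i, j))) = (if i + j = d then F i else 0)" for F :: "nat \<Rightarrow> real"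
  proof -
    have "(\<Sum>l\<le>d. (F l when (l, d - l) = (i, j))) = (\<Sum>l\<le>d. if l = i then (if i + j = d then F i else 0) else 0)"
      by (intro sum.cong refl) (auto simp: when_def)
    then show ?thesis by auto
  qed
  show "lookup (re_form d g) (i, j) = (if i + j = d then Re (coeff g i) else 0)"
    "lookup (im_form d g) (i, j) = (if i + j = d then Im (coeff g i) else 0)"
    using * by (simp_all add: re_form_def im_form_def lookup_sum lookup_single)
qed

lemma re_form_in_forms: "re_form d g \<in> forms d" and im_form_in_forms: "im_form d g \<in> forms d"
proof -
  have "fst m + snd m = d" if "m \<in> keys (re_form d g)" for m
    using that by (cases m) (simp add: in_keys_iff lookup_re_form split: if_splits)
  then show "re_form d g \<in> forms d" by (simp add: forms_def)
  have "fst m + snd m = d" if "m \<in> keys (im_form d g)" for m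
    using that by (cases m) (simp add: in_keys_iff lookup_im_form split: if_splits)
  then show "im_form d g \<in> forms d" by (simp add: forms_def)
qed

lemma dehom_re_form: "degree g \<le> d \<Longrightarrow> dehom (re_form d g) = smult (1 / 2) (g + cnjp g)"
  by (rule poly_eqI) (auto simp: coeff_dehom[OF re_form_in_forms] lookup_re_form complex_eq_iff coeff_eq_0)

lemma dehom_im_form: "degree g \<le> d \<Longrightarrow> dehom (im_form d g) = smult (- \<i> / 2) (g - cnjp g)"
  by (rule poly_eqI) (auto simp: coeff_dehom[OF im_form_in_forms] lookup_im_form complex_eq_iff coeff_eq_0)

lemma pair_to_complex:
  assumes p: "p \<in> forms d" and q: "q \<in> forms d"
  defines "g \<equiv> dehom p + smult \<i> (dehom q)"
  shows "degree g \<le> d" "re_form d g = p" "im_form d g = q"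
proof -
  show "degree g \<le> d"
    unfolding g_def using degree_dehom[OF p] degree_dehom[OF q]
    by (intro degree_add_le) (auto intro: order_trans[OF degree_smult_le])
  show "re_form d g = p" "im_form d g = q"
    by (auto intro!: forms_eqI[of _ d] re_form_in_forms im_form_in_forms p q
        simp: lookup_re_form lookup_im_form g_def coeff_dehom[OF p] coeff_dehom[OF q])
qed

lemma re_form_mult:
  assumes "degree a \<le> k" "degree b \<le> m"
  shows "re_form (k + m) (a * b) = re_form k a * re_form m b - im_form k a * im_form m b"
    and "im_form (k + m) (a * b) = re_form k a * im_form m b + im_form k a * re_form m b"
proof -
  have deg: "degree (a * b) \<le> k + m"
    using assms by (meson add_mono degree_mult_le order_trans)
  note mem = forms_mult[OF re_form_in_forms re_form_in_forms] forms_mult[OF im_form_in_forms im_form_in_forms]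
    forms_mult[OF re_form_in_forms im_form_in_forms] forms_mult[OF im_form_in_forms re_form_in_forms]
  show "re_form (k + m) (a * b) = re_form k a * re_form m b - im_form k a * im_form m b"
  proof (rule dehom_inject[OF re_form_in_forms])
    show "re_form k a * re_form m b - im_form k a * im_form m b \<in> forms (k + m)"
      by (intro subspace_diff[OF forms_subspace] mem)
    have "smult (1 / 2) (a * b + cnjp a * cnjp b) =
        smult (1 / 4) ((a + cnjp a) * (b + cnjp b)) + smult (1 / 4) ((a - cnjp a) * (b - cnjp b))"
      by (rule poly_eq_poly_eq_iff[THEN iffD1], rule ext) (simp add: algebra_simps)
    then show "dehom (re_form (k + m) (a * b)) = dehom (re_form k a * re_form m b - im_form k a * im_form m b)"
      by (simp add: dehom_diff dehom_mult dehom_re_form[OF deg] dehom_re_form[OF assms(1)] dehom_re_form[OF assms(2)]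
          dehom_im_form[OF assms(1)] dehom_im_form[OF assms(2)])
  qed
  show "im_form (k + m) (a * b) = re_form k a * im_form m b + im_form k a * re_form m b"
  proof (rule dehom_inject[OF im_form_in_forms])
    show "re_form k a * im_form m b + im_form k a * re_form m b \<in> forms (k + m)"
      by (intro subspace_add[OF forms_subspace] mem)
    have "smult (- \<i> / 2) (a * b - cnjp a * cnjp b) =
        smult (- \<i> / 4) ((a + cnjp a) * (b - cnjp b)) + smult (- \<i> / 4) ((a - cnjp a) * (b + cnjp b))"
      by (rule poly_eq_poly_eq_iff[THEN iffD1], rule ext) (simp add: algebra_simps)
    then show "dehom (im_form (k + m) (a * b)) = dehom (re_form k a * im_form m b + im_form k a * re_form m b)"
      by (simp add: dehom_add dehom_mult dehom_im_form[OF deg] dehom_re_form[OF assms(1)] dehom_re_form[OF assms(2)]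
          dehom_im_form[OF assms(1)] dehom_im_form[OF assms(2)])
  qed
qed

lemma dehom_norm_form:
  assumes "degree g \<le> d"
  shows "dehom (re_form d g * re_form d g + im_form d g * im_form d g) = g * cnjp g"
proof -
  have "smult (1 / 4) ((g + cnjp g) * (g + cnjp g)) - smult (1 / 4) ((g - cnjp g) * (g - cnjp g)) = g * cnjp g"
    by (rule poly_eq_poly_eq_iff[THEN iffD1], rule ext) (simp add: algebra_simps)
  then show ?thesis
    by (simp add: dehom_add dehom_mult dehom_re_form[OF assms] dehom_im_form[OF assms])
qed

text \<open>
  The Gram tensor of the representation of \<open>|g|^2\<close> as a sum of two squares.
\<close>
definition norm_tensor :: "nat \<Rightarrow> complex poly \<Rightarrow> btensor" where
  "norm_tensor d g = tensor (re_form d g) (re_form d g) + tensor (im_form d g) (im_form d g)"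

lemma norm_tensor_mult:
  assumes "degree a \<le> k" "degree b \<le> m"
  shows "norm_tensor (k + m) (a * b) = gram_tensor (re_form k a) (im_form k a) (re_form m b) (im_form m b)"
  by (simp add: norm_tensor_def gram_tensor_def re_form_mult[OF assms])

lemma re_form_cnjp [simp]: "re_form d (cnjp g) = re_form d g" "im_form d (cnjp g) = - im_form d g"
  by (auto intro!: poly_mapping_eqI simp: lookup_re_form lookup_im_form)

lemma norm_tensor_cnjp [simp]: "norm_tensor d (cnjp g) = norm_tensor d g"
  by (simp add: norm_tensor_def tensor_bilinear)

lemma norm_tensor_mult_cnjp:
  assumes "degree a \<le> k" "degree b \<le> m"
  shows "norm_tensor (k + m) (a * cnjp b) = gram_tensor (re_form k a) (im_form k a) (re_form m b) (- im_form m b)"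
  using norm_tensor_mult[of a k "cnjp b" m] assms by simp

lemma norm_tensor_unit:
  assumes "norm u = 1"
  shows "norm_tensor d (smult u g) = norm_tensor d g"
proof -
  have "re_form d (smult u g) = Re u *\<^sub>R re_form d g - Im u *\<^sub>R im_form d g"
    "im_form d (smult u g) = Im u *\<^sub>R re_form d g + Re u *\<^sub>R im_form d g"
    by (auto intro!: poly_mapping_eqI simp: lookup_re_form lookup_im_form lookup_minus lookup_add)
  moreover have "Re u * Re u + Im u * Im u = 1"
    using assms by (simp add: cmod_def power2_eq_square)
  ultimately show ?thesis
    by (simp add: norm_tensor_def tensor_rotate)
qed

lemma norm_tensor_norm_eq:
  assumes "norm \<gamma> = s"
  shows "norm_tensor d (smult \<gamma> g) = norm_tensor d (smult (of_real s) g)"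
proof (cases "s = 0")
  case False
  have "smult \<gamma> g = smult (\<gamma> / of_real s) (smult (of_real s) g)"
    using False by simp
  moreover have "norm (\<gamma> / of_real s) = 1"
    using assms False by (auto simp: norm_divide)
  ultimately show ?thesis
    using norm_tensor_unit by metis
qed (use assms in simp)

lemma Ex2_imp_norm_tensor:
  assumes "\<theta> \<in> Ex2 d f"
  shows "\<exists>g. degree g \<le> d \<and> \<theta> = norm_tensor d g \<and> g * cnjp g = dehom f"
proof -
  have "\<theta> \<in> psd_tensors d" "mult_map \<theta> = f" "tensor_rank \<theta> = 2"
    using assms by (auto simp: Ex2_def extreme_point_of_def Gram_def)
  then obtain p q where pq: "p \<in> forms d" "q \<in> forms d" "\<theta> = tensor p p + tensor q q"
    using rank_two_two_squares by blast
  define g where "g = dehom p + smult \<i> (dehom q)"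
  note g = pair_to_complex[OF pq(1,2), folded g_def]
  have "f = p * p + q * q"
    using \<open>mult_map \<theta> = f\<close> by (simp add: pq(3) linear_add[OF linear_mult_map] mult_map_tensor)
  then have "g * cnjp g = dehom f"
    using dehom_norm_form[OF g(1)] g by simp
  then show ?thesis
    using g pq by (intro exI[of _ g]) (simp add: norm_tensor_def)
qed

section \<open>Factorisations\<close>

text \<open>
  A constant for the linear factors keeps the simplifier from multiplying them out.
\<close>
definition lin :: "complex \<Rightarrow> complex poly" where
  "lin z = [:- z, 1:]"

lemma poly_lin [simp]: "poly (lin z) x = x - z"
  and lin_neq_0 [simp]: "lin z \<noteq> 0"
  and degree_lin [simp]: "degree (lin z) = 1"
  and lead_coeff_lin [simp]: "coeff (lin z) (Suc 0) = 1"
  and cnjp_lin [simp]: "cnjp (lin z) = lin (cnj z)"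
  by (simp_all add: lin_def)

lemma root_factor:
  assumes "poly p z = 0"
  obtains k where "p = lin z * k"
  using assms by (metis dvdE lin_def poly_eq_0_iff_dvd)

lemma lead_coeff_prod_lin [simp]: "lead_coeff (\<Prod>i\<in>I. lin (z i)) = 1"
  unfolding lead_coeff_prod by simp

lemma degree_prod_lin [simp]: "degree (\<Prod>i\<in>I. lin (z i)) = card I"
  by (cases "finite I") (simp_all add: degree_prod_eq_sum_degree)

text \<open>
  A root \<open>z i\<close> of the product is a root of \<open>h\<close> or of its conjugate, so that \<open>z i\<close> or \<open>cnj (z i)\<close> is a
  root of \<open>h\<close>. Splitting off its linear factor from \<open>h\<close> cancels the whole pair.
\<close>
lemma conjugate_factor_choice:
  assumes "finite I" "c \<noteq> 0" "h * cnjp h = smult c (\<Prod>i\<in>I. lin (z i) * lin (cnj (z i)))"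
  shows "\<exists>S\<subseteq>I. \<exists>\<gamma>. h = smult \<gamma> (\<Prod>i\<in>I. lin (if i \<in> S then z i else cnj (z i)))"
  using assms(1,3)
proof (induction I arbitrary: h)
  case empty
  then have "degree (h * cnjp h) = 0" by simp
  moreover have "h \<noteq> 0" using empty assms(2) by auto
  moreover from this have "cnjp h \<noteq> 0" by (metis cnjp_simps(2) map_poly_0)
  ultimately have "degree h = 0" by (simp add: degree_mult_eq)
  then obtain \<gamma> where "h = [:\<gamma>:]" using degree_eq_zeroE by blast
  then show ?case by (intro exI[of _ "{}"]) (auto intro!: exI[of _ \<gamma>])
next
  case (insert i I)
  have "poly (h * cnjp h) (z i) = 0"
    unfolding insert.prems using insert.hyps by simp
  then have "poly h (z i) = 0 \<or> poly h (cnj (z i)) = 0"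
    by (simp add: poly_cnjp)
  then obtain w where w: "w = z i \<or> w = cnj (z i)" "poly h w = 0" by blast
  then obtain k where k: "h = lin w * k"
    using root_factor by blast
  let ?L = "lin (z i) * lin (cnj (z i))"
  have "?L * (k * cnjp k) = h * cnjp h"
    unfolding k using w(1) by (auto simp: mult_ac)
  also have "\<dots> = ?L * smult c (\<Prod>i\<in>I. lin (z i) * lin (cnj (z i)))"
    using insert.hyps insert.prems by simp
  finally have "k * cnjp k = smult c (\<Prod>i\<in>I. lin (z i) * lin (cnj (z i)))"
    by (subst (asm) mult_cancel_left) auto
  then obtain S \<gamma> where S: "S \<subseteq> I" "k = smult \<gamma> (\<Prod>i\<in>I. lin (if i \<in> S then z i else cnj (z i)))"
    using insert.IH by blast
  define S' where "S' = (if w = z i then insert i S else S)"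
  have "(\<Prod>j\<in>I. lin (if j \<in> S' then z j else cnj (z j))) = (\<Prod>j\<in>I. lin (if j \<in> S then z j else cnj (z j)))"
    using insert.hyps by (intro prod.cong refl) (auto simp: S'_def)
  moreover have "(if i \<in> S' then z i else cnj (z i)) = w"
    using w(1) S(1) insert.hyps by (auto simp: S'_def)
  ultimately have "h = smult \<gamma> (\<Prod>j\<in>insert i I. lin (if j \<in> S' then z j else cnj (z j)))"
    using insert.hyps by (simp add: k S(2))
  moreover have "S' \<subseteq> insert i I" using S(1) by (auto simp: S'_def)
  ultimately show ?case by blast
qed

lemma divisor_of_linear_factors:
  assumes "finite I" "a * b = (\<Prod>i\<in>I. lin (y i))" "lead_coeff a = 1"
  shows "\<exists>S\<subseteq>I. a = (\<Prod>i\<in>S. lin (y i)) \<and> b = (\<Prod>i\<in>I - S. lin (y i))"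
  using assms
proof (induction I arbitrary: a b)
  case empty
  then have "degree (a * b) = 0" "a \<noteq> 0" "b \<noteq> 0" by auto
  then have "degree a = 0" by (simp add: degree_mult_eq)
  then have "a = 1" using empty(2) by (metis degree_eq_zeroE lead_coeff_pCons(2) one_pCons)
  then show ?case using empty by simp
next
  case (insert i I)
  have "poly (a * b) (y i) = 0"
    unfolding insert.prems using insert.hyps by simp
  then consider "poly a (y i) = 0" | "poly b (y i) = 0" by auto
  then show ?case
  proof cases
    case 1
    then obtain k where k: "a = lin (y i) * k"
      using root_factor by blast
    have "lin (y i) * (k * b) = lin (y i) * (\<Prod>i\<in>I. lin (y i))"
      using insert k by (simp add: mult_ac)
    then have "k * b = (\<Prod>i\<in>I. lin (y i))"
      by (subst (asm) mult_cancel_left) auto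
    moreover have "lead_coeff k = 1" using insert.prems(2) unfolding k lead_coeff_mult by simp
    ultimately obtain S where S: "S \<subseteq> I" "k = (\<Prod>i\<in>S. lin (y i))" "b = (\<Prod>i\<in>I - S. lin (y i))"
      using insert.IH by blast
    moreover have "finite S" "i \<notin> S" "insert i I - insert i S = I - S"
      using S insert.hyps finite_subset by auto
    ultimately show ?thesis
      by (intro exI[of _ "insert i S"]) (auto simp: k)
  next
    case 2
    then obtain k where k: "b = lin (y i) * k"
      using root_factor by blast
    have "lin (y i) * (a * k) = lin (y i) * (\<Prod>i\<in>I. lin (y i))"
      using insert k by (simp add: mult_ac)
    then have "a * k = (\<Prod>i\<in>I. lin (y i))"
      by (subst (asm) mult_cancel_left) auto
    then obtain S where S: "S \<subseteq> I" "a = (\<Prod>i\<in>S. lin (y i))" "k = (\<Prod>i\<in>I - S. lin (y i))"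
      using insert.IH insert.prems by blast
    moreover have "insert i I - S = insert i (I - S)" "i \<notin> I - S" "finite (I - S)"
      using S insert.hyps by auto
    ultimately show ?thesis
      by (intro exI[of _ S]) (auto simp: k)
  qed
qed

lemma poly_nonneg_continuous:
  fixes Q :: "complex poly"
  assumes "\<And>x::real. of_real x \<noteq> w \<Longrightarrow> poly Q (of_real x) \<in> \<real>\<^sub>\<ge>\<^sub>0"
  shows "poly Q (of_real x) \<in> \<real>\<^sub>\<ge>\<^sub>0"
proof (cases "of_real x = w")
  case True
  have "((\<lambda>t::real. poly Q (of_real t)) \<longlongrightarrow> poly Q (of_real x)) (at x)"
    by (intro tendsto_intros poly_isCont[THEN isCont_tendsto_compose])
  moreover have "\<forall>\<^sub>F t in at x. poly Q (of_real t) \<in> \<real>\<^sub>\<ge>\<^sub>0"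
    unfolding eventually_at_filter using assms True by (auto intro!: always_eventually)
  ultimately show ?thesis
    by (intro Lim_in_closed_set[of "\<real>\<^sub>\<ge>\<^sub>0"]) (auto intro: closed_nonneg_Reals_complex)
qed (use assms in auto)

text \<open>
  Roots that are not real come in conjugate pairs, and real roots have even multiplicity because the
  sign does not change.
\<close>
lemma nonneg_poly_conjugate_pairs:
  fixes P :: "complex poly"
  assumes "degree P = 2 * d" "\<And>x::real. poly P (of_real x) \<in> \<real>\<^sub>\<ge>\<^sub>0"
  shows "\<exists>z. P = smult (lead_coeff P) (\<Prod>i<d. lin (z i) * lin (cnj (z i)))"
  using assms
proof (induction d arbitrary: P)
  case 0
  then obtain c where "P = [:c:]" using degree_eq_zeroE[of P] by auto
  then show ?case by simp
next
  case (Suc d)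
  have "\<not> constant (poly P)"
    using Suc.prems(1) by (simp add: constant_degree)
  then obtain w where w: "poly P w = 0"
    using fundamental_theorem_of_algebra by blast
  \<comment> \<open>Also for a real root \<open>w\<close> a second factor splits off: the cofactor changes sign at \<open>w\<close>.\<close>
  obtain R where R: "P = lin w * R"
    using root_factor[OF w] by blast
  have "poly R (cnj w) = 0"
  proof (cases "cnj w = w")
    case False
    have real: "poly P (of_real x) = cnj (poly P (of_real x))" for x
      using Suc.prems(2)[of x] by (auto simp: complex_nonneg_Reals_iff complex_eq_iff)
    have "poly (cnjp P - P) (of_real x) = 0" for x
      using real[of x] by (simp add: poly_cnjp)
    then have "range complex_of_real \<subseteq> {x. poly (cnjp P - P) x = 0}" by auto
    moreover have "infinite (range complex_of_real)"
      by (simp add: inj_of_real range_inj_infinite infinite_UNIV_char_0 finite_image_iff)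
    ultimately have "cnjp P - P = 0"
      using poly_roots_finite finite_subset by blast
    then have "poly P (cnj w) = 0"
      using poly_cnjp[of P "cnj w"] w by simp
    then show ?thesis using False by (simp add: R)
  next
    case True
    then obtain r where r: "w = of_real r" by (metis Reals_cnj_iff Reals_cases)
    have "(\<lambda>x. Re (poly R (of_real x))) \<midarrow>r\<rightarrow> Re (poly R (of_real r))"
      and Im: "(\<lambda>x. Im (poly R (of_real x))) \<midarrow>r\<rightarrow> Im (poly R (of_real r))"
      by (intro tendsto_intros poly_isCont[THEN isCont_tendsto_compose])+
    then have lim: "((\<lambda>x. Re (poly R (of_real x))) \<longlongrightarrow> Re (poly R (of_real r))) (at_right r)"
      "((\<lambda>x. Re (poly R (of_real x))) \<longlongrightarrow> Re (poly R (of_real r))) (at_left r)"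
      by (auto simp: filterlim_at_split)
    have PR: "poly P (of_real x) = of_real (x - r) * poly R (of_real x)" for x
      by (simp add: R r)
    have sgn: "0 \<le> (x - r) * Re (poly R (of_real x)) \<and> (x = r \<or> Im (poly R (of_real x)) = 0)" for x
      using Suc.prems(2)[of x] unfolding PR by (auto simp: complex_nonneg_Reals_iff)
    have "0 \<le> Re (poly R (of_real r))"
      by (rule tendsto_lowerbound[OF lim(1)])
        (use sgn in \<open>auto simp: eventually_at_right_field zero_le_mult_iff intro!: exI[of _ "r + 1"]\<close>, force)
    moreover have "Re (poly R (of_real r)) \<le> 0"
      by (rule tendsto_upperbound[OF lim(2)])
        (use sgn in \<open>auto simp: eventually_at_left_field zero_le_mult_iff intro!: exI[of _ "r - 1"]\<close>, force)
    moreover have "Im (poly R (of_real r)) = 0"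
    proof (rule LIM_unique[OF Im])
      show "(\<lambda>x. Im (poly R (of_real x))) \<midarrow>r\<rightarrow> 0"
        by (rule tendsto_eventually, unfold eventually_at_filter, rule always_eventually) (use sgn in blast)
    qed
    ultimately show ?thesis
      unfolding r by (simp add: complex_eq_iff)
  qed
  then obtain Q where "R = lin (cnj w) * Q"
    using root_factor by blast
  with R have Q: "P = lin w * lin (cnj w) * Q" by (simp add: mult.assoc)
  have "P \<noteq> 0" using Suc.prems(1) by auto
  then have "Q \<noteq> 0" using Q by auto
  have deg: "degree Q = 2 * d"
    using Suc.prems(1) \<open>Q \<noteq> 0\<close> unfolding Q by (simp add: degree_mult_eq)
  have nonneg: "poly Q (of_real x) \<in> \<real>\<^sub>\<ge>\<^sub>0" if "of_real x \<noteq> w" for x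
  proof -
    have "of_real x - cnj w = cnj (of_real x - w)" by simp
    then have "poly P (of_real x) = of_real ((norm (of_real x - w))\<^sup>2) * poly Q (of_real x)"
      unfolding Q complex_norm_square by simp
    moreover have "0 < (norm (of_real x - w))\<^sup>2" using that by simp
    ultimately show ?thesis
      using Suc.prems(2)[of x] by (auto simp: complex_nonneg_Reals_iff zero_le_mult_iff)
  qed
  then obtain z where z: "Q = smult (lead_coeff Q) (\<Prod>i<d. lin (z i) * lin (cnj (z i)))"
    using Suc.IH[OF deg poly_nonneg_continuous[of w]] by blast
  define z' where "z' = z(d := w)"
  have "(\<Prod>i<Suc d. lin (z' i) * lin (cnj (z' i))) =
      (\<Prod>i<d. lin (z i) * lin (cnj (z i))) * (lin w * lin (cnj w))"
    by (simp add: z'_def)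
  moreover have "lead_coeff P = lead_coeff Q"
    unfolding Q lead_coeff_mult by simp
  ultimately have "P = smult (lead_coeff P) (\<Prod>i<Suc d. lin (z' i) * lin (cnj (z' i)))"
    by (subst Q, subst z) (simp add: mult_ac)
  then show ?case by blast
qed

section \<open>Determinants certifying independence\<close>

lemma det_nonzero_independent:
  fixes V :: "'n::finite \<Rightarrow> complex poly" and e :: "'n \<Rightarrow> nat"
  assumes det: "det (\<chi> i j. coeff (V i) (e j) :: complex^'n^'n) \<noteq> 0"
    and 0: "(\<Sum>i\<in>UNIV. smult (c i) (V i)) = 0"
  shows "c i = 0"
proof -
  let ?A = "\<chi> i j. coeff (V i) (e j) :: complex^'n^'n"
  let ?T = "transpose ?A"
  have "det ?T \<noteq> 0" using det by (simp add: det_transpose)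
  then obtain B where B: "B ** ?T = mat 1"
    using invertible_det_nz[of ?T] unfolding invertible_def by blast
  have "(\<Sum>i\<in>UNIV. c i * coeff (V i) (e j)) = 0" for j
    using arg_cong[OF 0, of "\<lambda>p. coeff p (e j)"] by (simp add: coeff_sum)
  then have "?T *v (\<chi> i. c i) = 0"
    by (simp add: vec_eq_iff matrix_vector_mult_def transpose_def mult.commute)
  then have "(B ** ?T) *v (\<chi> i. c i) = 0"
    unfolding matrix_vector_mul_assoc[symmetric] by simp
  then show ?thesis
    unfolding B by (simp add: vec_eq_iff)
qed

definition re_part :: "complex poly \<Rightarrow> complex poly" where
  "re_part g = smult (1 / 2) (g + cnjp g)"

definition im_part :: "complex poly \<Rightarrow> complex poly" where
  "im_part g = smult (- \<i> / 2) (g - cnjp g)"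

definition part_powers :: "nat \<Rightarrow> complex poly \<Rightarrow> nat \<Rightarrow> complex poly" where
  "part_powers n g i = re_part g ^ (n - i) * im_part g ^ i"

text \<open>
  If this determinant is nonzero, the products of monomials of degree \<open>n\<close> in the parts of \<open>a\<close> and of
  \<open>b\<close> are independent. It selects as many coefficients as there are products, and so it depends
  polynomially on \<open>a\<close> and \<open>b\<close>.
\<close>
definition product_minor ::
    "('n::finite \<Rightarrow> nat) \<Rightarrow> nat \<Rightarrow> (nat \<Rightarrow> nat) \<Rightarrow> (nat \<Rightarrow> nat) \<Rightarrow> complex poly \<Rightarrow> complex poly \<Rightarrow> complex" where
  "product_minor \<iota> n e e' a b =
    det (\<chi> i j. coeff (part_powers n a (\<iota> (fst i)) * part_powers n b (\<iota> (snd i))) (e (\<iota> (fst j)) + e' (\<iota> (snd j)))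
      :: complex^('n \<times> 'n)^('n \<times> 'n))"

lemma product_minor_monomials:
  assumes a: "\<And>i. part_powers n a (\<iota> i) = monom 1 (e (\<iota> i))" and b: "\<And>i. part_powers n b (\<iota> i) = monom 1 (e' (\<iota> i))"
    and inj: "inj (\<lambda>i :: 'n::finite \<times> 'n. e (\<iota> (fst i)) + e' (\<iota> (snd i)))"
  shows "product_minor \<iota> n e e' a b = 1"
proof -
  have "(\<chi> i j. coeff (part_powers n a (\<iota> (fst i)) * part_powers n b (\<iota> (snd i))) (e (\<iota> (fst j)) + e' (\<iota> (snd j)))
      :: complex^('n \<times> 'n)^('n \<times> 'n)) = mat 1"
    using injD[OF inj] by (auto simp: vec_eq_iff mat_def a b mult_monom)
  then show ?thesis
    by (simp add: product_minor_def)
qed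

lemma product_minor_independent:
  fixes \<iota> :: "'n::finite \<Rightarrow> nat"
  assumes minor: "product_minor \<iota> n e e' a b \<noteq> 0" and \<iota>: "bij_betw \<iota> UNIV {..n}"
    and deg: "degree a \<le> k" "degree b \<le> m"
    and 0: "(\<Sum>i\<le>n. \<Sum>j\<le>n. c i j *\<^sub>R ((re_form k a ^ (n - i) * im_form k a ^ i) *
        (re_form m b ^ (n - j) * im_form m b ^ j))) = 0"
    and ij: "i \<le> n" "j \<le> n"
  shows "c i j = 0"
proof -
  have pa: "dehom (re_form k a ^ (n - i) * im_form k a ^ i) = part_powers n a i" for i
    by (simp add: dehom_mult dehom_power part_powers_def re_part_def im_part_def
        dehom_re_form[OF deg(1)] dehom_im_form[OF deg(1)])
  have pb: "dehom (re_form m b ^ (n - i) * im_form m b ^ i) = part_powers n b i" for i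
    by (simp add: dehom_mult dehom_power part_powers_def re_part_def im_part_def
        dehom_re_form[OF deg(2)] dehom_im_form[OF deg(2)])
  have reindex: "(\<Sum>i\<le>n. g i) = (\<Sum>i\<in>UNIV. g (\<iota> i))" for g :: "nat \<Rightarrow> complex poly"
    using sum.reindex_bij_betw[OF \<iota>, of g] by simp
  have "0 = dehom (\<Sum>i\<le>n. \<Sum>j\<le>n. c i j *\<^sub>R ((re_form k a ^ (n - i) * im_form k a ^ i) *
        (re_form m b ^ (n - j) * im_form m b ^ j)))"
    using 0 by simp
  also have "\<dots> = (\<Sum>i\<le>n. \<Sum>j\<le>n. smult (of_real (c i j)) (part_powers n a i * part_powers n b j))"
    by (simp only: dehom_sum dehom_scale dehom_mult[of "_ * _" "_ * _"] pa pb)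
  also have "\<dots> = (\<Sum>i\<in>UNIV. \<Sum>j\<in>UNIV. smult (of_real (c (\<iota> i) (\<iota> j))) (part_powers n a (\<iota> i) * part_powers n b (\<iota> j)))"
    by (simp only: reindex)
  also have "\<dots> = (\<Sum>i\<in>UNIV. smult (of_real (c (\<iota> (fst i)) (\<iota> (snd i)))) (part_powers n a (\<iota> (fst i)) * part_powers n b (\<iota> (snd i))))"
    by (simp add: sum.cartesian_product UNIV_Times_UNIV[symmetric] case_prod_beta del: UNIV_Times_UNIV)
  finally have *: "complex_of_real (c (\<iota> (fst i)) (\<iota> (snd i))) = 0" for i
    using minor unfolding product_minor_def by (intro det_nonzero_independent) auto
  obtain i' j' where "i = \<iota> i'" "j = \<iota> j'"
    using \<iota> ij by (metis atMost_iff bij_betw_imp_surj_on imageE)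
  then show ?thesis using *[of "(i', j')"] by simp
qed

text \<open>
  The finite types of size three and two index matrices; \<open>idx3\<close> and \<open>idx2\<close> translate their elements
  to the exponents of the imaginary part.
\<close>
definition idx3 :: "3 \<Rightarrow> nat" where
  "idx3 i = (if i = 1 then 0 else if i = 2 then 1 else 2)"

definition idx2 :: "2 \<Rightarrow> nat" where
  "idx2 i = (if i = 1 then 0 else 1)"

lemma bij_idx3: "bij_betw idx3 UNIV {..2}"
proof -
  have v: "idx3 1 = 0" "idx3 2 = 1" "idx3 3 = 2" by (simp_all add: idx3_def)
  have "{..2::nat} = {0, 1, 2}" by auto
  then have "idx3 ` UNIV = {..2}" unfolding UNIV_3 by (simp add: v)
  moreover have "inj idx3"
    unfolding inj_def by (simp add: forall_3 v)
  ultimately show ?thesis by (simp add: bij_betw_def)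
qed

lemma bij_idx2: "bij_betw idx2 UNIV {..1}"
proof -
  have v: "idx2 1 = 0" "idx2 2 = 1" by (simp_all add: idx2_def)
  have "{..1::nat} = {0, 1}" by auto
  then have "idx2 ` UNIV = {..1}" unfolding UNIV_2 by (simp add: v)
  moreover have "inj idx2"
    unfolding inj_def by (simp add: forall_2 v)
  ultimately show ?thesis by (simp add: bij_betw_def)
qed

text \<open>
  The exponents are those of the products for \<open>a = x^k + \<i> x^(k-3)\<close> and
  \<open>b = x^m + \<i> x^(m-1)\<close>, where the exponents of the nine products differ: they are nine
  consecutive integers. For two quadratic forms only the four products can be independent,
  for instance with \<open>a = x^2 + \<i>\<close> and \<open>b = x^2 + \<i> x\<close>.
\<close>
definition generic_minor :: "nat \<Rightarrow> nat \<Rightarrow> complex poly \<Rightarrow> complex poly \<Rightarrow> complex" where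
  "generic_minor k m a b =
    (if 3 \<le> k \<and> 1 \<le> m then product_minor idx3 2 (\<lambda>i. 2 * k - 3 * i) (\<lambda>j. 2 * m - j) a b
     else if k = 2 \<and> m = 2 then product_minor idx2 1 (\<lambda>i. 2 - 2 * i) (\<lambda>j. 2 - j) a b
     else 1)"

lemma atMost_2_lessThan_3: "{..2::nat} = {..<3}" by auto

lemma generic_minor_biquadratic_indep:
  assumes "generic_minor k m a b \<noteq> 0" "3 \<le> k" "1 \<le> m" "degree a \<le> k" "degree b \<le> m"
  shows "biquadratic_indep (re_form k a) (im_form k a) (re_form m b) (im_form m b)"
  unfolding biquadratic_indep_def
proof (intro allI impI)
  fix c :: "nat \<Rightarrow> nat \<Rightarrow> real" and i j :: nat
  assume "(\<Sum>i<3. \<Sum>j<3. c i j *\<^sub>R ((re_form k a ^ (2 - i) * im_form k a ^ i) *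
      (re_form m b ^ (2 - j) * im_form m b ^ j))) = 0" and ij: "i < 3" "j < 3"
  then have 0: "(\<Sum>i\<le>2. \<Sum>j\<le>2. c i j *\<^sub>R ((re_form k a ^ (2 - i) * im_form k a ^ i) *
      (re_form m b ^ (2 - j) * im_form m b ^ j))) = 0"
    by (simp only: atMost_2_lessThan_3)
  show "c i j = 0"
    using assms ij by (intro product_minor_independent[OF _ bij_idx3 assms(4,5) 0]) (auto simp: generic_minor_def)
qed

lemma generic_minor_lin_indep:
  assumes "generic_minor 2 2 a b \<noteq> 0" "degree a \<le> 2" "degree b \<le> 2"
  shows "lin_indep 4 (prods (re_form 2 a) (im_form 2 a) (re_form 2 b) (im_form 2 b))"
  unfolding lin_indep_4_iff
proof (intro allI impI)
  fix x y z w :: real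
  assume *: "x *\<^sub>R (re_form 2 a * re_form 2 b) + y *\<^sub>R (re_form 2 a * im_form 2 b) +
       z *\<^sub>R (im_form 2 a * re_form 2 b) + w *\<^sub>R (im_form 2 a * im_form 2 b) = 0"
  let ?c = "\<lambda>i j. [[x, y], [z, w]] ! i ! j"
  have 0: "(\<Sum>i\<le>1. \<Sum>j\<le>1. ?c i j *\<^sub>R ((re_form 2 a ^ (1 - i) * im_form 2 a ^ i) *
      (re_form 2 b ^ (1 - j) * im_form 2 b ^ j))) = 0"
    using * by (simp add: add.assoc)
  have "?c i j = 0" if "i \<le> 1" "j \<le> 1" for i j
    using assms that by (intro product_minor_independent[OF _ bij_idx2 assms(2,3) 0]) (auto simp: generic_minor_def)
  from this[of 0 0] this[of 0 1] this[of 1 0] this[of 1 1]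
  show "x = 0 \<and> y = 0 \<and> z = 0 \<and> w = 0" by simp
qed

lemma parts_of_monomial_pair:
  assumes "g = monom 1 p + monom \<i> q"
  shows "re_part g = monom 1 p" "im_part g = monom 1 q"
proof -
  have "coeff (re_part g) l = coeff (monom 1 p) l" "coeff (im_part g) l = coeff (monom 1 q) l" for l
    unfolding re_part_def im_part_def coeff_smult coeff_add coeff_diff cnjp_simps(1) assms by simp_all
  then show "re_part g = monom 1 p" "im_part g = monom 1 q"
    by (auto intro: poly_eqI)
qed

lemma monic_monomial_pair:
  assumes "q < p"
  shows "degree (monom 1 p + monom \<i> q) = p" "lead_coeff (monom 1 p + monom \<i> q) = 1"
proof -
  show deg: "degree (monom 1 p + monom \<i> q) = p"
    using assms by (subst degree_add_eq_left) (auto simp: degree_monom_eq)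
  show "lead_coeff (monom 1 p + monom \<i> q) = 1"
    unfolding deg using assms by simp
qed

lemma part_powers_monomial_pair:
  assumes "q \<le> p" "i \<le> n"
  shows "part_powers n (monom 1 p + monom \<i> q) i = monom 1 (n * p - (p - q) * i)"
proof -
  have "p * (n - i) + q * i = n * p - (p - q) * i"
    using assms by (auto simp: algebra_simps diff_mult_distrib diff_mult_distrib2 intro: mult_right_mono dest: le_Suc_ex)
  then show ?thesis
    by (simp add: part_powers_def parts_of_monomial_pair monom_power mult_monom)
qed

lemma unique_digits:
  fixes x y x' y' n :: nat
  assumes "n * x + y = n * x' + y'" "y < n" "y' < n"
  shows "x = x' \<and> y = y'"
proof -
  have "(n * x + y) div n = x" "(n * x' + y') div n = x'" using assms(2,3) by simp_all
  then show ?thesis using assms(1) by auto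
qed

lemma generic_minor_example:
  "\<exists>a b. degree a = k \<and> lead_coeff a = 1 \<and> degree b = m \<and> lead_coeff b = 1 \<and> generic_minor k m a b \<noteq> 0"
proof -
  have idx3: "idx3 i \<le> 2" for i by (simp add: idx3_def)
  have idx2: "idx2 i \<le> 1" for i by (simp add: idx2_def)
  consider (nine) "3 \<le> k" "1 \<le> m" | (four) "k = 2" "m = 2" | (none) "\<not> (3 \<le> k \<and> 1 \<le> m)" "\<not> (k = 2 \<and> m = 2)"
    by blast
  then show ?thesis
  proof cases
    case nine
    define a b where "a = monom 1 k + monom \<i> (k - 3)" and "b = monom 1 m + monom \<i> (m - 1)"
    have inj: "inj (\<lambda>i :: 3 \<times> 3. (2 * k - 3 * idx3 (fst i)) + (2 * m - idx3 (snd i)))"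
    proof (rule injI)
      fix i j :: "3 \<times> 3"
      assume eq: "(2 * k - 3 * idx3 (fst i)) + (2 * m - idx3 (snd i)) = (2 * k - 3 * idx3 (fst j)) + (2 * m - idx3 (snd j))"
      have *: "3 * idx3 (fst i) \<le> 2 * k" "idx3 (snd i) \<le> 2 * m" "3 * idx3 (fst j) \<le> 2 * k" "idx3 (snd j) \<le> 2 * m"
        using nine idx3[of "fst i"] idx3[of "snd i"] idx3[of "fst j"] idx3[of "snd j"] by linarith+
      have "3 * idx3 (fst i) + idx3 (snd i) = 3 * idx3 (fst j) + idx3 (snd j)"
        using eq * by linarith
      then have "idx3 (fst i) = idx3 (fst j) \<and> idx3 (snd i) = idx3 (snd j)"
        by (rule unique_digits) (use idx3[of "snd i"] idx3[of "snd j"] in simp_all)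
      then show "i = j"
        using bij_idx3 by (auto simp: bij_betw_def prod_eq_iff dest: injD)
    qed
    have "product_minor idx3 2 (\<lambda>i. 2 * k - 3 * i) (\<lambda>j. 2 * m - j) a b = 1"
      using nine by (intro product_minor_monomials inj) (simp_all add: a_def b_def part_powers_monomial_pair idx3)
    then have "generic_minor k m a b = 1"
      using nine by (simp only: generic_minor_def if_True simp_thms)
    moreover have "degree a = k" "lead_coeff a = 1" "degree b = m" "lead_coeff b = 1"
      unfolding a_def b_def using nine by (intro monic_monomial_pair; simp)+
    ultimately show ?thesis
      by (metis zero_neq_one)
  next
    case four
    define a b where "a = monom 1 2 + monom \<i> 0" and "b = monom 1 2 + monom \<i> 1"
    have inj: "inj (\<lambda>i :: 2 \<times> 2. (2 - 2 * idx2 (fst i)) + (2 - idx2 (snd i)))"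
    proof (rule injI)
      fix i j :: "2 \<times> 2"
      assume eq: "(2 - 2 * idx2 (fst i)) + (2 - idx2 (snd i)) = (2 - 2 * idx2 (fst j)) + (2 - idx2 (snd j))"
      have "2 * idx2 (fst i) + idx2 (snd i) = 2 * idx2 (fst j) + idx2 (snd j)"
        using eq idx2[of "fst i"] idx2[of "snd i"] idx2[of "fst j"] idx2[of "snd j"] by linarith
      then have "idx2 (fst i) = idx2 (fst j) \<and> idx2 (snd i) = idx2 (snd j)"
        by (rule unique_digits) (use idx2[of "snd i"] idx2[of "snd j"] in simp_all)
      then show "i = j"
        using bij_idx2 by (auto simp: bij_betw_def prod_eq_iff dest: injD)
    qed
    have "part_powers 1 a (idx2 i) = monom 1 (2 - 2 * idx2 i)" "part_powers 1 b (idx2 i) = monom 1 (2 - idx2 i)" for i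
      using part_powers_monomial_pair[of 0 2 "idx2 i" 1] part_powers_monomial_pair[of 1 2 "idx2 i" 1] idx2[of i]
      unfolding a_def b_def by simp_all
    then have "product_minor idx2 1 (\<lambda>i. 2 - 2 * i) (\<lambda>j. 2 - j) a b = 1"
      by (intro product_minor_monomials inj)
    then have "generic_minor k m a b = 1"
      using four by (simp add: generic_minor_def)
    moreover have "degree a = k" "lead_coeff a = 1" "degree b = m" "lead_coeff b = 1"
      unfolding a_def b_def four by (rule monic_monomial_pair; simp)+
    ultimately show ?thesis
      by (metis zero_neq_one)
  next
    case none
    then have "generic_minor k m a b = 1" for a b
      by (simp only: generic_minor_def if_False)
    moreover have "degree (monom (1::complex) n) = n" "lead_coeff (monom (1::complex) n) = 1" for n
      by (simp_all add: degree_monom_eq)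
    ultimately show ?thesis
      by (metis zero_neq_one)
  qed
qed

section \<open>Real polynomial functions of the roots\<close>

text \<open>
  Polynomials in finitely many roots and their conjugates. Continuity and polynomial dependence along
  real lines are all that is used of them, and both follow by induction.
\<close>
inductive real_poly_fun :: "((nat \<Rightarrow> complex) \<Rightarrow> complex) \<Rightarrow> bool" where
  const: "real_poly_fun (\<lambda>z. c)"
| coord: "real_poly_fun (\<lambda>z. z i)"
| cnj_coord: "real_poly_fun (\<lambda>z. cnj (z i))"
| add: "real_poly_fun \<phi> \<Longrightarrow> real_poly_fun \<psi> \<Longrightarrow> real_poly_fun (\<lambda>z. \<phi> z + \<psi> z)"
| mult: "real_poly_fun \<phi> \<Longrightarrow> real_poly_fun \<psi> \<Longrightarrow> real_poly_fun (\<lambda>z. \<phi> z * \<psi> z)"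

lemma real_poly_fun_sum:
  "(\<And>i. i \<in> I \<Longrightarrow> real_poly_fun (\<phi> i)) \<Longrightarrow> real_poly_fun (\<lambda>z. \<Sum>i\<in>I. \<phi> i z)"
  by (induction I rule: infinite_finite_induct) (auto intro: real_poly_fun.intros)

lemma real_poly_fun_prod:
  "(\<And>i. i \<in> I \<Longrightarrow> real_poly_fun (\<phi> i)) \<Longrightarrow> real_poly_fun (\<lambda>z. \<Prod>i\<in>I. \<phi> i z)"
  by (induction I rule: infinite_finite_induct) (auto intro: real_poly_fun.intros)

lemma real_poly_fun_cnj: "real_poly_fun \<phi> \<Longrightarrow> real_poly_fun (\<lambda>z. cnj (\<phi> z))"
  by (induction rule: real_poly_fun.induct) (auto intro: real_poly_fun.intros)

lemma real_poly_fun_continuous: "real_poly_fun \<phi> \<Longrightarrow> continuous_on A \<phi>"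
proof (induction rule: real_poly_fun.induct)
  case (coord i)
  show ?case by (rule continuous_on_subset[OF continuous_on_product_coordinates]) simp
next
  case (cnj_coord i)
  show ?case
    by (intro continuous_on_cnj continuous_on_subset[OF continuous_on_product_coordinates]) simp
qed (auto intro: continuous_intros)

lemma real_poly_fun_on_line:
  "real_poly_fun \<phi> \<Longrightarrow> \<exists>q. \<forall>t::real. \<phi> (\<lambda>i. z i + of_real t * (w i - z i)) = poly q (of_real t)"
proof (induction rule: real_poly_fun.induct)
  case (const c)
  show ?case by (intro exI[of _ "[:c:]"]) simp
next
  case (coord i)
  show ?case by (intro exI[of _ "[:z i, w i - z i:]"]) simp
next
  case (cnj_coord i)
  show ?case by (intro exI[of _ "[:cnj (z i), cnj (w i - z i):]"]) simp
next
  case (add \<phi> \<psi>)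
  then obtain q r where "\<forall>t::real. \<phi> (\<lambda>i. z i + of_real t * (w i - z i)) = poly q (of_real t)"
    "\<forall>t::real. \<psi> (\<lambda>i. z i + of_real t * (w i - z i)) = poly r (of_real t)" by blast
  then show ?case by (intro exI[of _ "q + r"]) simp
next
  case (mult \<phi> \<psi>)
  then obtain q r where "\<forall>t::real. \<phi> (\<lambda>i. z i + of_real t * (w i - z i)) = poly q (of_real t)"
    "\<forall>t::real. \<psi> (\<lambda>i. z i + of_real t * (w i - z i)) = poly r (of_real t)" by blast
  then show ?case by (intro exI[of _ "q * r"]) simp
qed

text \<open>
  The restriction to the line is a polynomial in the parameter that does not vanish at one.
\<close>
lemma real_poly_fun_finite_zeros_on_line:
  assumes "real_poly_fun \<phi>" "\<phi> w \<noteq> 0"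
  shows "finite {t::real. \<phi> (\<lambda>i. z i + of_real t * (w i - z i)) = 0}"
proof -
  obtain q where q: "\<And>t::real. \<phi> (\<lambda>i. z i + of_real t * (w i - z i)) = poly q (of_real t)"
    using real_poly_fun_on_line[OF assms(1)] by blast
  have "q \<noteq> 0" using q[of 1] assms(2) by auto
  then have "finite (of_real -` {x. poly q x = 0} :: real set)"
    by (intro finite_vimageI poly_roots_finite) (auto simp: inj_of_real)
  then show ?thesis
    by (rule finite_subset[rotated]) (simp add: q subset_eq)
qed

text \<open>
  A point where one factor is nonzero is joined by a line to a point where the others are nonzero; on
  this line each side has finitely many zeros.
\<close>
lemma real_poly_fun_prod_nonzero:
  assumes "finite K" "\<And>k. k \<in> K \<Longrightarrow> real_poly_fun (\<phi> k)" "\<And>k. k \<in> K \<Longrightarrow> \<exists>z. \<phi> k z \<noteq> 0"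
  shows "\<exists>z. (\<Prod>k\<in>K. \<phi> k z) \<noteq> 0"
  using assms
proof (induction K)
  case (insert k K)
  obtain z where z: "\<phi> k z \<noteq> 0" using insert.prems by blast
  obtain w where w: "(\<Prod>k\<in>K. \<phi> k w) \<noteq> 0" using insert by blast
  let ?l = "\<lambda>t::real. \<lambda>i. z i + of_real t * (w i - z i)"
  let ?l' = "\<lambda>t::real. \<lambda>i. w i + of_real t * (z i - w i)"
  have "finite {t. (\<Prod>k\<in>K. \<phi> k (?l t)) = 0}"
    by (rule real_poly_fun_finite_zeros_on_line[OF real_poly_fun_prod])
      (use insert.prems w in auto)
  moreover have "finite {t. \<phi> k (?l t) = 0}"
  proof -
    have "finite {t. \<phi> k (?l' t) = 0}"
      by (rule real_poly_fun_finite_zeros_on_line) (use insert.prems z in auto)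
    then have "finite ((\<lambda>t. 1 - t) ` {t. \<phi> k (?l' t) = 0})" by simp
    moreover have "?l t = ?l' (1 - t)" for t
      by (intro ext) (simp add: algebra_simps)
    ultimately show ?thesis
      by (rule_tac finite_subset[rotated]) (auto simp: image_iff intro!: exI[of _ "1 - _"])
  qed
  ultimately have "finite ({t. (\<Prod>k\<in>K. \<phi> k (?l t)) = 0} \<union> {t. \<phi> k (?l t) = 0})" by simp
  then obtain t :: real where "t \<notin> {t. (\<Prod>k\<in>K. \<phi> k (?l t)) = 0} \<union> {t. \<phi> k (?l t) = 0}"
    using ex_new_if_finite infinite_UNIV_char_0 by blast
  then show ?case using insert.hyps by (intro exI[of _ "?l t"]) simp
qed simp

definition real_poly_coeffs :: "((nat \<Rightarrow> complex) \<Rightarrow> complex poly) \<Rightarrow> bool" where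
  "real_poly_coeffs F \<longleftrightarrow> (\<forall>n. real_poly_fun (\<lambda>z. coeff (F z) n))"

lemma real_poly_coeffs_intros:
  "real_poly_coeffs (\<lambda>z. p)"
  "real_poly_coeffs F \<Longrightarrow> real_poly_coeffs G \<Longrightarrow> real_poly_coeffs (\<lambda>z. F z + G z)"
  "real_poly_coeffs F \<Longrightarrow> real_poly_coeffs G \<Longrightarrow> real_poly_coeffs (\<lambda>z. F z * G z)"
  "real_poly_coeffs F \<Longrightarrow> real_poly_coeffs (\<lambda>z. smult c (F z))"
  "real_poly_coeffs F \<Longrightarrow> real_poly_coeffs (\<lambda>z. cnjp (F z))"
  by (auto simp: real_poly_coeffs_def coeff_mult intro!: real_poly_fun.intros real_poly_fun_sum real_poly_fun_cnj)

lemma real_poly_coeffs_diff: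
  "real_poly_coeffs F \<Longrightarrow> real_poly_coeffs G \<Longrightarrow> real_poly_coeffs (\<lambda>z. F z - G z)"
  using real_poly_coeffs_intros(2)[OF _ real_poly_coeffs_intros(4)[of G "- 1"]] by simp

lemma real_poly_coeffs_power: "real_poly_coeffs F \<Longrightarrow> real_poly_coeffs (\<lambda>z. F z ^ n)"
  by (induction n) (auto intro: real_poly_coeffs_intros)

lemma real_poly_coeffs_prod:
  "(\<And>i. i \<in> I \<Longrightarrow> real_poly_coeffs (F i)) \<Longrightarrow> real_poly_coeffs (\<lambda>z. \<Prod>i\<in>I. F i z)"
  by (induction I rule: infinite_finite_induct) (auto intro: real_poly_coeffs_intros)

lemma real_poly_coeffs_lin: "real_poly_fun \<phi> \<Longrightarrow> real_poly_coeffs (\<lambda>z. lin (\<phi> z))"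
  unfolding real_poly_coeffs_def lin_def
proof
  fix n assume \<phi>: "real_poly_fun \<phi>"
  have "real_poly_fun (\<lambda>z. - 1 * \<phi> z)" by (intro real_poly_fun.intros \<phi>)
  then show "real_poly_fun (\<lambda>z. coeff [:- \<phi> z, 1:] n)"
    by (cases n) (simp_all add: real_poly_fun.const)
qed

lemma real_poly_fun_product_minor:
  assumes "real_poly_coeffs F" "real_poly_coeffs G"
  shows "real_poly_fun (\<lambda>z. product_minor \<iota> n e e' (F z) (G z))"
proof -
  have "real_poly_fun (\<lambda>z. coeff (part_powers n (F z) i * part_powers n (G z) j) l)" for i j l
    using assms unfolding part_powers_def re_part_def im_part_def
    by (intro real_poly_coeffs_intros real_poly_coeffs_power real_poly_coeffs_diff
        real_poly_coeffs_def[THEN iffD1, rule_format])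
  then show ?thesis
    unfolding product_minor_def det_def
    by (auto intro!: real_poly_fun_sum real_poly_fun.intros real_poly_fun_prod)
qed

lemma real_poly_fun_generic_minor:
  assumes "real_poly_coeffs F" "real_poly_coeffs G"
  shows "real_poly_fun (\<lambda>z. generic_minor k m (F z) (G z))"
proof -
  have eq: "(\<lambda>z. generic_minor k m (F z) (G z)) =
    (if 3 \<le> k \<and> 1 \<le> m then (\<lambda>z. product_minor idx3 2 (\<lambda>i. 2 * k - 3 * i) (\<lambda>j. 2 * m - j) (F z) (G z))
     else if k = 2 \<and> m = 2 then (\<lambda>z. product_minor idx2 1 (\<lambda>i. 2 - 2 * i) (\<lambda>j. 2 - j) (F z) (G z))
     else (\<lambda>z. 1))"
    by (auto simp: generic_minor_def fun_eq_iff)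
  show ?thesis
    unfolding eq by (simp add: real_poly_fun_product_minor[OF assms] real_poly_fun.const)
qed

section \<open>The generic set is open and dense\<close>

definition conj_pairs :: "nat \<Rightarrow> (nat \<Rightarrow> complex) \<Rightarrow> complex poly" where
  "conj_pairs d z = (\<Prod>i<d. lin (z i) * lin (cnj (z i)))"

lemma conj_pairs_simps [simp]:
  "cnjp (conj_pairs d z) = conj_pairs d z" "degree (conj_pairs d z) = 2 * d" "coeff (conj_pairs d z) (2 * d) = 1"
proof -
  show "cnjp (conj_pairs d z) = conj_pairs d z"
    by (simp add: conj_pairs_def cnjp_prod mult.commute)
  have split: "conj_pairs d z = (\<Prod>i<d. lin (z i)) * (\<Prod>i<d. lin (cnj (z i)))"
    by (simp add: conj_pairs_def prod.distrib)
  have "(\<Prod>i<d. lin (z i)) \<noteq> 0" "(\<Prod>i<d. lin (cnj (z i))) \<noteq> 0"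
    by simp_all
  then show deg: "degree (conj_pairs d z) = 2 * d"
    unfolding split by (subst degree_mult_eq) simp_all
  have "lead_coeff (conj_pairs d z) = 1"
    unfolding split lead_coeff_mult lead_coeff_prod_lin by simp
  then show "coeff (conj_pairs d z) (2 * d) = 1"
    unfolding deg .
qed

definition pair_form :: "nat \<Rightarrow> real \<Rightarrow> (nat \<Rightarrow> complex) \<Rightarrow> bpoly" where
  "pair_form d c z = re_form (2 * d) (smult (of_real c) (conj_pairs d z))"

lemma dehom_pair_form: "dehom (pair_form d c z) = smult (of_real c) (conj_pairs d z)"
proof -
  have "degree (smult (of_real c) (conj_pairs d z)) \<le> 2 * d"
    by (rule order_trans[OF degree_smult_le]) simp
  then show ?thesis
    by (simp add: pair_form_def dehom_re_form smult_add_left[symmetric])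
qed

lemma lead_pair_form: "lookup (pair_form d c z) (2 * d, 0) = c"
  by (simp add: pair_form_def lookup_re_form)

lemma norm_form_eqI:
  assumes "degree g \<le> d" "f \<in> forms (2 * d)" "dehom f = g * cnjp g"
  shows "f = re_form d g * re_form d g + im_form d g * im_form d g"
proof (rule dehom_inject[OF assms(2)])
  show "re_form d g * re_form d g + im_form d g * im_form d g \<in> forms (2 * d)"
    unfolding mult_2
    by (intro subspace_add[OF forms_subspace] forms_mult re_form_in_forms im_form_in_forms)
qed (simp add: dehom_norm_form[OF assms(1)] assms(3))

lemma sum_two_squares_in_sos_cone:
  "p \<in> forms d \<Longrightarrow> q \<in> forms d \<Longrightarrow> p * p + q * q \<in> sos_cone d"
  unfolding sos_cone_def
  by (intro CollectI exI[of _ 2] exI[of _ "\<lambda>i. if i = 0 then p else q"])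
    (simp add: eval_nat_numeral power2_eq_square)

lemma pair_form_sos:
  assumes "0 \<le> c"
  shows "pair_form d c z \<in> sos_cone d"
proof -
  let ?g = "smult (of_real (sqrt c)) (\<Prod>i<d. lin (z i))"
  have deg: "degree ?g \<le> d" by (rule order_trans[OF degree_smult_le]) simp
  have "dehom (pair_form d c z) = ?g * cnjp ?g"
    using assms
    by (simp add: dehom_pair_form cnjp_prod conj_pairs_def prod.distrib of_real_mult[symmetric] del: of_real_mult)
  then have "pair_form d c z = re_form d ?g * re_form d ?g + im_form d ?g * im_form d ?g"
    by (intro norm_form_eqI deg) (simp_all add: pair_form_def re_form_in_forms)
  then show ?thesis
    by (metis sum_two_squares_in_sos_cone re_form_in_forms im_form_in_forms)
qed

lemma sos_cone_forms: "f \<in> sos_cone d \<Longrightarrow> f \<in> forms (2 * d)"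
  unfolding sos_cone_def mult_2 power2_eq_square
  by (auto intro!: subspace_sum[OF forms_subspace] forms_mult)

lemma sos_cone_nonneg:
  assumes "f \<in> sos_cone d"
  shows "poly (dehom f) (of_real x) \<in> \<real>\<^sub>\<ge>\<^sub>0"
proof -
  obtain r p where p: "\<forall>i<r. p i \<in> forms d" "f = (\<Sum>i<(r::nat). (p i)\<^sup>2)"
    using assms by (auto simp: sos_cone_def)
  have real: "Im (poly (dehom (p i)) (of_real x)) = 0" if "i < r" for i
  proof -
    have "cnjp (dehom (p i)) = dehom (p i)"
      using p(1) that by (auto intro!: poly_eqI simp: coeff_dehom[of _ d])
    then show ?thesis
      using poly_cnjp[of "dehom (p i)" "of_real x"] by (simp add: complex_eq_iff)
  qed
  have "poly (dehom f) (of_real x) = (\<Sum>i<r. (poly (dehom (p i)) (of_real x))\<^sup>2)"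
    by (simp add: p(2) dehom_sum dehom_power poly_sum)
  moreover have "(poly (dehom (p i)) (of_real x))\<^sup>2 \<in> \<real>\<^sub>\<ge>\<^sub>0" if "i < r" for i
    using real[OF that] by (simp add: complex_nonneg_Reals_iff power2_eq_square)
  ultimately show ?thesis
    by (auto simp: complex_nonneg_Reals_iff intro!: sum_nonneg)
qed

lemma sos_cone_pair_form:
  assumes f: "f \<in> sos_cone d" and lead: "0 < lookup f (2 * d, 0)"
  obtains z where "f = pair_form d (lookup f (2 * d, 0)) z"
proof -
  let ?c = "lookup f (2 * d, 0)"
  note fF = sos_cone_forms[OF f]
  have c: "coeff (dehom f) (2 * d) = of_real ?c"
    by (simp add: coeff_dehom[OF fF])
  have deg: "degree (dehom f) = 2 * d"
    using degree_dehom[OF fF] le_degree[of "dehom f" "2 * d"] c lead by simp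
  obtain z where "dehom f = smult (lead_coeff (dehom f)) (\<Prod>i<d. lin (z i) * lin (cnj (z i)))"
    using nonneg_poly_conjugate_pairs[OF deg sos_cone_nonneg[OF f]] by blast
  then have "dehom f = dehom (pair_form d ?c z)"
    by (simp add: deg c dehom_pair_form conj_pairs_def)
  then have "f = pair_form d ?c z"
    by (rule dehom_inject[OF fF, rotated]) (simp add: pair_form_def re_form_in_forms)
  then show thesis by (rule that)
qed

lemma sos_cone_lead_nonneg:
  assumes f: "f \<in> sos_cone d"
  shows "0 \<le> lookup f (2 * d, 0)"
proof -
  obtain r p where p: "\<forall>i<r. p i \<in> forms d" "f = (\<Sum>i<(r::nat). (p i)\<^sup>2)"
    using f by (auto simp: sos_cone_def)
  have "coeff (q * q) (2 * d) = (coeff q d)\<^sup>2" if "degree q \<le> d" for q :: "complex poly"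
  proof (cases "degree q = d")
    case True
    then show ?thesis
      using coeff_mult_degree_sum[of q q] by (simp add: mult_2 power2_eq_square)
  next
    case False
    then have "degree q < d" using that by simp
    moreover from this have "degree (q * q) < 2 * d"
      using degree_mult_le[of q q] by linarith
    ultimately show ?thesis by (simp add: coeff_eq_0)
  qed
  then have "coeff (dehom f) (2 * d) = (\<Sum>i<r. (coeff (dehom (p i)) d)\<^sup>2)"
    using p(1) degree_dehom by (simp add: p(2) dehom_sum dehom_power dehom_mult coeff_sum power2_eq_square)
  also have "\<dots> = of_real (\<Sum>i<r. (lookup (p i) (d, 0))\<^sup>2)"
    using p(1) by (simp add: coeff_dehom[of _ d])
  also have "coeff (dehom f) (2 * d) = of_real (lookup f (2 * d, 0))"
    using sos_cone_forms[OF f] by (simp add: coeff_dehom)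
  finally have "lookup f (2 * d, 0) = (\<Sum>i<r. (lookup (p i) (d, 0))\<^sup>2)"
    unfolding of_real_eq_iff .
  then show ?thesis by (simp add: sum_nonneg)
qed

lemma sos_cone_add_square:
  assumes "f \<in> sos_cone d" "q \<in> forms d"
  shows "f + q\<^sup>2 \<in> sos_cone d"
proof -
  obtain r p where p: "\<forall>i<r. p i \<in> forms d" "f = (\<Sum>i<(r::nat). (p i)\<^sup>2)"
    using assms by (auto simp: sos_cone_def)
  show ?thesis
    unfolding sos_cone_def
    by (intro CollectI exI[of _ "Suc r"] exI[of _ "p(r := q)"]) (use p assms(2) in \<open>auto simp: less_Suc_eq\<close>)
qed

lemma abs_lookup_le_norm: "\<bar>lookup f m\<bar> \<le> norm (f :: bpoly)"
proof (cases "m \<in> keys f")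
  case True
  have "\<bar>lookup f m\<bar> \<le> (\<Sum>m\<in>keys f. \<bar>lookup f m\<bar>)"
    using True by (intro member_le_sum) auto
  then show ?thesis
    by (simp add: norm_poly_mapping_def dist_poly_mapping_def)
qed (simp add: in_keys_iff)

lemma real_poly_coeffs_conj_pairs: "real_poly_coeffs (conj_pairs d)"
  unfolding conj_pairs_def[abs_def]
  by (intro real_poly_coeffs_prod real_poly_coeffs_intros real_poly_coeffs_lin real_poly_fun.intros)

lemma continuous_on_pair_form: "continuous_on A (\<lambda>(c, z). pair_form d c z)"
proof -
  have eq: "pair_form d c z = (\<Sum>i\<le>2 * d. (c * Re (coeff (conj_pairs d z) i)) *\<^sub>R single (i, 2 * d - i) 1)" for c z
    unfolding pair_form_def re_form_def by (subst single_conv_scaleR) simp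
  have "continuous_on A (\<lambda>x. coeff (conj_pairs d (snd x)) i)" for i and A :: "(real \<times> (nat \<Rightarrow> complex)) set"
    by (rule continuous_on_compose2[OF real_poly_fun_continuous[of "\<lambda>z. coeff (conj_pairs d z) i" UNIV]])
      (use real_poly_coeffs_conj_pairs in \<open>auto simp: real_poly_coeffs_def intro!: continuous_on_snd continuous_on_id\<close>)
  then show ?thesis
    unfolding eq case_prod_beta by (intro continuous_intros) auto
qed

text \<open>
  The condition ranges over all ways to write the form as a multiple of \<open>a b (cnj (a b))\<close>, and so over
  all pairs of points of rank two at once. It does not refer to an enumeration of the roots.
\<close>
definition generic :: "nat \<Rightarrow> bpoly \<Rightarrow> bool" where
  "generic d f \<longleftrightarrow> (\<forall>a b. lead_coeff a = 1 \<and> lead_coeff b = 1 \<and> degree a + degree b = d \<and>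
     dehom f = smult (of_real (lookup f (2 * d, 0))) ((a * b) * cnjp (a * b)) \<longrightarrow>
     generic_minor (degree a) (degree b) a b \<noteq> 0)"

definition generic_forms :: "nat \<Rightarrow> bpoly set" where
  "generic_forms d = {f \<in> sos_cone d. 0 < lookup f (2 * d, 0) \<and> generic d f}"

lemma monic_as_prod_lin:
  assumes "finite I" "degree a = card I" "lead_coeff a = 1"
  shows "\<exists>y. a = (\<Prod>i\<in>I. lin (y i))"
proof -
  obtain r where r: "smult (lead_coeff a) (\<Prod>i<degree a. [:- r i, 1:]) = a"
    by (rule complex_poly_decompose')
  obtain h where h: "bij_betw h I {0..<card I}"
    using ex_bij_betw_finite_nat[OF assms(1)] by blast
  have "a = (\<Prod>i<card I. lin (r i))"
    using r assms by (simp add: lin_def)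
  also have "\<dots> = (\<Prod>i\<in>I. lin (r (h i)))"
    using prod.reindex_bij_betw[OF h, of "\<lambda>i. lin (r i)"] by (simp add: lessThan_atLeast0)
  finally show ?thesis by (intro exI[of _ "\<lambda>i. r (h i)"])
qed

definition chosen_root :: "nat set \<Rightarrow> (nat \<Rightarrow> complex) \<Rightarrow> nat \<Rightarrow> complex" where
  "chosen_root T z i = (if i \<in> T then z i else cnj (z i))"

text \<open>
  The factorisations \<open>a b (cnj (a b))\<close> of a product of conjugate pairs are indexed by the set \<open>T\<close> of
  the pairs from which \<open>z i\<close>, and not its conjugate, is a root of \<open>a b\<close>, and by the set \<open>S\<close> of the
  pairs that belong to \<open>a\<close>.
\<close>
definition choice_minor :: "nat \<Rightarrow> nat set \<Rightarrow> nat set \<Rightarrow> (nat \<Rightarrow> complex) \<Rightarrow> complex" where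
  "choice_minor d S T z = generic_minor (card S) (card ({..<d} - S))
     (\<Prod>i\<in>S. lin (chosen_root T z i)) (\<Prod>i\<in>{..<d} - S. lin (chosen_root T z i))"

lemma real_poly_fun_choice_minor: "real_poly_fun (choice_minor d S T)"
proof -
  have "real_poly_fun (\<lambda>z. chosen_root T z i)" for i
    by (cases "i \<in> T") (auto simp: chosen_root_def intro: real_poly_fun.intros)
  then show ?thesis
    unfolding choice_minor_def[abs_def]
    by (intro real_poly_fun_generic_minor real_poly_coeffs_prod real_poly_coeffs_lin)
qed

lemma choice_minor_somewhere_nonzero:
  assumes S: "S \<subseteq> {..<d}"
  shows "\<exists>z. choice_minor d S T z \<noteq> 0"
proof -
  obtain a b where ab: "degree a = card S" "lead_coeff a = 1" "degree b = card ({..<d} - S)" "lead_coeff b = 1"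
    "generic_minor (card S) (card ({..<d} - S)) a b \<noteq> 0"
    using generic_minor_example by blast
  obtain u v where uv: "a = (\<Prod>i\<in>S. lin (u i))" "b = (\<Prod>i\<in>{..<d} - S. lin (v i))"
    using monic_as_prod_lin[of S a] monic_as_prod_lin[of "{..<d} - S" b] ab finite_subset[OF S] by auto
  define y where "y i = (if i \<in> S then u i else v i)" for i
  define z where "z i = (if i \<in> T then y i else cnj (y i))" for i
  have y: "chosen_root T z i = y i" for i
    by (simp add: chosen_root_def z_def)
  have "choice_minor d S T z = generic_minor (card S) (card ({..<d} - S)) a b"
    unfolding choice_minor_def y uv
    by (intro arg_cong2[where f = "generic_minor _ _"] prod.cong refl) (auto simp: y_def)
  then show ?thesis using ab(5) by (intro exI[of _ z]) simp
qed

lemma pair_form_generic: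
  assumes c: "c \<noteq> 0" and z: "\<And>S T. S \<subseteq> {..<d} \<Longrightarrow> T \<subseteq> {..<d} \<Longrightarrow> choice_minor d S T z \<noteq> 0"
  shows "generic d (pair_form d c z)"
  unfolding generic_def lead_pair_form
proof (intro allI impI, elim conjE)
  fix a b
  assume ab: "lead_coeff a = 1" "lead_coeff b = 1" "degree a + degree b = d"
    and eq: "dehom (pair_form d c z) = smult (of_real c) ((a * b) * cnjp (a * b))"
  have "smult (of_real c) ((a * b) * cnjp (a * b)) = smult (of_real c) (conj_pairs d z)"
    using eq unfolding dehom_pair_form by (rule sym)
  then have "(a * b) * cnjp (a * b) = smult 1 (\<Prod>i<d. lin (z i) * lin (cnj (z i)))"
    using c by (metis conj_pairs_def smult_1_left smult_cancel of_real_eq_0_iff)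
  from conjugate_factor_choice[OF finite_lessThan one_neq_zero this]
  obtain T \<gamma> where T: "T \<subseteq> {..<d}" "a * b = smult \<gamma> (\<Prod>i<d. lin (chosen_root T z i))"
    unfolding chosen_root_def by blast
  have "\<gamma> = lead_coeff (a * b)"
    unfolding T(2) lead_coeff_smult lead_coeff_prod_lin by simp
  then have "\<gamma> = 1" using ab by (simp add: lead_coeff_mult)
  then obtain S where S: "S \<subseteq> {..<d}" "a = (\<Prod>i\<in>S. lin (chosen_root T z i))" "b = (\<Prod>i\<in>{..<d} - S. lin (chosen_root T z i))"
    using divisor_of_linear_factors[of "{..<d}" a b] T(2) ab(1) by auto
  have "degree a = card S" "degree b = card ({..<d} - S)"
    by (simp_all add: S(2,3))
  then show "generic_minor (degree a) (degree b) a b \<noteq> 0"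
    using z[OF S(1) T(1)] by (simp add: choice_minor_def S(2,3)[symmetric])
qed

text \<open>
  A square of the leading monomial makes the leading coefficient positive, so that roots exist. These
  are then moved along a line towards roots for which no minor vanishes.
\<close>
theorem generic_forms_dense: "sos_cone d \<subseteq> closure (generic_forms d)"
proof
  fix f assume f: "f \<in> sos_cone d"
  show "f \<in> closure (generic_forms d)"
    unfolding closure_approachable
  proof (intro allI impI)
    fix e :: real assume "0 < e"
    let ?x = "single (d, 0) 1 :: bpoly"
    define M where "M = norm (?x * ?x) + 1"
    have M: "0 < M" "norm (?x * ?x) < M"
      unfolding M_def using norm_ge_zero[of "?x * ?x"] by linarith+
    define \<epsilon> where "\<epsilon> = e / (2 * M)"
    have \<epsilon>: "0 < \<epsilon>" using \<open>0 < e\<close> M by (simp add: \<epsilon>_def)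
    have "\<epsilon> * norm (?x * ?x) < \<epsilon> * M" using \<epsilon> M by simp
    also have "\<epsilon> * M = e / 2" using M by (simp add: \<epsilon>_def)
    finally have \<epsilon>_small: "\<epsilon> * norm (?x * ?x) < e / 2" .
    define f1 where "f1 = f + (sqrt \<epsilon> *\<^sub>R ?x)\<^sup>2"
    have f1: "f1 = f + \<epsilon> *\<^sub>R (?x * ?x)"
      using \<epsilon> by (simp add: f1_def power2_eq_square mult_scaleR_bpoly)
    have "sqrt \<epsilon> *\<^sub>R ?x \<in> forms d"
      by (intro subspace_scale[OF forms_subspace]) (simp add: forms_def)
    then have f1_sos: "f1 \<in> sos_cone d"
      unfolding f1_def by (rule sos_cone_add_square[OF f])
    have dist_f1: "dist f1 f < e / 2"
      using \<epsilon> \<epsilon>_small by (simp add: f1 dist_norm)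
    have lead: "0 < lookup f1 (2 * d, 0)"
      using sos_cone_lead_nonneg[OF f] \<epsilon> by (simp add: f1 lookup_add mult_single mult_2)
    define c where "c = lookup f1 (2 * d, 0)"
    obtain z where z: "f1 = pair_form d c z"
      using sos_cone_pair_form[OF f1_sos lead] unfolding c_def by blast
    let ?K = "Pow {..<d} \<times> Pow {..<d}"
    let ?\<Phi> = "\<lambda>z. \<Prod>k\<in>?K. choice_minor d (fst k) (snd k) z"
    have "\<exists>w. ?\<Phi> w \<noteq> 0"
      by (rule real_poly_fun_prod_nonzero) (auto intro: real_poly_fun_choice_minor choice_minor_somewhere_nonzero)
    then obtain w where w: "?\<Phi> w \<noteq> 0" by blast
    define v where "v t i = z i + of_real t * (w i - z i)" for t :: real and i
    have fin: "finite {t. ?\<Phi> (v t) = 0}"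
      unfolding v_def
      by (rule real_poly_fun_finite_zeros_on_line[of ?\<Phi>, OF _ w]) (intro real_poly_fun_prod real_poly_fun_choice_minor)
    have "continuous_on UNIV (\<lambda>t. pair_form d c (v t))"
    proof -
      have "continuous_on UNIV v"
        unfolding v_def by (intro continuous_on_coordinatewise_then_product continuous_intros)
      then show ?thesis
        using continuous_on_compose2[OF continuous_on_pair_form[of UNIV d], of UNIV "\<lambda>t. (c, v t)"]
        by (simp add: continuous_on_Pair)
    qed
    then have "((\<lambda>t. pair_form d c (v t)) \<longlongrightarrow> pair_form d c (v 0)) (at 0)"
      by (simp add: continuous_on_def)
    moreover have "v 0 = z" by (intro ext) (simp add: v_def)
    ultimately have "\<forall>\<^sub>F t in at 0. dist (pair_form d c (v t)) f1 < e / 2"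
      unfolding z using \<open>0 < e\<close> by (intro tendstoD) auto
    moreover have "\<forall>\<^sub>F t in at 0. ?\<Phi> (v t) \<noteq> 0"
    proof -
      have "open (- ({t. ?\<Phi> (v t) = 0} - {0}))"
        using fin by (intro open_Compl finite_imp_closed finite_Diff)
      then show ?thesis
        unfolding eventually_at_topological by blast
    qed
    ultimately have "\<forall>\<^sub>F t in at (0::real). dist (pair_form d c (v t)) f1 < e / 2 \<and> ?\<Phi> (v t) \<noteq> 0"
      by (rule eventually_conj)
    then obtain t where t: "dist (pair_form d c (v t)) f1 < e / 2" "?\<Phi> (v t) \<noteq> 0"
      using eventually_happens'[OF at_neq_bot] by blast
    have "choice_minor d S T (v t) \<noteq> 0" if "S \<subseteq> {..<d}" "T \<subseteq> {..<d}" for S T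
      using t(2) that by (force simp: prod_zero_iff)
    then have "pair_form d c (v t) \<in> generic_forms d"
      using lead pair_form_generic[of c d "v t"] pair_form_sos[of c d "v t"]
      by (simp add: generic_forms_def lead_pair_form c_def)
    moreover have "dist (pair_form d c (v t)) f < e"
      using t(1) dist_f1 dist_triangle[of "pair_form d c (v t)" f f1] by linarith
    ultimately show "\<exists>y\<in>generic_forms d. dist y f < e" by blast
  qed
qed

lemma compact_roots: "compact {z :: nat \<Rightarrow> complex. \<forall>i. norm (z i) \<le> R}"
proof -
  have "PiE UNIV (\<lambda>i. cball (0::complex) R) = {z. \<forall>i. norm (z i) \<le> R}"
    by (auto simp: PiE_UNIV_domain Pi_def)
  moreover have "compactin (product_topology (\<lambda>i::nat. euclidean) UNIV) (PiE UNIV (\<lambda>i. cball (0::complex) R))"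
    unfolding compactin_PiE by simp
  ultimately show ?thesis
    unfolding euclidean_product_topology compactin_euclidean_iff by metis
qed

lemma root_bound:
  fixes p :: "complex poly"
  assumes deg: "degree p = n" and root: "poly p w = 0" and B: "\<And>i. norm (coeff p i) \<le> B"
    and c: "0 < c" "c \<le> norm (coeff p n)"
  shows "norm w \<le> 1 + real n * B / c"
proof (cases "norm w \<le> 1")
  case True
  have "0 \<le> B" using B[of 0] norm_ge_zero order_trans by blast
  then have "0 \<le> real n * B / c" using c by simp
  then show ?thesis using True by linarith
next
  case False
  show ?thesis
  proof (cases n)
    case 0
    then have "poly p w = coeff p 0" using deg by (metis degree_eq_zeroE poly_pCons coeff_pCons_0 add_0_right mult_zero_right poly_0)
    then show ?thesis using root c 0 by simp
  next
    case (Suc l)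
    have "(\<Sum>i\<le>n. coeff p i * w ^ i) = 0"
      using root deg by (simp add: poly_altdef)
    then have "coeff p n * w ^ n = - (\<Sum>i\<le>l. coeff p i * w ^ i)"
      by (simp add: Suc eq_neg_iff_add_eq_0 add.commute)
    then have "norm (coeff p n) * norm w ^ n = norm (\<Sum>i\<le>l. coeff p i * w ^ i)"
      by (metis norm_minus_cancel norm_mult norm_power)
    also have "\<dots> \<le> (\<Sum>i\<le>l. B * norm w ^ l)"
    proof (intro sum_norm_le)
      fix i assume "i \<in> {..l}"
      then have "norm w ^ i \<le> norm w ^ l"
        using False by (intro power_increasing) auto
      then show "norm (coeff p i * w ^ i) \<le> B * norm w ^ l"
        unfolding norm_mult norm_power using B[of i] by (intro mult_mono) (auto intro: order_trans[OF norm_ge_zero])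
    qed
    also have "\<dots> = real n * B * norm w ^ l" by (simp add: Suc)
    finally have "norm (coeff p n) * norm w * norm w ^ l \<le> real n * B * norm w ^ l"
      by (simp add: Suc mult_ac)
    moreover have "0 < norm w ^ l" using False by (intro zero_less_power) auto
    ultimately have "norm (coeff p n) * norm w \<le> real n * B" by simp
    moreover have "c * norm w \<le> norm (coeff p n) * norm w"
      using c by (intro mult_right_mono) auto
    ultimately have "norm w \<le> real n * B / c" using c by (simp add: field_simps)
    then show ?thesis by simp
  qed
qed

text \<open>
  Among the forms with positive leading coefficient, the complement of the generic forms is the
  image of a closed set under the continuous map from leading coefficients and roots to forms;
  locally the roots are bounded, and so the image is closed.
\<close>
theorem openin_generic_forms: "openin (top_of_set (sos_cone d)) (generic_forms d)"
  unfolding openin_euclidean_subtopology_iff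
proof (intro conjI ballI)
  show "generic_forms d \<subseteq> sos_cone d" by (auto simp: generic_forms_def)
  fix f assume "f \<in> generic_forms d"
  then have f: "f \<in> sos_cone d" "0 < lookup f (2 * d, 0)" "generic d f"
    by (auto simp: generic_forms_def)
  define c where "c = lookup f (2 * d, 0)"
  define N where "N = norm f + 1"
  define R where "R = 1 + real (2 * d) * N / (c / 2)"
  define front_part where "front_part k z = (\<Prod>i<k. lin (z i))" for k and z :: "nat \<Rightarrow> complex"
  define rear_part where "rear_part k z = (\<Prod>i\<in>{k..<d}. lin (z i))" for k and z :: "nat \<Rightarrow> complex"
  define D where "D k = {z. \<forall>i. norm (z i) \<le> R} \<inter> {z. generic_minor k (d - k) (front_part k z) (rear_part k z) \<in> {0}}" for k
  define Bad where "Bad = (\<Union>k\<le>d. (\<lambda>(c, z). pair_form d c z) ` ({c / 2..N} \<times> D k))"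
  have "0 < c" using f by (simp add: c_def)
  have "compact (D k)" for k
  proof -
    have "real_poly_fun (\<lambda>z. generic_minor k (d - k) (front_part k z) (rear_part k z))"
      unfolding front_part_def rear_part_def
      by (intro real_poly_fun_generic_minor real_poly_coeffs_prod real_poly_coeffs_lin real_poly_fun.intros)
    then have "closed ((\<lambda>z. generic_minor k (d - k) (front_part k z) (rear_part k z)) -` {0})"
      by (intro closed_vimage real_poly_fun_continuous) auto
    then show ?thesis
      unfolding D_def using compact_roots by (intro compact_Int_closed) (auto simp: vimage_def)
  qed
  then have "compact Bad"
    unfolding Bad_def
    by (intro compact_UN finite_atMost compact_continuous_image continuous_on_pair_form compact_Times) auto
  then have "closed Bad" by (rule compact_imp_closed)
  have front_rear: "front_part k z * rear_part k z * cnjp (front_part k z * rear_part k z) = conj_pairs d z" if "k \<le> d" for k z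
  proof -
    have "front_part k z * rear_part k z = (\<Prod>i<d. lin (z i))"
      unfolding front_part_def rear_part_def
      using prod.atLeastLessThan_concat[of 0 k d "\<lambda>i. lin (z i)"] that by (simp add: lessThan_atLeast0)
    then show ?thesis
      by (simp add: conj_pairs_def cnjp_prod prod.distrib)
  qed
  have degs: "degree (front_part k z) = k" "lead_coeff (front_part k z) = 1" "degree (rear_part k z) = d - k" "lead_coeff (rear_part k z) = 1" for k z
    unfolding front_part_def rear_part_def lead_coeff_prod_lin by simp_all
  have "f \<notin> Bad"
  proof
    assume "f \<in> Bad"
    then obtain k c' z where k: "k \<le> d" "f = pair_form d c' z" "generic_minor k (d - k) (front_part k z) (rear_part k z) = 0"
      by (auto simp: Bad_def D_def)
    have "dehom f = smult (of_real (lookup f (2 * d, 0))) ((front_part k z * rear_part k z) * cnjp (front_part k z * rear_part k z))"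
      unfolding front_rear[OF k(1)] by (simp add: k(2) lead_pair_form dehom_pair_form)
    then show False
      using f(3) k degs[of k z] unfolding generic_def by (metis le_add_diff_inverse)
  qed
  then obtain e1 where e1: "0 < e1" "ball f e1 \<inter> Bad = {}"
    using \<open>closed Bad\<close> by (metis Compl_iff disjoint_eq_subset_Compl open_Compl open_contains_ball)
  define e where "e = min e1 (min (c / 2) 1)"
  have "0 < e" using e1 \<open>0 < c\<close> by (simp add: e_def)
  moreover have "f' \<in> generic_forms d" if f': "f' \<in> sos_cone d" "dist f' f < e" for f'
  proof -
    define c' where "c' = lookup f' (2 * d, 0)"
    have "\<bar>c' - c\<bar> \<le> dist f' f"
      using abs_lookup_le_norm[of "f' - f" "(2 * d, 0)"] by (simp add: c'_def c_def dist_norm lookup_minus)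
    moreover have "dist f' f < c / 2" using f'(2) by (simp add: e_def)
    ultimately have c': "c / 2 \<le> c'" by linarith
    have "norm f' \<le> norm f + dist f' f"
      using norm_triangle_ineq[of f "f' - f"] by (simp add: dist_norm)
    then have N: "norm f' \<le> N" using that by (simp add: e_def N_def)
    have "c' \<le> N" using abs_lookup_le_norm[of f' "(2 * d, 0)"] N by (simp add: c'_def)
    note f'F = sos_cone_forms[OF f'(1)]
    have "generic d f'"
      unfolding generic_def
    proof (intro allI impI notI, elim conjE)
      fix a b
      assume ab: "lead_coeff a = 1" "lead_coeff b = 1" "degree a + degree b = d"
        and eq: "dehom f' = smult (of_real (lookup f' (2 * d, 0))) ((a * b) * cnjp (a * b))"
        and minor: "generic_minor (degree a) (degree b) a b = 0"
      define k where "k = degree a"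
      have k: "k \<le> d" "degree b = d - k" using ab by (simp_all add: k_def)
      obtain u where u: "a = (\<Prod>i<k. lin (u i))"
        using monic_as_prod_lin[of "{..<k}" a] ab(1) by (metis finite_lessThan card_lessThan k_def)
      obtain v where v: "b = (\<Prod>i\<in>{k..<d}. lin (v i))"
        using monic_as_prod_lin[of "{k..<d}" b] ab(2) k(2) by (metis finite_atLeastLessThan card_atLeastLessThan)
      define z where "z i = (if i < k then u i else if i < d then v i else 0)" for i
      have z: "front_part k z = a" "rear_part k z = b"
        unfolding front_part_def rear_part_def u v by (auto simp: z_def intro!: prod.cong)
      have "dehom f' = dehom (pair_form d c' z)"
        using eq front_rear[OF k(1), of z] by (simp add: z dehom_pair_form c'_def)
      then have f'z: "f' = pair_form d c' z"
        by (rule dehom_inject[OF f'F, rotated]) (simp add: pair_form_def re_form_in_forms)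
      have "norm (z i) \<le> R" for i
      proof (cases "i < d")
        case True
        have "degree (dehom f') = 2 * d"
          using c' \<open>0 < c\<close> by (simp add: f'z dehom_pair_form)
        moreover have "poly (dehom f') (z i) = 0"
          using True by (auto simp: f'z dehom_pair_form conj_pairs_def poly_prod prod_zero_iff)
        moreover have "norm (coeff (dehom f') j) \<le> N" for j
          using abs_lookup_le_norm[of f' "(j, 2 * d - j)"] N norm_ge_zero[of f']
          by (auto simp: coeff_dehom[OF f'F] simp del: norm_ge_zero)
        moreover have "c / 2 \<le> norm (coeff (dehom f') (2 * d))"
          using c' \<open>0 < c\<close> by (simp add: f'z dehom_pair_form)
        ultimately show ?thesis
          unfolding R_def using \<open>0 < c\<close> by (intro root_bound) auto
      next
        case False
        have "0 \<le> N" using N norm_ge_zero order_trans by blast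
        then have "0 \<le> R" using \<open>0 < c\<close> by (simp add: R_def add_nonneg_nonneg)
        then show ?thesis using False k by (simp add: z_def)
      qed
      then have "z \<in> D k"
        using minor by (simp add: D_def z k k_def[symmetric])
      then have "f' \<in> Bad"
        unfolding Bad_def f'z using k c' \<open>c' \<le> N\<close> by force
      moreover have "f' \<in> ball f e1" using that by (simp add: e_def dist_commute)
      ultimately show False using e1 by blast
    qed
    then show ?thesis
      using f'(1) c' \<open>0 < c\<close> by (simp add: generic_forms_def c'_def)
  qed
  ultimately show "\<exists>e>0. \<forall>f'\<in>sos_cone d. dist f' f < e \<longrightarrow> f' \<in> generic_forms d" by blast
qed

section \<open>Pairs of rank two points of a generic Gram spectrahedron\<close>

text \<open>
  The data of a pair of points of rank two: the factors \<open>a b\<close> and \<open>a (cnj b)\<close> up to the constant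
  \<open>lead_root d f\<close>, the square root of the leading coefficient.
\<close>
definition splitting :: "nat \<Rightarrow> bpoly \<Rightarrow> complex poly \<Rightarrow> complex poly \<Rightarrow> bool" where
  "splitting d f a b \<longleftrightarrow> lead_coeff a = 1 \<and> lead_coeff b = 1 \<and> degree a + degree b = d \<and>
     dehom f = smult (of_real (lookup f (2 * d, 0))) ((a * b) * cnjp (a * b))"

definition lead_root :: "nat \<Rightarrow> bpoly \<Rightarrow> real" where
  "lead_root d f = sqrt (lookup f (2 * d, 0))"

definition norm_point :: "nat \<Rightarrow> bpoly \<Rightarrow> complex poly \<Rightarrow> btensor" where
  "norm_point d f g = norm_tensor d (smult (of_real (lead_root d f)) g)"

lemma splitting_commute: "splitting d f a b \<Longrightarrow> splitting d f b a"
  by (simp add: splitting_def mult.commute add.commute)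

lemma norm_point_cnjp: "norm_point d f (cnjp g) = norm_point d f g"
  using norm_tensor_cnjp[of d "smult (of_real (lead_root d f)) g"] by (simp add: norm_point_def del: norm_tensor_cnjp)

lemma generic_splitting_minor:
  "f \<in> generic_forms d \<Longrightarrow> splitting d f a b \<Longrightarrow> generic_minor (degree a) (degree b) a b \<noteq> 0"
  by (auto simp: generic_forms_def generic_def splitting_def)

lemma re_form_scale: "re_form k (smult (of_real s) a) = s *\<^sub>R re_form k a"
  and im_form_scale: "im_form k (smult (of_real s) a) = s *\<^sub>R im_form k a"
  by (auto intro!: poly_mapping_eqI simp: lookup_re_form lookup_im_form)

abbreviation "scaled_re d f a \<equiv> lead_root d f *\<^sub>R re_form (degree a) a"
abbreviation "scaled_im d f a \<equiv> lead_root d f *\<^sub>R im_form (degree a) a"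

lemma norm_point_mult:
  fixes f :: bpoly
  assumes "degree a + degree b = d"
  shows "norm_point d f (a * b) =
      gram_tensor (scaled_re d f a) (scaled_im d f a) (re_form (degree b) b) (im_form (degree b) b)"
    and "norm_point d f (a * cnjp b) =
      gram_tensor (scaled_re d f a) (scaled_im d f a) (re_form (degree b) b) (- im_form (degree b) b)"
proof -
  have deg: "degree (smult (of_real (lead_root d f)) a) \<le> degree a" by (rule degree_smult_le)
  show "norm_point d f (a * b) =
      gram_tensor (scaled_re d f a) (scaled_im d f a) (re_form (degree b) b) (im_form (degree b) b)"
    using norm_tensor_mult[OF deg order_refl, of b] assms by (simp add: norm_point_def re_form_scale im_form_scale)
  show "norm_point d f (a * cnjp b) =
      gram_tensor (scaled_re d f a) (scaled_im d f a) (re_form (degree b) b) (- im_form (degree b) b)"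
    using norm_tensor_mult_cnjp[OF deg order_refl, of b] assms by (simp add: norm_point_def re_form_scale im_form_scale)
qed

lemma biquadratic_indep_scale:
  assumes indep: "biquadratic_indep a1 a2 b1 b2" and s: "s \<noteq> 0"
  shows "biquadratic_indep (s *\<^sub>R a1) (s *\<^sub>R a2) b1 b2"
  unfolding biquadratic_indep_def
proof (intro allI impI)
  fix c :: "nat \<Rightarrow> nat \<Rightarrow> real" and i j :: nat
  assume 0: "(\<Sum>i<3. \<Sum>j<3. c i j *\<^sub>R (((s *\<^sub>R a1) ^ (2 - i) * (s *\<^sub>R a2) ^ i) * (b1 ^ (2 - j) * b2 ^ j))) = 0"
    and ij: "i < 3" "j < 3"
  have pow: "(s *\<^sub>R p) ^ n = s ^ n *\<^sub>R p ^ n" for p :: bpoly and n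
    by (induction n) (simp_all add: mult_scaleR_bpoly mult.commute)
  have "c i j *\<^sub>R (((s *\<^sub>R a1) ^ (2 - i) * (s *\<^sub>R a2) ^ i) * (b1 ^ (2 - j) * b2 ^ j)) =
      (s\<^sup>2 * c i j) *\<^sub>R ((a1 ^ (2 - i) * a2 ^ i) * (b1 ^ (2 - j) * b2 ^ j))" if "i < 3" for i j
  proof -
    have "s ^ (2 - i) * s ^ i = s\<^sup>2"
      using that by (simp add: power_add[symmetric])
    then show ?thesis
      by (simp add: pow mult_scaleR_bpoly mult_ac)
  qed
  then have "(\<Sum>i<3. \<Sum>j<3. c i j *\<^sub>R (((s *\<^sub>R a1) ^ (2 - i) * (s *\<^sub>R a2) ^ i) * (b1 ^ (2 - j) * b2 ^ j))) =
      (\<Sum>i<3. \<Sum>j<3. (s\<^sup>2 * c i j) *\<^sub>R ((a1 ^ (2 - i) * a2 ^ i) * (b1 ^ (2 - j) * b2 ^ j)))"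
    by (intro sum.cong refl) auto
  with 0 have "(\<Sum>i<3. \<Sum>j<3. (s\<^sup>2 * c i j) *\<^sub>R ((a1 ^ (2 - i) * a2 ^ i) * (b1 ^ (2 - j) * b2 ^ j))) = 0"
    by simp
  then have "s\<^sup>2 * c i j = 0"
    using indep[unfolded biquadratic_indep_def, rule_format, of "\<lambda>i j. s\<^sup>2 * c i j"] ij by blast
  then show "c i j = 0" using s by simp
qed

lemma lin_indep_4_scale:
  assumes indep: "lin_indep 4 (prods a1 a2 b1 b2)" and s: "s \<noteq> 0"
  shows "lin_indep 4 (prods (s *\<^sub>R a1) (s *\<^sub>R a2) b1 b2)"
  unfolding lin_indep_4_iff
proof (intro allI impI)
  fix x y z w :: real
  assume "x *\<^sub>R (s *\<^sub>R a1 * b1) + y *\<^sub>R (s *\<^sub>R a1 * b2) + z *\<^sub>R (s *\<^sub>R a2 * b1) + w *\<^sub>R (s *\<^sub>R a2 * b2) = 0"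
  then have "(x * s) *\<^sub>R (a1 * b1) + (y * s) *\<^sub>R (a1 * b2) + (z * s) *\<^sub>R (a2 * b1) + (w * s) *\<^sub>R (a2 * b2) = 0"
    by (simp add: mult_scaleR_bpoly)
  then have "x * s = 0 \<and> y * s = 0 \<and> z * s = 0 \<and> w * s = 0"
    using indep unfolding lin_indep_4_iff by blast
  then show "x = 0 \<and> y = 0 \<and> z = 0 \<and> w = 0" using s by simp
qed

lemma lead_root_pos: "f \<in> generic_forms d \<Longrightarrow> 0 < lead_root d f"
  by (simp add: generic_forms_def lead_root_def)

lemma splitting_biquadratic_indep:
  assumes f: "f \<in> generic_forms d" and split: "splitting d f a b" and deg: "3 \<le> degree a" "1 \<le> degree b"
  shows "biquadratic_indep (scaled_re d f a) (scaled_im d f a)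
    (re_form (degree b) b) (im_form (degree b) b)"
  using generic_minor_biquadratic_indep[OF generic_splitting_minor[OF f split] deg] lead_root_pos[OF f]
  by (intro biquadratic_indep_scale) auto

text \<open>
  The roles of \<open>a\<close> and \<open>b\<close> can be exchanged because \<open>b (cnj a)\<close> is the conjugate of \<open>a (cnj b)\<close>.
\<close>
lemma splitting_face:
  assumes f: "f \<in> generic_forms d" and split: "splitting d f a b"
    and deg: "1 \<le> degree a" "1 \<le> degree b" "3 \<le> degree a \<or> 3 \<le> degree b"
    and Ex2: "norm_point d f (a * b) \<in> Ex2 d f" "norm_point d f (a * cnjp b) \<in> Ex2 d f"
  shows "closed_segment (norm_point d f (a * b)) (norm_point d f (a * cnjp b)) face_of Gram d f"
proof -
  have *: "closed_segment (norm_point d f (a * b)) (norm_point d f (a * cnjp b)) face_of Gram d f"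
    if split: "splitting d f a b" and deg: "3 \<le> degree a" "1 \<le> degree b"
      and Ex2: "norm_point d f (a * b) \<in> Ex2 d f" "norm_point d f (a * cnjp b) \<in> Ex2 d f" for a b
  proof -
    have "degree a + degree b = d" using split by (simp add: splitting_def)
    from norm_point_mult[OF this] Ex2 show ?thesis
      using biquadratic_indep_segment_face[OF splitting_biquadratic_indep[OF f split deg]]
      by (simp add: Ex2_def)
  qed
  show ?thesis
  proof (cases "3 \<le> degree a")
    case True
    then show ?thesis using * split deg Ex2 by blast
  next
    case False
    have "norm_point d f (b * cnjp a) = norm_point d f (a * cnjp b)"
      using norm_point_cnjp[of d f "a * cnjp b"] by (simp add: mult.commute)
    then show ?thesis
      using *[of b a] split deg Ex2 False splitting_commute by (simp add: mult.commute)
  qed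
qed

lemma dehom_generic:
  assumes f: "f \<in> generic_forms d"
  shows "f \<in> forms (2 * d)" "degree (dehom f) = 2 * d" "lead_coeff (dehom f) = of_real ((lead_root d f)\<^sup>2)"
proof -
  have f': "f \<in> sos_cone d" "0 < lookup f (2 * d, 0)"
    using f by (auto simp: generic_forms_def)
  show F: "f \<in> forms (2 * d)" by (rule sos_cone_forms[OF f'(1)])
  have c: "coeff (dehom f) (2 * d) = of_real (lookup f (2 * d, 0))"
    by (simp add: coeff_dehom[OF F])
  show deg: "degree (dehom f) = 2 * d"
    using degree_dehom[OF F] le_degree[of "dehom f" "2 * d"] c f'(2) by simp
  show "lead_coeff (dehom f) = of_real ((lead_root d f)\<^sup>2)"
    using f'(2) unfolding deg c by (simp add: lead_root_def)
qed

lemma norm_factor: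
  assumes f: "f \<in> generic_forms d" and h: "h * cnjp h = dehom f"
  shows "degree h = d" "norm (lead_coeff h) = lead_root d f"
proof -
  have "dehom f \<noteq> 0"
    using dehom_generic(3)[OF f] lead_root_pos[OF f] by auto
  then have "h \<noteq> 0" "cnjp h \<noteq> 0" using h by auto
  then have "degree (h * cnjp h) = 2 * degree h" by (simp add: degree_mult_eq)
  then show "degree h = d" using dehom_generic(2)[OF f] h by simp
  have "of_real ((norm (lead_coeff h))\<^sup>2) = lead_coeff h * cnj (lead_coeff h)"
    by (rule complex_norm_square)
  also have "\<dots> = lead_coeff (h * cnjp h)" by (simp add: lead_coeff_mult)
  also have "\<dots> = of_real ((lead_root d f)\<^sup>2)" using h dehom_generic(3)[OF f] by simp
  finally have "(norm (lead_coeff h))\<^sup>2 = (lead_root d f)\<^sup>2" by (simp only: of_real_eq_iff)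
  then show "norm (lead_coeff h) = lead_root d f"
    using lead_root_pos[OF f] by (simp add: power2_eq_iff_nonneg)
qed

text \<open>
  The factor that belongs to a point is determined by its roots up to a constant, whose absolute
  value is given by the leading coefficient of \<open>f\<close>.
\<close>
lemma Ex2_chosen_roots:
  assumes f: "f \<in> generic_forms d" and z: "dehom f = smult (of_real ((lead_root d f)\<^sup>2)) (conj_pairs d z)"
    and \<theta>: "\<theta> \<in> Ex2 d f"
  shows "\<exists>S\<subseteq>{..<d}. \<theta> = norm_point d f (\<Prod>i<d. lin (chosen_root S z i))"
proof -
  obtain h where h: "\<theta> = norm_tensor d h" "h * cnjp h = dehom f"
    using Ex2_imp_norm_tensor[OF \<theta>] by blast
  have "of_real ((lead_root d f)\<^sup>2) \<noteq> (0::complex)"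
    using lead_root_pos[OF f] by simp
  then obtain S \<gamma> where S: "S \<subseteq> {..<d}" "h = smult \<gamma> (\<Prod>i<d. lin (chosen_root S z i))"
    using conjugate_factor_choice[OF finite_lessThan _ h(2)[unfolded z conj_pairs_def]]
    unfolding chosen_root_def by blast
  have "\<gamma> = lead_coeff h"
    unfolding S(2) lead_coeff_smult lead_coeff_prod_lin by simp
  then have "norm \<gamma> = lead_root d f" using norm_factor(2)[OF f h(2)] by simp
  then show ?thesis
    using S norm_tensor_norm_eq[of \<gamma> "lead_root d f" d] by (auto simp: h(1) norm_point_def)
qed

text \<open>
  For two choices \<open>S\<close> and \<open>T\<close> that differ exactly on \<open>D\<close>, the common factor \<open>a\<close> belongs to the
  complement of \<open>D\<close>.
\<close>
lemma splitting_of_choices: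
  assumes f: "f \<in> generic_forms d" and z: "dehom f = smult (of_real ((lead_root d f)\<^sup>2)) (conj_pairs d z)"
    and D: "D \<subseteq> {..<d}"
    and ST: "\<And>i. i < d \<Longrightarrow> (i \<in> S \<longleftrightarrow> i \<in> T) \<longleftrightarrow> i \<notin> D"
  defines "a \<equiv> \<Prod>i\<in>{..<d} - D. lin (chosen_root S z i)" and "b \<equiv> \<Prod>i\<in>D. lin (chosen_root S z i)"
  shows "splitting d f a b" "degree a = d - card D" "degree b = card D"
    "(\<Prod>i<d. lin (chosen_root S z i)) = a * b" "(\<Prod>i<d. lin (chosen_root T z i)) = a * cnjp b"
proof -
  show deg: "degree a = d - card D" "degree b = card D"
    using D by (simp_all add: a_def b_def card_Diff_subset finite_subset)
  show ab: "(\<Prod>i<d. lin (chosen_root S z i)) = a * b"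
    unfolding a_def b_def by (rule prod.subset_diff[OF D]) simp
  have "cnjp b = (\<Prod>i\<in>D. lin (chosen_root T z i))"
    unfolding b_def cnjp_prod by (intro prod.cong refl) (use D ST in \<open>auto simp: chosen_root_def\<close>)
  moreover have "a = (\<Prod>i\<in>{..<d} - D. lin (chosen_root T z i))"
    unfolding a_def by (intro prod.cong refl) (use ST in \<open>auto simp: chosen_root_def\<close>)
  moreover have "(\<Prod>i<d. lin (chosen_root T z i)) =
      (\<Prod>i\<in>{..<d} - D. lin (chosen_root T z i)) * (\<Prod>i\<in>D. lin (chosen_root T z i))"
    by (rule prod.subset_diff[OF D]) simp
  ultimately show "(\<Prod>i<d. lin (chosen_root T z i)) = a * cnjp b" by simp
  have "(a * b) * cnjp (a * b) = (\<Prod>i<d. lin (chosen_root S z i) * lin (cnj (chosen_root S z i)))"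
    unfolding ab[symmetric] cnjp_prod by (simp add: prod.distrib)
  also have "\<dots> = conj_pairs d z"
    unfolding conj_pairs_def by (intro prod.cong refl) (simp add: chosen_root_def mult.commute)
  moreover have "(lead_root d f)\<^sup>2 = lookup f (2 * d, 0)"
    using f by (simp add: lead_root_def generic_forms_def)
  moreover have "lead_coeff a = 1" "lead_coeff b = 1"
    unfolding a_def b_def by (rule lead_coeff_prod_lin)+
  moreover have "card D \<le> d" using D card_mono[of "{..<d}" D] by simp
  ultimately show "splitting d f a b"
    unfolding splitting_def using z deg by simp
qed

lemma generic_roots:
  assumes f: "f \<in> generic_forms d"
  obtains z where "dehom f = smult (of_real ((lead_root d f)\<^sup>2)) (conj_pairs d z)"
proof -
  have f': "f \<in> sos_cone d" "0 < lookup f (2 * d, 0)"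
    using f by (auto simp: generic_forms_def)
  obtain z where "f = pair_form d (lookup f (2 * d, 0)) z"
    by (rule sos_cone_pair_form[OF f'])
  then have "dehom f = smult (of_real (lookup f (2 * d, 0))) (conj_pairs d z)"
    using dehom_pair_form by metis
  moreover have "(lead_root d f)\<^sup>2 = lookup f (2 * d, 0)"
    using f' by (simp add: lead_root_def)
  ultimately show thesis using that by simp
qed

theorem Ex2_pair_splitting:
  assumes f: "f \<in> generic_forms d" and \<theta>: "\<theta> \<in> Ex2 d f" "\<theta>' \<in> Ex2 d f" "\<theta> \<noteq> \<theta>'"
  shows "\<exists>a b. splitting d f a b \<and> 1 \<le> degree a \<and> 1 \<le> degree b \<and>
    \<theta> = norm_point d f (a * b) \<and> \<theta>' = norm_point d f (a * cnjp b)"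
proof -
  obtain z where z: "dehom f = smult (of_real ((lead_root d f)\<^sup>2)) (conj_pairs d z)"
    by (rule generic_roots[OF f])
  obtain S T where S: "\<theta> = norm_point d f (\<Prod>i<d. lin (chosen_root S z i))"
    and T: "\<theta>' = norm_point d f (\<Prod>i<d. lin (chosen_root T z i))"
    using Ex2_chosen_roots[OF f z] \<theta> by metis
  define D where "D = {i. i < d \<and> (i \<in> S) \<noteq> (i \<in> T)}"
  define a b where "a = (\<Prod>i\<in>{..<d} - D. lin (chosen_root S z i))" and "b = (\<Prod>i\<in>D. lin (chosen_root S z i))"
  have split: "splitting d f a b" and S': "\<theta> = norm_point d f (a * b)" and T': "\<theta>' = norm_point d f (a * cnjp b)"
  proof -
    have "D \<subseteq> {..<d}" "\<And>i. i < d \<Longrightarrow> (i \<in> S \<longleftrightarrow> i \<in> T) \<longleftrightarrow> i \<notin> D"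
      by (auto simp: D_def)
    note choices = splitting_of_choices[OF f z this, folded a_def b_def]
    show "splitting d f a b" by (rule choices(1))
    show "\<theta> = norm_point d f (a * b)" using S by (simp only: choices(4))
    show "\<theta>' = norm_point d f (a * cnjp b)" using T by (simp only: choices(5))
  qed
  have monic: "lead_coeff a = 1" "lead_coeff b = 1" using split by (simp_all add: splitting_def)
  have const: "p = 1" if "lead_coeff p = 1" "degree p = 0" for p :: "complex poly"
    using that by (metis degree_eq_zeroE lead_coeff_pCons(2) one_pCons)
  have "cnjp 1 = 1" by (simp add: one_pCons map_poly_pCons)
  have "degree b \<noteq> 0"
  proof
    assume "degree b = 0"
    then have "b = 1" by (rule const[OF monic(2)])
    then show False using \<theta>(3) S' T' \<open>cnjp 1 = 1\<close> by simp
  qed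
  moreover have "degree a \<noteq> 0"
  proof
    assume "degree a = 0"
    then have "a = 1" by (rule const[OF monic(1)])
    then show False using \<theta>(3) S' T' norm_point_cnjp[of d f b] by simp
  qed
  ultimately show ?thesis
    using split S' T' by (intro exI[of _ a] exI[of _ b]) simp
qed

text \<open>
  Two degrees with sum at least five are not both less than three.
\<close>
theorem generic_segments_are_faces:
  assumes d: "5 \<le> d" and f: "f \<in> generic_forms d" and \<theta>: "\<theta> \<in> Ex2 d f" "\<theta>' \<in> Ex2 d f" "\<theta> \<noteq> \<theta>'"
  shows "closed_segment \<theta> \<theta>' face_of Gram d f"
proof -
  obtain a b where ab: "splitting d f a b" "1 \<le> degree a" "1 \<le> degree b"
    "\<theta> = norm_point d f (a * b)" "\<theta>' = norm_point d f (a * cnjp b)"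
    using Ex2_pair_splitting[OF f \<theta>] by blast
  have "3 \<le> degree a \<or> 3 \<le> degree b"
    using ab(1) d by (auto simp: splitting_def)
  then show ?thesis
    using splitting_face[OF f ab(1-3)] ab \<theta> by simp
qed

section \<open>Octics\<close>

lemma splitting_form:
  assumes f: "f \<in> generic_forms d" and split: "splitting d f a b"
  defines "a1 \<equiv> scaled_re d f a" and "a2 \<equiv> scaled_im d f a"
    and "b1 \<equiv> re_form (degree b) b" and "b2 \<equiv> im_form (degree b) b"
  shows "f = (a1 * a1 + a2 * a2) * (b1 * b1 + b2 * b2)"
    and "a1 \<in> forms (degree a)" "a2 \<in> forms (degree a)" "b1 \<in> forms (degree b)" "b2 \<in> forms (degree b)"
proof -
  show mem: "a1 \<in> forms (degree a)" "a2 \<in> forms (degree a)" "b1 \<in> forms (degree b)" "b2 \<in> forms (degree b)"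
    unfolding a1_def a2_def b1_def b2_def
    by (intro subspace_scale[OF forms_subspace] re_form_in_forms im_form_in_forms)+
  have d: "d = degree a + degree b" using split by (simp add: splitting_def)
  have lr: "(lead_root d f)\<^sup>2 = lookup f (2 * d, 0)"
    using f by (simp add: lead_root_def generic_forms_def)
  let ?A = "smult (of_real (lead_root d f)) a"
  have deg: "degree ?A \<le> degree a" by (rule degree_smult_le)
  show "f = (a1 * a1 + a2 * a2) * (b1 * b1 + b2 * b2)"
  proof (rule dehom_inject[OF dehom_generic(1)[OF f]])
    have "(a1 * a1 + a2 * a2) * (b1 * b1 + b2 * b2) \<in> forms ((degree a + degree a) + (degree b + degree b))"
      by (intro forms_mult subspace_add[OF forms_subspace] mem)
    then show "(a1 * a1 + a2 * a2) * (b1 * b1 + b2 * b2) \<in> forms (2 * d)"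
      by (simp add: d mult_2 add_ac)
    have "dehom ((a1 * a1 + a2 * a2) * (b1 * b1 + b2 * b2)) = (?A * cnjp ?A) * (b * cnjp b)"
      unfolding dehom_mult[of "_ + _"]
      using dehom_norm_form[OF deg] dehom_norm_form[of b "degree b"]
      by (simp add: a1_def a2_def b1_def b2_def re_form_scale im_form_scale)
    also have "\<dots> = dehom f"
      using split lr by (simp add: splitting_def power2_eq_square of_real_mult[symmetric] mult_ac del: of_real_mult)
    finally show "dehom f = dehom ((a1 * a1 + a2 * a2) * (b1 * b1 + b2 * b2))" by simp
  qed
qed

text \<open>
  With \<open>p = a1 b1 - a2 b2\<close> and \<open>q = a1 b2 + a2 b1\<close>, independence of the nine products implies
  independence of \<open>p\<^sup>2\<close>, \<open>p q\<close>, \<open>q\<^sup>2\<close>.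
\<close>
lemma splitting_Ex2:
  assumes f: "f \<in> generic_forms d" and split: "splitting d f a b" and deg: "3 \<le> degree a" "1 \<le> degree b"
  shows "norm_point d f (a * b) \<in> Ex2 d f"
proof -
  define a1 a2 b1 b2 where "a1 = scaled_re d f a" and "a2 = scaled_im d f a"
    and "b1 = re_form (degree b) b" and "b2 = im_form (degree b) b"
  have indep: "biquadratic_indep a1 a2 b1 b2"
    unfolding a1_def a2_def b1_def b2_def by (rule splitting_biquadratic_indep[OF f split deg])
  note form = splitting_form[OF f split, folded a1_def a2_def b1_def b2_def]
  have d: "degree a + degree b = d" using split by (simp add: splitting_def)
  let ?p = "a1 * b1 - a2 * b2" and ?q = "a1 * b2 + a2 * b1"
  have "tensor ?p ?p + tensor ?q ?q \<in> Ex2 d (?p * ?p + ?q * ?q)"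
  proof (rule two_squares_Ex2)
    show "?p \<in> forms d" "?q \<in> forms d"
      unfolding d[symmetric]
      by (intro subspace_add[OF forms_subspace] subspace_diff[OF forms_subspace] forms_mult form)+
    fix x y z
    assume 0: "x *\<^sub>R (?p * ?p) + y *\<^sub>R (?p * ?q) + z *\<^sub>R (?q * ?q) = 0"
    have "?p * ?p = a1 * a1 * (b1 * b1) - 2 *\<^sub>R (a1 * a2 * (b1 * b2)) + a2 * a2 * (b2 * b2)"
      "?q * ?q = a1 * a1 * (b2 * b2) + 2 *\<^sub>R (a1 * a2 * (b1 * b2)) + a2 * a2 * (b1 * b1)"
      "?p * ?q = a1 * a1 * (b1 * b2) + a1 * a2 * (b1 * b1) - a1 * a2 * (b2 * b2) - a2 * a2 * (b1 * b2)"
      by (simp_all add: algebra_simps scaleR_2)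
    note 0 = 0[unfolded this]
    have "x = 0 \<and> y = 0 \<and> z = 0 \<and> y = 0 \<and> 2 * z - 2 * x = 0 \<and> - y = 0 \<and> z = 0 \<and> - y = 0 \<and> x = 0"
      by (rule biquadratic_indepD[OF indep], subst 0[symmetric], rule poly_mapping_eqI)
        (simp add: lookup_add lookup_minus algebra_simps)
    then show "x = 0 \<and> y = 0 \<and> z = 0" by blast
  qed
  moreover have "?p * ?p + ?q * ?q = f"
    unfolding form(1) by (simp add: algebra_simps)
  moreover have "norm_point d f (a * b) = tensor ?p ?p + tensor ?q ?q"
    unfolding norm_point_mult(1)[OF d] gram_tensor_def a1_def a2_def b1_def b2_def ..
  ultimately show ?thesis by simp
qed

lemma splitting_lin_indep:
  assumes f: "f \<in> generic_forms 4" and split: "splitting 4 f a b" and deg: "1 \<le> degree a" "1 \<le> degree b"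
  shows "lin_indep 4 (prods (scaled_re 4 f a) (scaled_im 4 f a)
    (re_form (degree b) b) (im_form (degree b) b))"
proof -
  have d: "degree a + degree b = 4" using split by (simp add: splitting_def)
  have s: "lead_root 4 f \<noteq> 0" using lead_root_pos[OF f] by simp
  consider "3 \<le> degree a" | "3 \<le> degree b" | "degree a = 2" "degree b = 2" using d by linarith
  then show ?thesis
  proof cases
    case 1
    then show ?thesis
      by (intro biquadratic_indep_prods splitting_biquadratic_indep[OF f split] deg)
  next
    case 2
    have "biquadratic_indep (re_form (degree b) b) (im_form (degree b) b) (re_form (degree a) a) (im_form (degree a) a)"
      using generic_minor_biquadratic_indep[OF generic_splitting_minor[OF f splitting_commute[OF split]] 2 deg(1)]
      by simp
    then show ?thesis
      by (intro lin_indep_4_scale[OF _ s] lin_indep_4_commute[OF biquadratic_indep_prods])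
  next
    case 3
    then show ?thesis
      using generic_minor_lin_indep[of a b] generic_splitting_minor[OF f split] s
      by (auto intro!: lin_indep_4_scale)
  qed
qed

text \<open>
  The two Gram tensors have different coefficients with respect to the four products.
\<close>
lemma lin_indep_4_gram_tensor_neq:
  assumes "lin_indep 4 (prods a1 a2 b1 b2)"
  shows "gram_tensor a1 a2 b1 b2 \<noteq> gram_tensor a1 a2 b1 (- b2)"
proof
  assume "gram_tensor a1 a2 b1 b2 = gram_tensor a1 a2 b1 (- b2)"
  then have "quad_tensor 4 (prods a1 a2 b1 b2) (gram_matrix 1) = quad_tensor 4 (prods a1 a2 b1 b2) (gram_matrix (- 1))"
    unfolding gram_tensor_quad_tensor(2) unfolding gram_tensor_quad_tensor(1) .
  then have "quad_tensor 4 (prods a1 a2 b1 b2) (\<lambda>s t. gram_matrix 1 s t - gram_matrix (- 1) s t) = 0"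
    unfolding quad_tensor_diff[symmetric] by simp
  from quad_tensor_eq_0[OF assms this, of 0 3] show False
    by (simp add: gram_matrix_def)
qed

lemma smult_sum_right: "smult c (\<Sum>i\<in>I. p i) = (\<Sum>i\<in>I. smult c (p i))"
  by (induction I rule: infinite_finite_induct) (simp_all add: smult_add_right)

lemma prod_const_poly: "(\<Prod>i\<in>I. [:g i:]) = [:\<Prod>i\<in>I. g i:]"
  by (induction I rule: infinite_finite_induct) (simp_all add: one_pCons mult.commute)

text \<open>
  Expanding the product of the sums of squares \<open>(x - s y)^2 + (t y)^2\<close> over all pairs of
  roots gives squares of forms of all degrees in the first variable, hence a Gram tensor of full rank.
\<close>
lemma generic_full_support:
  assumes f: "f \<in> generic_forms d" and z: "dehom f = smult (of_real ((lead_root d f)\<^sup>2)) (conj_pairs d z)"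
    and Im: "\<And>i. i < d \<Longrightarrow> Im (z i) \<noteq> 0" and M: "finite M" "card M \<le> d"
  shows "\<exists>p. (\<Sum>J\<in>Pow {..<d}. tensor (p J) (p J)) \<in> Gram d f \<and> (\<exists>J\<in>Pow {..<d}. p J \<notin> span M)"
proof -
  define l where "l i = re_form 1 (lin (z i))" for i
  define m where "m i = im_form 1 (lin (z i))" for i
  have lm: "l i \<in> forms 1" "m i \<in> forms 1" for i
    by (simp_all add: l_def m_def re_form_in_forms im_form_in_forms)
  have dl: "dehom (l i) = lin (of_real (Re (z i)))" and dm: "dehom (m i) = [:of_real (- Im (z i)):]" for i
  proof -
    show "dehom (l i) = lin (of_real (Re (z i)))"
      unfolding l_def by (subst dehom_re_form) (simp_all add: lin_def complex_eq_iff)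
    show "dehom (m i) = [:of_real (- Im (z i)):]"
      unfolding m_def by (subst dehom_im_form) (simp_all add: lin_def complex_eq_iff)
  qed
  define p where "p J = lead_root d f *\<^sub>R ((\<Prod>i\<in>J. l i) * (\<Prod>i\<in>{..<d} - J. m i))" for J
  have prod_forms: "(\<Prod>i\<in>J. q i) \<in> forms (card J)" if "\<And>i. q i \<in> forms 1" for q :: "nat \<Rightarrow> bpoly" and J
  proof (induction J rule: infinite_finite_induct)
    case (insert i J)
    then show ?case using forms_mult[OF that, of _ _ i] by simp
  qed (simp_all add: forms_def single_one[symmetric] del: single_one)
  have p_forms: "p J \<in> forms d" if "J \<in> Pow {..<d}" for J
  proof -
    have "card J + card ({..<d} - J) = d"
      using that card_mono[of "{..<d}" J] by (simp add: card_Diff_subset finite_subset)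
    then have "(\<Prod>i\<in>J. l i) * (\<Prod>i\<in>{..<d} - J. m i) \<in> forms d"
      using forms_mult[OF prod_forms[of l J, OF lm(1)] prod_forms[of m "{..<d} - J", OF lm(2)]] by simp
    then show ?thesis unfolding p_def by (intro subspace_scale[OF forms_subspace])
  qed
  have dp: "dehom (p J) = smult (of_real (lead_root d f)) ((\<Prod>i\<in>J. dehom (l i)) * (\<Prod>i\<in>{..<d} - J. dehom (m i)))" for J
  proof -
    have "dehom (\<Prod>i\<in>J. q i) = (\<Prod>i\<in>J. dehom (q i))" for q :: "nat \<Rightarrow> bpoly" and J
      by (induction J rule: infinite_finite_induct) (simp_all add: dehom_mult dehom_power[of 0 0, simplified])
    then show ?thesis by (simp add: p_def dehom_scale dehom_mult)
  qed
  have "mult_map (\<Sum>J\<in>Pow {..<d}. tensor (p J) (p J)) = (\<Sum>J\<in>Pow {..<d}. p J * p J)"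
    by (simp add: linear_sum[OF linear_mult_map] mult_map_tensor)
  also have "\<dots> = f"
  proof (rule dehom_inject[OF _ dehom_generic(1)[OF f]])
    show "(\<Sum>J\<in>Pow {..<d}. p J * p J) \<in> forms (2 * d)"
      unfolding mult_2 by (intro subspace_sum[OF forms_subspace] forms_mult p_forms)
    have sq: "lin (z i) * lin (cnj (z i)) = dehom (l i) * dehom (l i) + dehom (m i) * dehom (m i)" for i
    proof -
      have "cnjp (lin (z i)) = lin (cnj (z i))" by simp
      then show ?thesis
        using dehom_norm_form[of "lin (z i)" 1] by (simp add: dehom_add dehom_mult l_def m_def)
    qed
    have "conj_pairs d z = (\<Sum>J\<in>Pow {..<d}. (\<Prod>i\<in>J. dehom (l i) * dehom (l i)) * (\<Prod>i\<in>{..<d} - J. dehom (m i) * dehom (m i)))"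
      unfolding conj_pairs_def sq by (rule prod_add) simp
    then show "dehom (\<Sum>J\<in>Pow {..<d}. p J * p J) = dehom f"
      unfolding z by (simp add: dehom_sum dehom_mult dp prod.distrib smult_sum_right power2_eq_square mult_ac)
  qed
  finally have Gram: "(\<Sum>J\<in>Pow {..<d}. tensor (p J) (p J)) \<in> Gram d f"
    unfolding Gram_def by (intro CollectI conjI psd_sum psd_square p_forms)
  have "\<exists>J\<in>Pow {..<d}. p J \<notin> span M"
  proof (rule ccontr)
    assume "\<not> ?thesis"
    then have "p {..<j} \<in> span M" if "j < Suc d" for j
      using that by auto
    then obtain c where c: "(\<Sum>j<Suc d. c j *\<^sub>R p {..<j}) = 0" "\<exists>j<Suc d. c j \<noteq> 0"
      using span_linear_relation[of "Suc d" "\<lambda>j. p {..<j}" M] M by auto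
    define j where "j = Max {j. j < Suc d \<and> c j \<noteq> 0}"
    have "j \<in> {j. j < Suc d \<and> c j \<noteq> 0}"
      unfolding j_def using c(2) by (intro Max_in) auto
    then have j: "j \<le> d" "c j \<noteq> 0" by auto
    have above: "c i = 0" if "j < i" "i < Suc d" for i
    proof (rule ccontr)
      assume "c i \<noteq> 0"
      then have "i \<le> j" unfolding j_def using that by (intro Max_ge) auto
      then show False using that by simp
    qed
    \<comment> \<open>In the first variable \<open>p {..<j}\<close> has degree exactly \<open>j\<close>; its leading coefficient is the product
      of the remaining imaginary parts, up to sign and the factor \<open>lead_root d f\<close>.\<close>
    define e where "e i = (\<Prod>l\<in>{..<d} - {..<i}. of_real (- Im (z l)) :: complex)" for i
    have dpi: "dehom (p {..<i}) = smult (of_real (lead_root d f) * e i) (\<Prod>l<i. lin (of_real (Re (z l))))" for i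
    proof -
      have "(\<Prod>l\<in>{..<d} - {..<i}. [:of_real (- Im (z l)) :: complex:]) = [:e i:]"
        unfolding e_def by (rule prod_const_poly)
      then show ?thesis
        by (simp only: dp dl dm) (simp add: mult.commute)
    qed
    have e0: "e i \<noteq> 0" for i using Im by (auto simp: e_def)
    have low: "coeff (dehom (p {..<i})) j = 0" if "i < j" for i
    proof -
      have "degree (dehom (p {..<i})) \<le> i"
        unfolding dpi by (rule order_trans[OF degree_smult_le]) simp
      then show ?thesis using that by (intro coeff_eq_0) simp
    qed
    have top: "coeff (dehom (p {..<j})) j = of_real (lead_root d f) * e j"
      using lead_coeff_prod_lin[of "\<lambda>l. of_real (Re (z l))" "{..<j}"] by (simp add: dpi)
    have "0 = coeff (dehom (\<Sum>i<Suc d. c i *\<^sub>R p {..<i})) j" unfolding c by simp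
    also have "\<dots> = (\<Sum>i<Suc d. of_real (c i) * coeff (dehom (p {..<i})) j)"
      by (simp add: dehom_sum dehom_add dehom_scale coeff_sum)
    also have "\<dots> = (\<Sum>i<Suc d. if i = j then of_real (c j) * coeff (dehom (p {..<j})) j else 0)"
    proof (intro sum.cong refl)
      fix i assume "i \<in> {..<Suc d}"
      then show "of_real (c i) * coeff (dehom (p {..<i})) j =
          (if i = j then of_real (c j) * coeff (dehom (p {..<j})) j else 0)"
        using above[of i] low[of i] by (cases i j rule: linorder_cases) simp_all
    qed
    also have "\<dots> = of_real (c j) * (of_real (lead_root d f) * e j)"
      using j by (simp add: top)
    finally show False using j e0 lead_root_pos[OF f] by simp
  qed
  with Gram show ?thesis by blast
qed


text \<open>
  The imaginary part of a monic linear factor with a real root is zero, and then the four products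
  are dependent.
\<close>
lemma generic_octic_roots_not_real:
  assumes f: "f \<in> generic_forms 4" and z: "dehom f = smult (of_real ((lead_root 4 f)\<^sup>2)) (conj_pairs 4 z)"
    and i: "i < 4"
  shows "Im (z i) \<noteq> 0"
proof
  assume "Im (z i) = 0"
  have sub: "{i} \<subseteq> {..<4}" using i by simp
  have "(l \<in> UNIV \<longleftrightarrow> l \<in> - {i}) \<longleftrightarrow> l \<notin> {i}" for l by auto
  note choices = splitting_of_choices[OF f z sub this]
  have b: "(\<Prod>l\<in>{i}. lin (chosen_root UNIV z l)) = lin (z i)"
    by (simp add: chosen_root_def)
  have "im_form 1 (lin (z i)) = 0"
  proof (rule dehom_inject[OF im_form_in_forms])
    show "0 \<in> forms 1" by (simp add: forms_def)
    have "cnj (z i) = z i" using \<open>Im (z i) = 0\<close> by (simp add: complex_eq_iff)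
    then show "dehom (im_form 1 (lin (z i))) = dehom 0"
      by (simp add: dehom_im_form)
  qed
  then have "lin_indep 4 (prods (lead_root 4 f *\<^sub>R re_form 3 (\<Prod>l\<in>{..<4} - {i}. lin (chosen_root UNIV z l)))
      (lead_root 4 f *\<^sub>R im_form 3 (\<Prod>l\<in>{..<4} - {i}. lin (chosen_root UNIV z l))) (re_form 1 (lin (z i))) 0)"
    using splitting_lin_indep[OF f choices(1)] choices(2,3) b by simp
  from this[unfolded lin_indep_4_iff, rule_format, of 0 1 0 0] show False by simp
qed

text \<open>
  A point of rank two in an octic Gram spectrahedron corresponds to a choice of one root from
  each of the four conjugate pairs, up to conjugating all of them.
\<close>
locale generic_octic =
  fixes f :: bpoly and z :: "nat \<Rightarrow> complex"
  assumes f: "f \<in> generic_forms 4"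
    and z: "dehom f = smult (of_real ((lead_root 4 f)\<^sup>2)) (conj_pairs 4 z)"
begin

definition point :: "nat set \<Rightarrow> btensor" where
  "point S = norm_point 4 f (\<Prod>i<4. lin (chosen_root S z i))"

lemma point_Compl: "point (- S) = point S"
proof -
  have "(\<Prod>i<4. lin (chosen_root (- S) z i)) = cnjp (\<Prod>i<4. lin (chosen_root S z i))"
    unfolding cnjp_prod by (intro prod.cong refl) (simp add: chosen_root_def)
  then show ?thesis by (simp add: point_def norm_point_cnjp)
qed

lemma point_cong: "S \<inter> {..<4} = T \<inter> {..<4} \<Longrightarrow> point S = point T"
  unfolding point_def by (intro arg_cong[where f = "norm_point 4 f"] prod.cong refl) (auto simp: chosen_root_def)

text \<open>
  Choices inside \<open>{..<3}\<close> agree on the last root, so that both factors have positive degree.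
\<close>
lemma point_pair:
  assumes ST: "S \<subseteq> {..<3}" "T \<subseteq> {..<3}" "S \<noteq> T"
  obtains a b where "splitting 4 f a b" "1 \<le> degree a" "1 \<le> degree b"
    "even (degree b) \<longleftrightarrow> (even (card S) \<longleftrightarrow> even (card T))"
    "point S = norm_point 4 f (a * b)" "point T = norm_point 4 f (a * cnjp b)"
proof -
  define D where "D = (S - T) \<union> (T - S)"
  have D: "D \<subseteq> {..<3}" "D \<noteq> {}" using ST by (auto simp: D_def)
  have fin: "finite S" "finite T" "finite D"
    using ST(1,2) D(1) by (meson finite_lessThan finite_subset)+
  have "D \<subseteq> {..<4}" using D by fastforce
  moreover have "(i \<in> S \<longleftrightarrow> i \<in> T) \<longleftrightarrow> i \<notin> D" for i by (auto simp: D_def)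
  ultimately have "D \<subseteq> {..<4}" "\<And>i. i < 4 \<Longrightarrow> (i \<in> S \<longleftrightarrow> i \<in> T) \<longleftrightarrow> i \<notin> D" by blast+
  note choices = splitting_of_choices[OF f z this]
  have "card D \<le> 3" using D card_mono[of "{..<3::nat}" D] by simp
  moreover have "1 \<le> card D" using D fin by (simp add: Suc_le_eq card_gt_0_iff)
  moreover have "card D + 2 * card (S \<inter> T) = card S + card T"
  proof -
    have "card D = card (S - T) + card (T - S)"
      unfolding D_def using fin by (intro card_Un_disjoint) auto
    moreover have "card S = card (S - T) + card (S \<inter> T)" "card T = card (T - S) + card (S \<inter> T)"
      using fin card_Int_Diff[of S T] card_Int_Diff[of T S] by (simp_all add: Int_commute)
    ultimately show ?thesis by simp
  qed
  then have "even (card D + 2 * card (S \<inter> T)) \<longleftrightarrow> even (card S + card T)" by simp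
  then have "even (card D) \<longleftrightarrow> (even (card S) \<longleftrightarrow> even (card T))" by simp
  ultimately show thesis
    using choices by (intro that) (simp_all add: point_def)
qed

lemma inj_on_point: "inj_on point (Pow {..<3})"
proof (rule inj_onI, rule ccontr)
  fix S T assume "S \<in> Pow {..<3}" "T \<in> Pow {..<3}" and eq: "point S = point T" and "S \<noteq> T"
  then have "S \<subseteq> {..<3}" "T \<subseteq> {..<3}" by simp_all
  from point_pair[OF this \<open>S \<noteq> T\<close>]
  obtain a b where ab: "splitting 4 f a b" "1 \<le> degree a" "1 \<le> degree b"
    "point S = norm_point 4 f (a * b)" "point T = norm_point 4 f (a * cnjp b)" .
  have d: "degree a + degree b = 4" using ab by (simp add: splitting_def)
  show False
    using lin_indep_4_gram_tensor_neq[OF splitting_lin_indep[OF f ab(1-3)]] eq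
    unfolding ab(4,5) norm_point_mult[OF d] by simp
qed

text \<open>
  Conjugating all roots replaces a choice by its complement. So the choices may be normalised to omit
  the last root.
\<close>
lemma Ex2_eq: "Ex2 4 f = point ` Pow {..<3}"
proof (intro equalityI subsetI)
  fix \<theta> assume "\<theta> \<in> Ex2 4 f"
  then obtain S where S: "\<theta> = point S"
    using Ex2_chosen_roots[OF f z] unfolding point_def by blast
  define T where "T = (if 3 \<in> S then - S else S) \<inter> {..<3}"
  have "T \<inter> {..<4} = (if 3 \<in> S then - S else S) \<inter> {..<4}"
  proof -
    have "{..<4} = insert 3 {..<3::nat}" by auto
    then show ?thesis by (auto simp: T_def)
  qed
  then have "point T = point (if 3 \<in> S then - S else S)" by (rule point_cong)
  also have "\<dots> = \<theta>" using S point_Compl by simp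
  finally show "\<theta> \<in> point ` Pow {..<3}" by (auto simp: T_def)
next
  fix \<theta> assume "\<theta> \<in> point ` Pow {..<3}"
  then obtain S where S: "\<theta> = point S" by blast
  \<comment> \<open>Split off the last root; any choice that differs from \<open>S\<close> there serves to name the splitting.\<close>
  have "{3} \<subseteq> {..<4::nat}" "\<And>i. (i \<in> S \<longleftrightarrow> i \<in> (S - {3}) \<union> ({3} - S)) \<longleftrightarrow> i \<notin> {3::nat}" by auto
  note choices = splitting_of_choices[OF f z this]
  show "\<theta> \<in> Ex2 4 f"
    unfolding S point_def choices(4) by (rule splitting_Ex2[OF f choices(1)]) (unfold choices, simp_all)
qed

text \<open>
  The degree of \<open>b\<close> is the number of places where the choices differ: one, two or three.
\<close>
lemma edge_iff:
  assumes ST: "S \<subseteq> {..<3}" "T \<subseteq> {..<3}" "S \<noteq> T"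
  shows "closed_segment (point S) (point T) face_of Gram 4 f \<longleftrightarrow> (even (card S) \<longleftrightarrow> odd (card T))"
proof -
  obtain a b where ab: "splitting 4 f a b" "1 \<le> degree a" "1 \<le> degree b"
    "even (degree b) \<longleftrightarrow> (even (card S) \<longleftrightarrow> even (card T))"
    "point S = norm_point 4 f (a * b)" "point T = norm_point 4 f (a * cnjp b)"
    using point_pair[OF ST] .
  have d: "degree a + degree b = 4" using ab by (simp add: splitting_def)
  show ?thesis
  proof (cases "odd (degree b)")
    case True
    have "degree b \<noteq> 2" using True by auto
    then have "3 \<le> degree a \<or> 3 \<le> degree b" using d by linarith
    moreover have "point S \<in> Ex2 4 f" "point T \<in> Ex2 4 f"
      using ST by (auto simp: Ex2_eq)
    ultimately have "closed_segment (point S) (point T) face_of Gram 4 f"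
      using splitting_face[OF f ab(1-3)] ab(5,6) by simp
    then show ?thesis using True ab(4) by blast
  next
    case False
    then obtain l where l: "degree b = 2 * l" by (auto elim: evenE)
    then have "l = 1" using ab(2,3) d by linarith
    then have deg: "degree b = 2" "degree a = 2" using l d by simp_all
    have "\<not> closed_segment (point S) (point T) face_of Gram 4 f"
      unfolding ab(5,6) norm_point_mult[OF d] unfolding deg
      by (rule two_two_not_face[OF splitting_form(2-5)[OF f ab(1), unfolded deg]
            splitting_lin_indep[OF f ab(1-3), unfolded deg] splitting_form(1)[OF f ab(1), unfolded deg]])
    then show ?thesis using False ab(4) by blast
  qed
qed

text \<open>
  The points of the segment are supported on the span of four products.
\<close>
lemma segment_in_boundary:
  assumes ST: "S \<subseteq> {..<3}" "T \<subseteq> {..<3}" "S \<noteq> T"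
  shows "closed_segment (point S) (point T) \<subseteq> rel_frontier (Gram 4 f)"
proof
  fix x assume x: "x \<in> closed_segment (point S) (point T)"
  obtain a b where ab: "splitting 4 f a b"
    "point S = norm_point 4 f (a * b)" "point T = norm_point 4 f (a * cnjp b)"
    using point_pair[OF ST] by metis
  have d: "degree a + degree b = 4" using ab by (simp add: splitting_def)
  let ?u = "prods (scaled_re 4 f a) (scaled_im 4 f a)
    (re_form (degree b) b) (im_form (degree b) b)"
  have "card (?u ` {..<4}) \<le> 4"
    using card_image_le[of "{..<4::nat}" ?u] by simp
  then obtain p :: "nat set \<Rightarrow> bpoly" where p: "(\<Sum>J\<in>Pow {..<4}. tensor (p J) (p J)) \<in> Gram 4 f" "\<exists>J\<in>Pow {..<4}. p J \<notin> span (?u ` {..<4})"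
    using generic_full_support[OF f z generic_octic_roots_not_real[OF f z], of "?u ` {..<4}"] by blast
  then obtain J where J: "J \<in> Pow {..<4}" "p J \<notin> span (?u ` {..<4})" by blast
  have "point S \<in> Gram 4 f" "point T \<in> Gram 4 f"
    using ST Ex2_eq by (auto simp: Ex2_def extreme_point_of_def)
  then have "x \<in> Gram 4 f"
    using x convex_Gram closed_segment_subset by blast
  then show "x \<in> rel_frontier (Gram 4 f)"
  proof (rule small_support_rel_frontier[OF _ p(1) _ J subspace_span])
    fix l :: "bpoly \<Rightarrow> real"
    assume l: "linear l" "\<And>w. w \<in> span (?u ` {..<4}) \<Longrightarrow> l w = 0"
    show "quad_form x l = 0"
    proof (rule quad_form_segment_gram_tensor[OF l(1)])
      show "l (?u s) = 0" if "s < 4" for s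
        using that by (intro l(2) span_base) auto
      show "x \<in> closed_segment (gram_tensor (scaled_re 4 f a) (scaled_im 4 f a)
          (re_form (degree b) b) (im_form (degree b) b))
        (gram_tensor (scaled_re 4 f a) (scaled_im 4 f a)
          (re_form (degree b) b) (- im_form (degree b) b))"
        using x unfolding ab(2,3) norm_point_mult[OF d] .
    qed
  qed simp
qed

definition even_points :: "btensor set" where
  "even_points = point ` {S. S \<subseteq> {..<3} \<and> even (card S)}"

definition odd_points :: "btensor set" where
  "odd_points = point ` {S. S \<subseteq> {..<3} \<and> odd (card S)}"

lemma card_even_odd_subsets:
  "card {S. S \<subseteq> {..<3::nat} \<and> even (card S)} = 4" "card {S. S \<subseteq> {..<3::nat} \<and> odd (card S)} = 4"
proof -
  let ?E = "{S. S \<subseteq> {..<3::nat} \<and> even (card S)}" and ?O = "{S. S \<subseteq> {..<3::nat} \<and> odd (card S)}"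
  \<comment> \<open>Toggling one element exchanges even and odd subsets.\<close>
  let ?t = "\<lambda>S. if 0 \<in> S then S - {0} else insert (0::nat) S"
  have flip: "?t S \<subseteq> {..<3} \<and> (even (card (?t S)) \<longleftrightarrow> odd (card S)) \<and> ?t (?t S) = S" if "S \<subseteq> {..<3}" for S
  proof -
    have fin: "finite S" by (rule finite_subset[OF that finite_lessThan])
    have "even (card (?t S)) \<longleftrightarrow> odd (card S)"
    proof (cases "0 \<in> S")
      case True
      define n where "n = card (S - {0})"
      have n: "card S = Suc n" unfolding n_def by (rule card_Suc_Diff1[OF fin True, symmetric])
      then show ?thesis unfolding n using True by (simp only: if_True n_def[symmetric]) simp
    qed (use fin in simp)
    then show ?thesis using that by (auto simp: insert_absorb)
  qed
  have "bij_betw ?t ?E ?O"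
    by (rule bij_betw_byWitness[where f' = ?t]) (use flip in blast)+
  then have "card ?E = card ?O" by (rule bij_betw_same_card)
  moreover have "card ?E + card ?O = card (?E \<union> ?O)"
    by (rule card_Un_disjoint[symmetric]) (auto intro: finite_subset[of _ "Pow {..<3}"])
  moreover have "?E \<union> ?O = Pow {..<3}" by auto
  ultimately show "card ?E = 4" "card ?O = 4"
    by (simp_all add: card_Pow)
qed

lemma even_odd_points:
  "Ex2 4 f = even_points \<union> odd_points" "even_points \<inter> odd_points = {}"
  "card even_points = 4" "card odd_points = 4" "finite (Ex2 4 f)"
proof -
  show "Ex2 4 f = even_points \<union> odd_points"
    unfolding Ex2_eq even_points_def odd_points_def by blast
  have inj: "S = T" if "point S = point T" "S \<subseteq> {..<3}" "T \<subseteq> {..<3}" for S T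
    using inj_onD[OF inj_on_point that(1)] that by simp
  show "even_points \<inter> odd_points = {}"
    unfolding even_points_def odd_points_def using inj by blast
  have "inj_on point {S. S \<subseteq> {..<3} \<and> even (card S)}" "inj_on point {S. S \<subseteq> {..<3} \<and> odd (card S)}"
    by (rule inj_on_subset[OF inj_on_point], blast)+
  then show "card even_points = 4" "card odd_points = 4"
    by (simp_all only: even_points_def odd_points_def card_image card_even_odd_subsets)
  show "finite (Ex2 4 f)" unfolding Ex2_eq by simp
qed

lemma edge_set:
  "{(\<theta>, \<theta>'). \<theta> \<in> Ex2 4 f \<and> \<theta>' \<in> Ex2 4 f \<and> \<theta> \<noteq> \<theta>' \<and> closed_segment \<theta> \<theta>' face_of Gram 4 f} =
    even_points \<times> odd_points \<union> odd_points \<times> even_points"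
proof -
  have edge: "\<theta> \<in> even_points \<and> \<theta>' \<in> odd_points \<or> \<theta> \<in> odd_points \<and> \<theta>' \<in> even_points"
    if "\<theta> \<in> Ex2 4 f" "\<theta>' \<in> Ex2 4 f" "\<theta> \<noteq> \<theta>'" "closed_segment \<theta> \<theta>' face_of Gram 4 f" for \<theta> \<theta>'
  proof -
    obtain S T where "\<theta> = point S" "\<theta>' = point T" "S \<subseteq> {..<3}" "T \<subseteq> {..<3}"
      using \<open>\<theta> \<in> Ex2 4 f\<close> \<open>\<theta>' \<in> Ex2 4 f\<close> unfolding Ex2_eq by blast
    then show ?thesis
      using that(3,4) edge_iff[of S T] unfolding even_points_def odd_points_def by blast
  qed
  have face: "closed_segment \<theta> \<theta>' face_of Gram 4 f" if parity: "\<theta> \<in> even_points" "\<theta>' \<in> odd_points" for \<theta> \<theta>'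
  proof -
    obtain S T where ST: "\<theta> = point S" "\<theta>' = point T" "S \<subseteq> {..<3}" "T \<subseteq> {..<3}" "even (card S)" "odd (card T)"
      using parity unfolding even_points_def odd_points_def by blast
    then have "S \<noteq> T" by blast
    then show ?thesis using ST edge_iff[of S T] by simp
  qed
  have face': "closed_segment \<theta> \<theta>' face_of Gram 4 f" if "\<theta> \<in> odd_points" "\<theta>' \<in> even_points" for \<theta> \<theta>'
    using face[OF that(2,1)] by (simp add: closed_segment_commute)
  show ?thesis
  proof (intro equalityI subsetI)
    fix x assume "x \<in> even_points \<times> odd_points \<union> odd_points \<times> even_points"
    then show "x \<in> {(\<theta>, \<theta>'). \<theta> \<in> Ex2 4 f \<and> \<theta>' \<in> Ex2 4 f \<and> \<theta> \<noteq> \<theta>' \<and> closed_segment \<theta> \<theta>' face_of Gram 4 f}"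
      using even_odd_points(1,2) face face' by auto
  qed (use edge in auto)
qed

lemma octic_graph:
  "card (Ex2 4 f) = 8"
  "card {{\<theta>, \<theta>'} |\<theta> \<theta>'. \<theta> \<in> Ex2 4 f \<and> \<theta>' \<in> Ex2 4 f \<and> \<theta> \<noteq> \<theta>' \<and> closed_segment \<theta> \<theta>' face_of Gram 4 f} = 16"
  "complete_bipartite_digraph 4 4 (with_proj (edge_graph 4 f))"
proof -
  note parts = even_odd_points
  have fin: "finite even_points" "finite odd_points" using parts(1,5) by (metis finite_Un)+
  show "card (Ex2 4 f) = 8"
    unfolding parts(1) using parts fin by (subst card_Un_disjoint) auto
  have "{{\<theta>, \<theta>'} |\<theta> \<theta>'. \<theta> \<in> Ex2 4 f \<and> \<theta>' \<in> Ex2 4 f \<and> \<theta> \<noteq> \<theta>' \<and> closed_segment \<theta> \<theta>' face_of Gram 4 f} =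
      (\<lambda>(\<theta>, \<theta>'). {\<theta>, \<theta>'}) ` {(\<theta>, \<theta>'). \<theta> \<in> Ex2 4 f \<and> \<theta>' \<in> Ex2 4 f \<and> \<theta> \<noteq> \<theta>' \<and> closed_segment \<theta> \<theta>' face_of Gram 4 f}"
    by auto
  also have "\<dots> = (\<lambda>(\<theta>, \<theta>'). {\<theta>, \<theta>'}) ` (even_points \<times> odd_points)"
    unfolding edge_set by (auto simp: image_Un insert_commute)
  finally have "card {{\<theta>, \<theta>'} |\<theta> \<theta>'. \<theta> \<in> Ex2 4 f \<and> \<theta>' \<in> Ex2 4 f \<and> \<theta> \<noteq> \<theta>' \<and> closed_segment \<theta> \<theta>' face_of Gram 4 f} =
      card ((\<lambda>(\<theta>, \<theta>'). {\<theta>, \<theta>'}) ` (even_points \<times> odd_points))"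
    by (rule arg_cong)
  also have "\<dots> = card (even_points \<times> odd_points)"
  proof (rule card_image, rule inj_onI, clarify)
    fix \<theta> \<theta>' \<eta> \<eta>'
    assume "\<theta> \<in> even_points" "\<theta>' \<in> odd_points" "\<eta> \<in> even_points" "\<eta>' \<in> odd_points" "{\<theta>, \<theta>'} = {\<eta>, \<eta>'}"
    then show "\<theta> = \<eta> \<and> \<theta>' = \<eta>'" using parts(2) by (auto simp: doubleton_eq_iff)
  qed
  finally show "card {{\<theta>, \<theta>'} |\<theta> \<theta>'. \<theta> \<in> Ex2 4 f \<and> \<theta>' \<in> Ex2 4 f \<and> \<theta> \<noteq> \<theta>' \<and> closed_segment \<theta> \<theta>' face_of Gram 4 f} = 16"
    by (simp add: card_cartesian_product parts)
  show "complete_bipartite_digraph 4 4 (with_proj (edge_graph 4 f))"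
  proof -
    have "finite (pverts (edge_graph 4 f))" "pverts (edge_graph 4 f) = even_points \<union> odd_points"
      using parts(1,5) by (simp_all add: edge_graph_def)
    moreover have "parcs (edge_graph 4 f) = even_points \<times> odd_points \<union> odd_points \<times> even_points"
      using edge_set by (simp add: edge_graph_def)
    ultimately show ?thesis
      unfolding complete_bipartite_digraph_pair_def using parts(2-4) by blast
  qed
qed

end

theorem theorem6p4:
  fixes d :: nat
  assumes "d \<ge> 4"
  shows "\<exists>U. openin (top_of_set (sos_cone d)) U \<and> sos_cone d \<subseteq> closure U \<and>
    (\<forall>f\<in>U.
      (d = 4 \<longrightarrow>
        card (Ex2 d f) = 8 \<and>
        (\<forall>\<theta>\<in>Ex2 d f. \<forall>\<theta>'\<in>Ex2 d f. \<theta> \<noteq> \<theta>' \<longrightarrow>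
           closed_segment \<theta> \<theta>' \<subseteq> rel_frontier (Gram d f)) \<and>
        card {{\<theta>, \<theta>'} |\<theta> \<theta>'. \<theta> \<in> Ex2 d f \<and> \<theta>' \<in> Ex2 d f \<and> \<theta> \<noteq> \<theta>' \<and>
                closed_segment \<theta> \<theta>' face_of Gram d f} = 16 \<and>
        complete_bipartite_digraph 4 4 (with_proj (edge_graph d f))) \<and>
      (d \<ge> 5 \<longrightarrow>
        (\<forall>\<theta>\<in>Ex2 d f. \<forall>\<theta>'\<in>Ex2 d f. \<theta> \<noteq> \<theta>' \<longrightarrow>
           closed_segment \<theta> \<theta>' face_of Gram d f)))"
proof (intro exI[of _ "generic_forms d"] conjI ballI impI)
  show "openin (top_of_set (sos_cone d)) (generic_forms d)" by (rule openin_generic_forms)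
  show "sos_cone d \<subseteq> closure (generic_forms d)" by (rule generic_forms_dense)
  fix f assume f: "f \<in> generic_forms d"
  show "closed_segment \<theta> \<theta>' face_of Gram d f" if "5 \<le> d" "\<theta> \<in> Ex2 d f" "\<theta>' \<in> Ex2 d f" "\<theta> \<noteq> \<theta>'" for \<theta> \<theta>'
    using generic_segments_are_faces f that by blast
  assume d: "d = 4"
  obtain z where "dehom f = smult (of_real ((lead_root 4 f)\<^sup>2)) (conj_pairs 4 z)"
    using generic_roots f d by metis
  then interpret generic_octic f z
    using f d by unfold_locales simp_all
  show "card (Ex2 d f) = 8"
    "card {{\<theta>, \<theta>'} |\<theta> \<theta>'. \<theta> \<in> Ex2 d f \<and> \<theta>' \<in> Ex2 d f \<and> \<theta> \<noteq> \<theta>' \<and> closed_segment \<theta> \<theta>' face_of Gram d f} = 16"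
    "complete_bipartite_digraph 4 4 (with_proj (edge_graph d f))"
    unfolding d by (rule octic_graph)+
  fix \<theta> \<theta>' assume "\<theta> \<in> Ex2 d f" "\<theta>' \<in> Ex2 d f" "\<theta> \<noteq> \<theta>'"
  then obtain S T where "\<theta> = point S" "\<theta>' = point T" "S \<subseteq> {..<3}" "T \<subseteq> {..<3}" "S \<noteq> T"
    unfolding d Ex2_eq by blast
  then show "closed_segment \<theta> \<theta>' \<subseteq> rel_frontier (Gram d f)"
    unfolding d using segment_in_boundary by simp
qed

end
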